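(* Suppose Assumptions 1 and 2 (stated in the context) hold, and let $\hat\mu(x)$ be the Mondrian random forest estimator with lifetime $\lambda=\lambda_n$ and $B=B_n$ trees. Then $$\mathbb{E}\left[\big(\hat\mu(x)-\mu(x)\big)^2\right]\lesssim \frac{\lambda^d}{n}+\frac{1}{\lambda^{2(2\wedge\beta)}}+\frac{1}{\lambda^{2(1\wedge\beta)}B}.$$ If further $\lambda\asymp n^{\frac{1}{d+2(2\wedge\beta)}}$ and $B\gtrsim n^{\frac{2(2\wedge\beta)-2(1\wedge\beta)}{d+2(2\wedge\beta)}}$, then $$\mathbb{E}\left[\big(\hat\mu(x)-\mu(x)\big)^2\right]\lesssim n^{-\frac{2(2\wedge\beta)}{d+2(2\wedge\beta)}}.$$
   Context: Notation. $\mathbb{N}=\{0,1,2,\dots\}$; $a\wedge b$ and $a\vee b$ are minimum and maximum. For non-negative sequences, $a_n\lesssim b_n$ (equivalently $b_n\gtrsim a_n$) means $a_n/b_n$ is bounded over $n\ge1$ (the bound may depend on fixed quantities such as $d$, $x$, the law of the data and the sequences $\lambda_n,B_n$, but not on $n$); $a_n\asymp b_n$ means $a_n\lesssim b_n\lesssim a_n$. $\mathbb{I}$ denotes an indicator. Hölder classes. For $\beta>0$ let $\underline{\beta}=\lceil\beta-1\rceil$ be the largest integer strictly less than $\beta$. Write $g\in\mathcal{H}^\beta$ if $g:[0,1]^d\to\mathbb{R}$ is $\underline\beta$ times differentiable and, for some $C>0$, $\max_{|\nu|=\underline\beta}|\partial^\nu g(x)-\partial^\nu g(x')|\le C\|x-x'\|_2^{\beta-\underline\beta}$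 for all $x,x'\in[0,1]^d$ ($\nu\in\mathbb{N}^d$ a multi-index). Assumption 1 (data). Fix $d\ge1$. $(X_i,Y_i)$, $1\le i\le n$, are i.i.d. from a distribution on $\mathbb{R}^d\times\mathbb{R}$; $\mathbf{X}=(X_1,\dots,X_n)$. $X_i$ has a Lebesgue density $f$ on $[0,1]^d$, bounded away from zero, with $f\in\mathcal{H}^{\beta_f}$ for some $\beta_f>0$. $\mathbb{E}[Y_i^2\mid X_i]$ is bounded, $\mu(X_i)=\mathbb{E}[Y_i\mid X_i]$ with $\mu\in\mathcal{H}^{\beta_\mu}$, $\beta_\mu>0$. With $\varepsilon_i=Y_i-\mu(X_i)$, $\sigma^2(X_i)=\mathbb{E}[\varepsilon_i^2\mid X_i]$ is bounded away from zero with $\sigma^2\in\mathcal{H}^{\beta_\sigma}$, $\beta_\sigma>0$. Set $\beta=\beta_\mu\wedge(\beta_f+1)$. Mondrian process $\mathcal{M}([0,1]^d,\lambda)$. For a rectangle $D=\prod_j[a_j,b_j]\subseteq[0,1]^d$ let $|D_j|=b_j-a_j$, $|D|=\prod_j|D_j|$, $|D|_1=\sum_j|D_j|$. Start at time $0$ with the trivial partition of $[0,1]^d$. For each cell $D$, formed at time $t_D$, sample $E_D\sim\mathrm{Exp}(|D|_1)$ (rate $|D|_1$) independently. If $t_D+E_D\le\lambda$, split $D$: choose coordinate $J$ with $\mathbb{P}(J=j)=|D_j|/|D|_1$ and location $S_J\sim\mathrm{Unif}[a_J,b_J]$, producing cells $\{x\in D:x_J\le S_J\}$ and $\{x\in D:x_J>S_J\}$,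 each formed at time $t_D+E_D$. The output $T$ is the partition consisting of the cells not split (those with $t_D+E_D>\lambda$); $T(x)$ is the cell containing $x$. Mondrian random forest. $\mathbf{T}=(T_1,\dots,T_B)$ are i.i.d. $\mathcal{M}([0,1]^d,\lambda)$, independent of the data; $N_b(x)=\sum_{i=1}^n\mathbb{I}\{X_i\in T_b(x)\}$; $\hat\mu(x)=\frac1B\sum_{b=1}^B\frac{\sum_{i=1}^nY_i\,\mathbb{I}\{X_i\in T_b(x)\}}{N_b(x)}$, with $0/0=0$. Assumption 2 (estimator). $x\in(0,1)^d$ is a fixed point; $\lambda=\lambda_n>0$ and $B=B_n\ge1$ satisfy $\lambda\gtrsim(\log n)^3$, $n/\lambda^d\to\infty$, and $B\gtrsim(\log n)^d$. The dimension $d$ does not depend on $n$. *)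

theory Defs
  imports "HOL-Probability.Probability"
begin

text \<open>The constant is uniform over \<open>n \<ge> 1\<close>, not only eventually.\<close>

definition lesssim :: "(nat \<Rightarrow> real) \<Rightarrow> (nat \<Rightarrow> real) \<Rightarrow> bool" (infix \<open>\<lessapprox>\<close> 50) where
  "a \<lessapprox> b \<longleftrightarrow> (\<exists>C. \<forall>n\<ge>1. a n \<le> C * b n)"

definition same_order :: "(nat \<Rightarrow> real) \<Rightarrow> (nat \<Rightarrow> real) \<Rightarrow> bool" where
  "same_order a b \<longleftrightarrow> a \<lessapprox> b \<and> b \<lessapprox> a"

abbreviation cube :: "(real ^ 'd) set" where
  "cube \<equiv> cbox 0 1"

text \<open>
  Derivatives are taken within the cube, so they are one-sided on its boundary; they are
  unique there because the cube has nonempty interior.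
\<close>

definition partial :: "'d::finite \<Rightarrow> (real ^ 'd \<Rightarrow> real) \<Rightarrow> real ^ 'd \<Rightarrow> real" where
  "partial i g = (\<lambda>x. frechet_derivative g (at x within cube) (axis i 1))"

text \<open>
  A multi-index \<open>\<nu>\<close> with \<open>|\<nu>| = k\<close> is given by a list of \<open>k\<close> coordinates in which \<open>i\<close> occurs
  \<open>\<nu>\<^sub>i\<close> times. For a \<open>k\<close> times differentiable function the order of the list is immaterial.
\<close>

fun partials :: "'d::finite list \<Rightarrow> (real ^ 'd \<Rightarrow> real) \<Rightarrow> real ^ 'd \<Rightarrow> real" where
  "partials [] g = g"
| "partials (i # \<nu>) g = partials \<nu> (partial i g)"

fun times_differentiable :: "nat \<Rightarrow> (real ^ 'd::finite \<Rightarrow> real) \<Rightarrow> bool" where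
  "times_differentiable 0 g \<longleftrightarrow> True"
| "times_differentiable (Suc k) g \<longleftrightarrow>
     g differentiable_on cube \<and> (\<forall>i. times_differentiable k (partial i g))"

definition holder_class :: "real \<Rightarrow> (real ^ 'd::finite \<Rightarrow> real) set" where
  "holder_class \<beta> =
     {g. let k = nat \<lceil>\<beta> - 1\<rceil> in
         times_differentiable k g \<and>
         (\<exists>C>0. \<forall>\<nu>. length \<nu> = k \<longrightarrow>
            (\<forall>x\<in>cube. \<forall>y\<in>cube. \<bar>partials \<nu> g x - partials \<nu> g y\<bar> \<le> C * norm (x - y) powr (\<beta> - k)))}"

text \<open>
  \<open>P\<close> is the law of one pair \<open>(X, Y)\<close>; conditioning on \<open>X\<close> is conditioning on the
  \<open>\<sigma>\<close>-algebra generated by the first projection. The functions \<open>f\<close>, \<open>\<mu>\<close>, \<open>\<sigma>2\<close> only matter on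
  the cube, where \<open>X\<close> lies almost surely; the indicators remove their values outside, which need
  not be measurable. The nonnegative conditional expectation is used for \<open>Y\<^sup>2\<close>, since its finiteness is
  part of what is assumed.
\<close>

definition given_X :: "('a::topological_space \<times> real) measure \<Rightarrow> ('a \<times> real) measure" where
  "given_X P = vimage_algebra (space P) fst borel"

definition data_law ::
  "(real ^ 'd::finite \<Rightarrow> real) \<Rightarrow> (real ^ 'd \<Rightarrow> real) \<Rightarrow> (real ^ 'd \<Rightarrow> real) \<Rightarrow>
   real \<Rightarrow> real \<Rightarrow> real \<Rightarrow> ((real ^ 'd) \<times> real) measure \<Rightarrow> bool" where
  "data_law f \<mu> \<sigma>2 \<beta>f \<beta>\<mu> \<beta>\<sigma> P \<longleftrightarrow>
     prob_space P \<and> sets P = sets borel \<and>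
     distributed P lborel fst (\<lambda>x. ennreal (indicator cube x * f x)) \<and>
     (\<exists>c>0. \<forall>x\<in>cube. c \<le> f x) \<and>
     \<beta>f > 0 \<and> f \<in> holder_class \<beta>f \<and>
     (\<exists>C. AE z in P. nn_cond_exp P (given_X P) (\<lambda>z. ennreal ((snd z)\<^sup>2)) z \<le> ennreal C) \<and>
     (AE z in P. real_cond_exp P (given_X P) snd z = \<mu> (fst z)) \<and>
     \<beta>\<mu> > 0 \<and> \<mu> \<in> holder_class \<beta>\<mu> \<and>
     (AE z in P. real_cond_exp P (given_X P)
        (\<lambda>z. (snd z - indicator cube (fst z) * \<mu> (fst z))\<^sup>2) z = \<sigma>2 (fst z)) \<and>
     (\<exists>c>0. \<forall>x\<in>cube. c \<le> \<sigma>2 x) \<and>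
     \<beta>\<sigma> > 0 \<and> \<sigma>2 \<in> holder_class \<beta>\<sigma>"

text \<open>
  Cells are indexed by the nodes of the infinite binary tree in heap order: the root is \<open>0\<close> and
  node \<open>p\<close> has the children \<open>2 p + 1\<close> (the part \<open>x\<^sub>J \<le> S\<^sub>J\<close>) and \<open>2 p + 2\<close> (the part
  \<open>x\<^sub>J > S\<^sub>J\<close>), so that \<open>Suc m\<close> has parent \<open>m div 2\<close>. A history attaches to every node the
  triple \<open>(E, J, S\<^sub>J)\<close> of waiting time, split coordinate and split location. It does not depend
  on the lifetime, which only determines which of the splits are carried out.
\<close>

type_synonym 'd split = "real \<times> 'd \<times> real"
type_synonym 'd history = "nat \<Rightarrow> 'd split"

definition waiting_time :: "'d history \<Rightarrow> nat \<Rightarrow> real" where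
  "waiting_time h n = fst (h n)"

definition coord :: "'d history \<Rightarrow> nat \<Rightarrow> 'd" where
  "coord h n = fst (snd (h n))"

definition loc :: "'d history \<Rightarrow> nat \<Rightarrow> real" where
  "loc h n = snd (snd (h n))"

fun lower :: "'d::finite history \<Rightarrow> nat \<Rightarrow> real ^ 'd" where
  "lower h 0 = 0"
| "lower h (Suc m) = (let p = m div 2 in
     if even m then lower h p
     else (\<chi> i. if i = coord h p then loc h p else lower h p $ i))"

fun upper :: "'d::finite history \<Rightarrow> nat \<Rightarrow> real ^ 'd" where
  "upper h 0 = 1"
| "upper h (Suc m) = (let p = m div 2 in
     if even m then (\<chi> i. if i = coord h p then loc h p else upper h p $ i)
     else upper h p)"

fun cell :: "'d::finite history \<Rightarrow> nat \<Rightarrow> (real ^ 'd) set" where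
  "cell h 0 = cube"
| "cell h (Suc m) = (let p = m div 2 in
     if even m then {x \<in> cell h p. x $ coord h p \<le> loc h p}
     else {x \<in> cell h p. x $ coord h p > loc h p})"

fun formation_time :: "'d history \<Rightarrow> nat \<Rightarrow> real" where
  "formation_time h 0 = 0"
| "formation_time h (Suc m) = formation_time h (m div 2) + waiting_time h (m div 2)"

definition split_due :: "'d history \<Rightarrow> nat \<Rightarrow> real" where
  "split_due h n = formation_time h n + waiting_time h n"

fun formed :: "real \<Rightarrow> 'd history \<Rightarrow> nat \<Rightarrow> bool" where
  "formed l h 0 \<longleftrightarrow> True"
| "formed l h (Suc m) \<longleftrightarrow> formed l h (m div 2) \<and> split_due h (m div 2) \<le> l"

definition mondrian_partition :: "real \<Rightarrow> 'd::finite history \<Rightarrow> (real ^ 'd) set set" where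
  "mondrian_partition l h = {cell h n | n. formed l h n \<and> l < split_due h n}"

text \<open>
  The member of \<open>T\<close> containing \<open>x\<close>; the union is over exactly one cell if \<open>T\<close> is a partition
  of a set containing \<open>x\<close>.
\<close>

definition cell_of :: "'a set set \<Rightarrow> 'a \<Rightarrow> 'a set" where
  "cell_of T x = \<Union>{D \<in> T. x \<in> D}"

definition split_space :: "'d::finite split measure" where
  "split_space = lborel \<Otimes>\<^sub>M (count_space UNIV \<Otimes>\<^sub>M lborel)"

text \<open>
  Joint density of \<open>(E, J, S\<^sub>J)\<close> for the cell with corners \<open>a\<close> and \<open>b\<close>: \<open>E\<close> is exponential with
  rate \<open>|D|\<^sub>1\<close> and independent of \<open>(J, S\<^sub>J)\<close>, \<open>J = j\<close> has probability \<open>|D\<^sub>j| / |D|\<^sub>1\<close>, and given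
  \<open>J = j\<close>, \<open>S\<^sub>J\<close> is uniform on \<open>[a\<^sub>j, b\<^sub>j]\<close>.
\<close>

definition split_density :: "real ^ 'd::finite \<Rightarrow> real ^ 'd \<Rightarrow> 'd split \<Rightarrow> real" where
  "split_density a b = (\<lambda>(e, j, s).
     let L = (\<Sum>i\<in>UNIV. b $ i - a $ i) in
     exponential_density L e * ((b $ j - a $ j) / L) *
     (indicator {a $ j..b $ j} s / (b $ j - a $ j)))"

text \<open>
  Degenerate cells have probability zero; they get an arbitrary law so that \<open>split_law\<close> is a
  probability kernel.
\<close>

definition split_law :: "real ^ 'd::finite \<Rightarrow> real ^ 'd \<Rightarrow> 'd split measure" where
  "split_law a b =
     (if \<forall>i. a $ i < b $ i then density split_space (\<lambda>z. ennreal (split_density a b z))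
      else return split_space (0, undefined, 0))"

lemma prob_space_split_density:
  fixes a b :: "real ^ 'd::finite"
  assumes ab: "\<And>i. a $ i < b $ i"
  shows "prob_space (density split_space (\<lambda>z. ennreal (split_density a b z)))"
proof -
  define L where "L = (\<Sum>i\<in>UNIV. b $ i - a $ i)"
  have L: "L > 0" unfolding L_def using ab by (intro sum_pos) auto
  define u where "u = (\<lambda>(j, s). ennreal ((b $ j - a $ j) / L) * 
      (ennreal (1 / (b $ j - a $ j)) * indicator {a $ j..b $ j} s))"
  have eq: "ennreal (split_density a b (e, z)) = ennreal (exponential_density L e) * u z" for e z
  proof (cases z)
    case (Pair j s)
    have "split_density a b (e, z) = exponential_density L e *
       (((b $ j - a $ j) / L) * ((1 / (b $ j - a $ j)) * indicator {a $ j..b $ j} s))"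
      by (simp add: split_density_def Pair L_def[symmetric] Let_def)
    moreover have "(1 / (b $ j - a $ j)) \<ge> 0" "(b $ j - a $ j) / L \<ge> 0"
      using ab[of j] L by auto
    moreover have split_prod: "ennreal (p * (q * (r * indicator A t))) =
        ennreal p * (ennreal q * (ennreal r * indicator A t))"
      if "0 \<le> p" "0 \<le> q" "0 \<le> r" for p q r t :: real and A
      using that by (cases "t \<in> A") (simp_all add: ennreal_mult')
    ultimately show ?thesis
      unfolding u_def Pair split
      by (simp only: split_prod exponential_density_nonneg[OF L])
  qed
  interpret c: sigma_finite_measure "count_space (UNIV :: 'd set)"
    by (rule sigma_finite_measure_count_space_finite) simp
  interpret p: pair_sigma_finite "count_space (UNIV :: 'd set)" "lborel :: real measure"
    by standard
  have u_meas [measurable]: "u \<in> borel_measurable (count_space UNIV \<Otimes>\<^sub>M lborel)"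
    unfolding u_def by (intro measurable_pair_measure_countable1) (auto simp: case_prod_beta)
  have inner: "(\<integral>\<^sup>+s. u (j, s) \<partial>lborel) = ennreal ((b $ j - a $ j) / L)" for j
  proof -
    have "ennreal (1 / (b $ j - a $ j)) * ennreal (b $ j - a $ j) = 1"
      using ab[of j] by (subst ennreal_mult[symmetric]) auto
    then show ?thesis
      using ab[of j] by (simp add: u_def nn_integral_cmult)
  qed
  have "(\<integral>\<^sup>+z. u z \<partial>(count_space UNIV \<Otimes>\<^sub>M lborel)) = (\<Sum>j\<in>UNIV. ennreal ((b $ j - a $ j) / L))"
    by (subst lborel.nn_integral_fst[symmetric])
       (auto simp: inner nn_integral_count_space_finite)
  also have "\<dots> = ennreal (\<Sum>j\<in>UNIV. (b $ j - a $ j) / L)"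
    using ab L by (intro sum_ennreal) (simp add: less_imp_le)
  also have "(\<Sum>j\<in>UNIV. (b $ j - a $ j) / L) = 1"
    using L unfolding sum_divide_distrib[symmetric] L_def[symmetric] by simp
  finally have u1: "(\<integral>\<^sup>+z. u z \<partial>(count_space UNIV \<Otimes>\<^sub>M lborel)) = 1" by simp
  have e1: "(\<integral>\<^sup>+e. ennreal (exponential_density L e) \<partial>lborel) = 1"
    using prob_space.emeasure_space_1[OF prob_space_exponential_density[OF L]]
    by (simp add: emeasure_density)
  have "(\<integral>\<^sup>+z. ennreal (split_density a b z) \<partial>split_space) =
      (\<integral>\<^sup>+z. ennreal (exponential_density L (fst z)) * u (snd z) \<partial>split_space)"
    by (simp add: eq[of "fst z" "snd z" for z, simplified])
  also have "\<dots> = (\<integral>\<^sup>+e. \<integral>\<^sup>+z. ennreal (exponential_density L e) * u z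
        \<partial>(count_space UNIV \<Otimes>\<^sub>M lborel) \<partial>lborel)"
  proof -
    show ?thesis unfolding split_space_def
      by (subst sigma_finite_measure.nn_integral_fst[OF p.sigma_finite_measure_axioms, symmetric]) auto
  qed
  also have "\<dots> = 1"
    by (simp add: nn_integral_cmult u1 e1)
  finally have int1: "(\<integral>\<^sup>+z. ennreal (split_density a b z) \<partial>split_space) = 1" .
  have "(\<lambda>z. ennreal (split_density a b z)) = (\<lambda>z. ennreal (exponential_density L (fst z)) * u (snd z))"
    by (simp add: eq[of "fst z" "snd z" for z, simplified])
  also have "\<dots> \<in> borel_measurable split_space"
    unfolding split_space_def by measurable
  finally have [measurable]: "(\<lambda>z. ennreal (split_density a b z)) \<in> borel_measurable split_space" .
  show ?thesis
    by (rule prob_spaceI) (simp add: emeasure_density int1)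
qed

lemma space_split_space [simp]: "space split_space = UNIV"
  by (simp add: split_space_def space_pair_measure)

lemma prob_space_split_law: "prob_space (split_law a b)"
  by (auto simp: split_law_def intro!: prob_space_split_density prob_space_return)

lemma sets_split_law [simp]: "sets (split_law a b) = sets split_space"
  by (simp add: split_law_def)

lemma measurable_history_component:
  assumes "p < n"
  shows "(\<lambda>h. waiting_time h p) \<in> borel_measurable (PiM {0..<n} (\<lambda>_. split_space :: 'd::finite split measure))"
    and "(\<lambda>h. coord h p) \<in> measurable (PiM {0..<n} (\<lambda>_. split_space :: 'd split measure)) (count_space UNIV)"
    and "(\<lambda>h. loc h p) \<in> borel_measurable (PiM {0..<n} (\<lambda>_. split_space :: 'd split measure))"
proof -
  have [measurable]: "(\<lambda>h. h p) \<in> measurable (PiM {0..<n} (\<lambda>_. split_space :: 'd split measure))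
      (borel \<Otimes>\<^sub>M (count_space (UNIV :: 'd set) \<Otimes>\<^sub>M borel))"
  proof -
    have "(\<lambda>h. h p) \<in> measurable (PiM {0..<n} (\<lambda>_. split_space :: 'd split measure)) split_space"
      using assms by (intro measurable_component_singleton) auto
    moreover have "sets (split_space :: 'd split measure) =
        sets (borel \<Otimes>\<^sub>M (count_space (UNIV :: 'd set) \<Otimes>\<^sub>M borel))"
      unfolding split_space_def by (intro sets_pair_measure_cong) auto
    ultimately show ?thesis by (simp cong: measurable_cong_sets)
  qed
  show "(\<lambda>h. waiting_time h p) \<in> borel_measurable (PiM {0..<n} (\<lambda>_. split_space :: 'd split measure))"
    unfolding waiting_time_def by measurable
  show "(\<lambda>h. coord h p) \<in> measurable (PiM {0..<n} (\<lambda>_. split_space :: 'd split measure)) (count_space UNIV)"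
    unfolding coord_def by measurable
  show "(\<lambda>h. loc h p) \<in> borel_measurable (PiM {0..<n} (\<lambda>_. split_space :: 'd split measure))"
    unfolding loc_def by measurable
qed

lemma measurable_corners:
  assumes "k \<le> n"
  shows "(\<lambda>h. lower h k $ i) \<in> borel_measurable (PiM {0..<n} (\<lambda>_. split_space))"
    and "(\<lambda>h. upper h k $ i) \<in> borel_measurable (PiM {0..<n} (\<lambda>_. split_space))"
proof -
  have "(\<lambda>h. lower h k $ i) \<in> borel_measurable (PiM {0..<n} (\<lambda>_. split_space)) \<and>
        (\<lambda>h. upper h k $ i) \<in> borel_measurable (PiM {0..<n} (\<lambda>_. split_space))"
    using assms
  proof (induction k rule: less_induct)
    case (less k)
    show ?case
    proof (cases k)
      case 0
      then show ?thesis by simp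
    next
      case (Suc m)
      have p: "m div 2 < n" "m div 2 < k" "m div 2 \<le> n" using less.prems Suc by auto
      have [measurable]:
        "(\<lambda>h. lower h (m div 2) $ i) \<in> borel_measurable (PiM {0..<n} (\<lambda>_. split_space))"
        "(\<lambda>h. upper h (m div 2) $ i) \<in> borel_measurable (PiM {0..<n} (\<lambda>_. split_space))"
        using less.IH[OF p(2,3)] by auto
      note [measurable] = measurable_history_component[OF p(1)]
      show ?thesis
        by (cases "even m") (simp_all add: Suc Let_def)
    qed
  qed
  then show "(\<lambda>h. lower h k $ i) \<in> borel_measurable (PiM {0..<n} (\<lambda>_. split_space))"
    and "(\<lambda>h. upper h k $ i) \<in> borel_measurable (PiM {0..<n} (\<lambda>_. split_space))"
    by auto
qed

text \<open>
  The law of the triple at node \<open>n\<close> given those at the nodes before it depends only on the cell of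
  \<open>n\<close>, which is a function of the triples at the proper ancestors of \<open>n\<close>.
\<close>

definition split_kernel :: "nat \<Rightarrow> 'd::finite history \<Rightarrow> 'd split measure" where
  "split_kernel n h = split_law (lower h n) (upper h n)"

lemma measurable_split_kernel:
  "split_kernel n \<in> measurable (PiM {0..<n} (\<lambda>_. split_space :: 'd::finite split measure))
     (subprob_algebra split_space)"
proof -
  let ?M = "PiM {0..<n} (\<lambda>_. split_space :: 'd split measure)"
  note [measurable] = measurable_corners[OF order_refl[of n]]
  interpret c: sigma_finite_measure "count_space (UNIV :: 'd set)"
    by (rule sigma_finite_measure_count_space_finite) simp
  interpret p: pair_sigma_finite "count_space (UNIV :: 'd set)" "lborel :: real measure"
    by standard
  interpret q: pair_sigma_finite "lborel :: real measure"
      "count_space (UNIV :: 'd set) \<Otimes>\<^sub>M (lborel :: real measure)"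
    by (intro pair_sigma_finite.intro p.sigma_finite_measure_axioms lborel.sigma_finite_measure_axioms)
  interpret s: sigma_finite_measure "split_space :: 'd split measure"
    unfolding split_space_def by (rule q.sigma_finite_measure_axioms)
  have dens [measurable]: "(\<lambda>(h, z). split_density (lower h n) (upper h n) z)
      \<in> borel_measurable (?M \<Otimes>\<^sub>M split_space)"
  proof -
    define F where "F = (\<lambda>j (w :: 'd history \<times> 'd split).
        split_density (lower (fst w) n) (upper (fst w) n) (fst (snd w), j, snd (snd (snd w))))"
    have J: "(\<lambda>w. fst (snd (snd w))) \<in> measurable (?M \<Otimes>\<^sub>M split_space) (count_space UNIV)"
      by (rule measurable_compose[OF measurable_snd]) (unfold split_space_def, measurable)
    have F: "F j \<in> borel_measurable (?M \<Otimes>\<^sub>M split_space)" for j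
    proof -
      have [measurable]: "(\<lambda>w. fst (snd w)) \<in> borel_measurable (?M \<Otimes>\<^sub>M split_space)"
        "(\<lambda>w. snd (snd (snd w))) \<in> borel_measurable (?M \<Otimes>\<^sub>M split_space)"
        by (rule measurable_compose[OF measurable_snd], unfold split_space_def, measurable)+
      show ?thesis
        unfolding F_def split_density_def split Let_def exponential_density_def indicator_def
          atLeastAtMost_iff
        by measurable
    qed
    have "(\<lambda>w. F (fst (snd (snd w))) w) \<in> borel_measurable (?M \<Otimes>\<^sub>M split_space)"
      by (rule measurable_compose_countable'[where I = UNIV, OF F J]) simp
    then show ?thesis by (simp add: F_def case_prod_beta)
  qed
  show ?thesis
  proof (rule measurable_subprob_algebra)
    fix A assume A [measurable]: "A \<in> sets (split_space :: 'd split measure)"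
    define G where "G = {h :: 'd history. \<forall>i. lower h n $ i < upper h n $ i}"
    have G: "{h \<in> space ?M. h \<in> G} \<in> sets ?M"
      unfolding G_def mem_Collect_eq by measurable
    have "emeasure (split_kernel n h) A = (if h \<in> G
        then \<integral>\<^sup>+z. ennreal (split_density (lower h n) (upper h n) z) * indicator A z \<partial>split_space
        else indicator A (0, undefined, 0))" if "h \<in> space ?M" for h
    proof -
      have [measurable]: "split_density (lower h n) (upper h n) \<in> borel_measurable split_space"
        using measurable_compose[OF measurable_Pair1'[OF that] dens] by simp
      show ?thesis
        by (auto simp: G_def split_kernel_def split_law_def emeasure_density)
    qed
    moreover have "(\<lambda>h. if h \<in> G
        then \<integral>\<^sup>+z. ennreal (split_density (lower h n) (upper h n) z) * indicator A z \<partial>split_space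
        else indicator A (0, undefined, 0)) \<in> borel_measurable ?M"
      using G by measurable
    ultimately show "(\<lambda>h. emeasure (split_kernel n h) A) \<in> borel_measurable ?M"
      by (simp cong: measurable_cong)
  qed (auto simp: split_kernel_def prob_space_split_law prob_space_imp_subprob_space)
qed

global_interpretation mondrian: Ionescu_Tulcea split_kernel "\<lambda>_. split_space"
proof (rule Ionescu_Tulcea.intro)
  show "split_kernel i \<in> measurable (PiM {0..<i} (\<lambda>_. split_space)) (subprob_algebra split_space)" for i
    by (rule measurable_split_kernel)
  show "prob_space (split_kernel i h)" for i h
    unfolding split_kernel_def by (rule prob_space_split_law)
qed

definition mondrian_law :: "'d::finite history measure" where
  "mondrian_law = mondrian.PF.lim"

text \<open>The convention \<open>0 / 0 = 0\<close> is the one of division on the reals.\<close>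

definition forest_estimator ::
  "nat \<Rightarrow> nat \<Rightarrow> (nat \<Rightarrow> 'a set set) \<Rightarrow> (nat \<Rightarrow> 'a) \<Rightarrow> (nat \<Rightarrow> real) \<Rightarrow> 'a \<Rightarrow> real" where
  "forest_estimator n B T X Y x =
     1 / real B * (\<Sum>b=1..B.
       (\<Sum>i=1..n. Y i * indicator (cell_of (T b) x) (X i)) /
       (\<Sum>i=1..n. indicator (cell_of (T b) x) (X i)))"

definition iid :: "'w measure \<Rightarrow> nat set \<Rightarrow> 'a measure \<Rightarrow> (nat \<Rightarrow> 'w \<Rightarrow> 'a) \<Rightarrow> bool" where
  "iid M I L Z \<longleftrightarrow>
     prob_space.indep_vars M (\<lambda>_. L) Z I \<and> (\<forall>i\<in>I. distr M L (Z i) = L)"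

definition forest_sample ::
  "'w measure \<Rightarrow> ((real ^ 'd::finite) \<times> real) measure \<Rightarrow> nat \<Rightarrow> nat \<Rightarrow>
   (nat \<Rightarrow> 'w \<Rightarrow> real ^ 'd) \<Rightarrow> (nat \<Rightarrow> 'w \<Rightarrow> real) \<Rightarrow> (nat \<Rightarrow> 'w \<Rightarrow> 'd history) \<Rightarrow> bool" where
  "forest_sample M P n B X Y H \<longleftrightarrow>
     prob_space M \<and>
     iid M {1..n} P (\<lambda>i \<omega>. (X i \<omega>, Y i \<omega>)) \<and>
     iid M {1..B} mondrian_law H \<and>
     prob_space.indep_set M
       (sets (vimage_algebra (space M) (\<lambda>\<omega>. \<lambda>i\<in>{1..n}. (X i \<omega>, Y i \<omega>)) (PiM {1..n} (\<lambda>_. P))))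
       (sets (vimage_algebra (space M) (\<lambda>\<omega>. \<lambda>b\<in>{1..B}. H b \<omega>) (PiM {1..B} (\<lambda>_. mondrian_law))))"

definition mondrian_forest ::
  "nat \<Rightarrow> real \<Rightarrow> nat \<Rightarrow> (nat \<Rightarrow> 'w \<Rightarrow> real ^ 'd::finite) \<Rightarrow> (nat \<Rightarrow> 'w \<Rightarrow> real) \<Rightarrow>
   (nat \<Rightarrow> 'w \<Rightarrow> 'd history) \<Rightarrow> real ^ 'd \<Rightarrow> 'w \<Rightarrow> real" where
  "mondrian_forest n l B X Y H x \<omega> =
     forest_estimator n B (\<lambda>b. mondrian_partition l (H b \<omega>)) (\<lambda>i. X i \<omega>) (\<lambda>i. Y i \<omega>) x"

end

theory Submission
  imports Defs
begin

text \<open>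
  A box \<open>Q\<close> inside a cell is still uncut after a further time \<open>s\<close> with probability
  \<open>exp (- s |Q|\<^sub>1)\<close>, whatever the cell is: this function solves the equation obtained by conditioning
  on the first split. Applied to boxes around \<open>x\<close>, it shows that the \<open>2 d\<close> distances from \<open>x\<close> to the
  faces of its final cell are independent exponential variables of rate \<open>\<lambda>\<close>, truncated at the
  faces of the cube. Hence \<open>1 / |T(x)|\<close> has mean of order \<open>\<lambda>\<^sup>d\<close>, the squared diameter has mean of
  order \<open>1 / \<lambda>\<^sup>2\<close>, and the centre of \<open>T(x)\<close> is off \<open>x\<close> by \<open>O(1 / \<lambda>\<^sup>2)\<close> in mean.

  For a fixed cell \<open>D\<close> the tree estimator is within \<open>C / (n P(D))\<close> in mean square of
  \<open>A(D) = E[Y | X \<in> D]\<close>, since the deviations of different observations from \<open>A(D)\<close> are orthogonal.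
  The independent biases \<open>a(D) = A(D) - \<mu>(x)\<close> of the \<open>B\<close> trees then contribute
  \<open>E[a\<^sup>2] / B + (E a)\<^sup>2\<close>, where \<open>a(D)\<close> is of the order of a power of the diameter and, if \<open>\<beta> > 1\<close>, is
  linear in the offset of the centre of \<open>D\<close> up to an error of the order of the diameter to the
  power \<open>min 2 \<beta>\<close>.
\<close>

section \<open>Mondrian process: the history as a Markov process\<close>

text \<open>Only the branch of cells around \<open>x\<close> matters, but a priori it may be cut
  infinitely often before the lifetime. Summed over all nodes, the first-split equation identifies
  the wanted probability with the value at the root, provided an infinite sum can be cancelled;
  split rates are bounded, as perimeters are at most d, and this makes the sum finite. The box
  reduced to \<open>x\<close> then shows that a final cell exists almost surely. The survival
  probability is a product over the faces of the box, hence the independence of the margins. As 1 /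
  margin has infinite mean, the two margins of a coordinate are separated by their geometric mean,
  each contributing \<lambda> to the power 1/2. The centre is close to \<open>x\<close> in mean
  because opposite margins have the same law up to truncation. In the bias, a linear function
  averages over a box to its value at the centre, and the variation of the density \<open>f\<close>
  costs one diameter times its power \<open>min 1 \<beta>f\<close>: hence the
  \<open>\<beta>f + 1\<close> in \<open>\<beta>\<close>. All trees see the same data; the argument
  gains from averaging them only in the fluctuation of the bias.\<close>

lemma sets_mondrian_law [measurable_cong]: "sets mondrian_law = sets (PiM UNIV (\<lambda>_. split_space))"
  by (simp add: mondrian_law_def)

lemma space_mondrian_law [simp]: "space mondrian_law = UNIV"
  by (simp add: mondrian_law_def space_PiM)

text \<open>The limit measure is built from finite-dimensional laws \<open>CI J\<close> for finite
  index sets \<open>J\<close>. For an initial segment such a law is the iterated composition of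
  kernels itself, because embedding \<open>{0..<n}\<close> into itself changes nothing. The start
  \<open>\<lambda>_. undefined\<close> is the only history on the empty index set.\<close>

lemma distr_mondrian_law_restrict:
  "distr mondrian_law (PiM {0..<n} (\<lambda>_. split_space)) (\<lambda>h. restrict h {0..<n}) =
    mondrian.C 0 n (\<lambda>_. undefined)"
proof -
  have "distr mondrian_law (PiM {0..<n} (\<lambda>_. split_space :: 'a split measure)) (\<lambda>h. restrict h {0..<n})
      = mondrian.CI {0..<n}"
    unfolding mondrian_law_def by (rule mondrian.distr_lim) simp
  also have "\<dots> = mondrian.C 0 n (\<lambda>_. undefined)"
  proof (rule measure_eqI)
    show "sets (mondrian.CI {0..<n}) = sets (mondrian.C 0 n (\<lambda>_. undefined) :: 'a history measure)"
      by (simp add: mondrian.CI_def mondrian.sets_C)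
    fix A assume "A \<in> sets (mondrian.CI {0..<n} :: 'a history measure)"
    then have A: "A \<in> sets (PiM {0..<n} (\<lambda>_. split_space :: 'a split measure))"
      by (simp add: mondrian.CI_def)
    show "emeasure (mondrian.CI {0..<n}) A = emeasure (mondrian.C 0 n (\<lambda>_. undefined)) A"
      by (subst mondrian.emeasure_CI[OF order_refl A])
         (simp add: prod_emb_id[OF sets.sets_into_space[OF A, unfolded space_PiM]])
  qed
  finally show ?thesis .
qed

lemma prob_space_mondrian_law: "prob_space (mondrian_law :: 'd::finite history measure)"
proof -
  have "prob_space (mondrian.C 0 0 (\<lambda>_. undefined) :: 'd history measure)"
    by (rule mondrian.prob_space_C) (simp add: space_PiM)
  then have "prob_space (distr mondrian_law (PiM {0..<0} (\<lambda>_. split_space :: 'd split measure)) (\<lambda>h. restrict h {0..<0}))"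
    by (simp only: distr_mondrian_law_restrict)
  then show ?thesis
    by (rule prob_space_distrD[rotated]) measurable
qed

lemma nn_integral_mondrian_law_restrict:
  assumes "F \<in> borel_measurable (PiM {0..<n} (\<lambda>_. split_space :: 'd::finite split measure))"
  shows "(\<integral>\<^sup>+h. F (restrict h {0..<n}) \<partial>mondrian_law) = (\<integral>\<^sup>+h. F h \<partial>mondrian.C 0 n (\<lambda>_. undefined))"
  unfolding distr_mondrian_law_restrict[symmetric]
  by (subst nn_integral_distr) (use assms in auto)

text \<open>The Markov property: the triple at node \<open>n\<close> is integrated out against its
  kernel while the earlier triples keep their joint law. It holds because \<open>C 0 (Suc n)\<close>
  is \<open>C 0 n\<close> followed by the one-step extension \<open>eP n\<close>. The restrictions
  appear since points of the product over \<open>{0..<n}\<close> are undefined elsewhere.\<close>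

lemma nn_integral_mondrian_law_step:
  assumes F: "F \<in> borel_measurable (PiM {0..<Suc n} (\<lambda>_. split_space :: 'd::finite split measure))"
  shows "(\<integral>\<^sup>+h. F (restrict h {0..<Suc n}) \<partial>mondrian_law) =
    (\<integral>\<^sup>+h. (\<integral>\<^sup>+z. F ((restrict h {0..<n})(n := z)) \<partial>split_kernel n (restrict h {0..<n})) \<partial>mondrian_law)"
proof -
  let ?\<Omega> = "\<lambda>n. PiM {0..<n} (\<lambda>_. split_space :: 'd split measure)"
  have "(\<integral>\<^sup>+h. F (restrict h {0..<Suc n}) \<partial>mondrian_law) =
      (\<integral>\<^sup>+h. F h \<partial>(mondrian.C 0 n (\<lambda>_. undefined) \<bind> mondrian.eP n))"
    using nn_integral_mondrian_law_restrict[OF F] by simp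
  also have "\<dots> = (\<integral>\<^sup>+h. (\<integral>\<^sup>+h'. F h' \<partial>mondrian.eP n h) \<partial>mondrian.C 0 n (\<lambda>_. undefined))"
  proof (rule nn_integral_bind[OF F])
    have "sets (mondrian.C 0 n (\<lambda>_. undefined)) = sets (?\<Omega> n)"
      using mondrian.sets_C[of "\<lambda>_. undefined" 0 n] by (simp add: space_PiM)
    then show "mondrian.eP n \<in> mondrian.C 0 n (\<lambda>_. undefined) \<rightarrow>\<^sub>M subprob_algebra (?\<Omega> (Suc n))"
      using mondrian.measurable_eP measurable_cong_sets by blast
  qed
  also have "\<dots> = (\<integral>\<^sup>+h. (\<integral>\<^sup>+h'. F h' \<partial>mondrian.eP n (restrict h {0..<n})) \<partial>mondrian_law)"
    by (rule nn_integral_mondrian_law_restrict[symmetric])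
       (intro measurable_compose[OF mondrian.measurable_eP] nn_integral_measurable_subprob_algebra F)
  also have "\<dots> = (\<integral>\<^sup>+h. (\<integral>\<^sup>+z. F ((restrict h {0..<n})(n := z)) \<partial>split_kernel n (restrict h {0..<n})) \<partial>mondrian_law)"
    by (intro nn_integral_cong mondrian.nn_integral_eP[OF _ F]) (auto simp: space_PiM)
  finally show ?thesis .
qed

text \<open>The side length in the probability of J = j cancels against the uniform density of the
  location, so the pair (J, S) has constant density \<open>1 / L\<close> on the disjoint union of
  the sides, independently of the waiting time. This is why the chance of missing a box depends on
  perimeters only.\<close>

lemma nn_integral_split_law:
  fixes a b :: "real ^ 'd::finite" and g :: "real \<Rightarrow> ennreal" and k :: "'d \<Rightarrow> real \<Rightarrow> ennreal"
  assumes ab: "\<And>i. a $ i < b $ i" and L: "L = (\<Sum>i\<in>UNIV. b $ i - a $ i)"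
    and g: "g \<in> borel_measurable borel" and k: "\<And>j. k j \<in> borel_measurable borel"
  shows "(\<integral>\<^sup>+z. g (fst z) * k (fst (snd z)) (snd (snd z)) \<partial>split_law a b) =
    (\<integral>\<^sup>+e. ennreal (exponential_density L e) * g e \<partial>lborel) *
    (\<Sum>j\<in>UNIV. ennreal (1 / L) * (\<integral>\<^sup>+s. indicator {a $ j..b $ j} s * k j s \<partial>lborel))"
proof -
  interpret c: sigma_finite_measure "count_space (UNIV :: 'd set)"
    by (rule sigma_finite_measure_count_space_finite) simp
  interpret p: pair_sigma_finite "count_space (UNIV :: 'd set)" "lborel :: real measure"
    by standard
  have Lpos: "L > 0" unfolding L using ab by (intro sum_pos) auto
  define u where "u = (\<lambda>(j, s). ennreal (1 / L) * (indicator {a $ j..b $ j} s :: ennreal))"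
  have eq: "ennreal (split_density a b (e, z)) = ennreal (exponential_density L e) * u z" for e z
  proof (cases z)
    case (Pair j s)
    have "split_density a b (e, z) = exponential_density L e * ((1 / L) * indicator {a $ j..b $ j} s)"
      using ab[of j] by (simp add: split_density_def Pair L[symmetric] Let_def)
    then show ?thesis
      using Lpos exponential_density_nonneg[OF Lpos, of e]
      by (simp add: u_def Pair ennreal_mult[symmetric] indicator_def)
  qed
  note [measurable] = g
  have u_meas [measurable]: "u \<in> borel_measurable (count_space UNIV \<Otimes>\<^sub>M lborel)"
    unfolding u_def by (intro measurable_pair_measure_countable1) (auto simp: case_prod_beta)
  have k_meas [measurable]: "(\<lambda>z. k (fst z) (snd z)) \<in> borel_measurable (count_space UNIV \<Otimes>\<^sub>M lborel)"
    using k by (intro measurable_pair_measure_countable1) auto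
  have "(\<lambda>z. ennreal (split_density a b z)) = (\<lambda>z. ennreal (exponential_density L (fst z)) * u (snd z))"
    by (simp add: eq[of "fst z" "snd z" for z, simplified])
  also have "\<dots> \<in> borel_measurable split_space"
    unfolding split_space_def by measurable
  finally have [measurable]: "(\<lambda>z. ennreal (split_density a b z)) \<in> borel_measurable split_space" .
  have [measurable]: "(\<lambda>z. g (fst z) * k (fst (snd z)) (snd (snd z))) \<in> borel_measurable split_space"
  proof -
    have "(\<lambda>z. g (fst z) * (\<lambda>z. k (fst z) (snd z)) (snd z)) \<in> borel_measurable (lborel \<Otimes>\<^sub>M (count_space UNIV \<Otimes>\<^sub>M lborel))"
      by measurable
    then show ?thesis by (simp add: split_space_def)
  qed
  have "(\<integral>\<^sup>+z. g (fst z) * k (fst (snd z)) (snd (snd z)) \<partial>split_law a b) =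
     (\<integral>\<^sup>+z. ennreal (split_density a b z) * (g (fst z) * k (fst (snd z)) (snd (snd z))) \<partial>split_space)"
    using ab by (simp add: split_law_def nn_integral_density)
  also have "\<dots> = (\<integral>\<^sup>+z. (ennreal (exponential_density L (fst z)) * g (fst z)) * (u (snd z) * k (fst (snd z)) (snd (snd z))) \<partial>split_space)"
    by (simp add: eq[of "fst z" "snd z" for z, simplified] mult_ac)
  also have "\<dots> = (\<integral>\<^sup>+e. \<integral>\<^sup>+z. (ennreal (exponential_density L e) * g e) * (u z * k (fst z) (snd z))
        \<partial>(count_space UNIV \<Otimes>\<^sub>M lborel) \<partial>lborel)"
    unfolding split_space_def
    by (subst sigma_finite_measure.nn_integral_fst[OF p.sigma_finite_measure_axioms, symmetric]) auto
  also have "\<dots> = (\<integral>\<^sup>+e. ennreal (exponential_density L e) * g e \<partial>lborel) *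
      (\<integral>\<^sup>+z. u z * k (fst z) (snd z) \<partial>(count_space UNIV \<Otimes>\<^sub>M lborel))"
    by (simp add: nn_integral_cmult nn_integral_multc)
  also have "(\<integral>\<^sup>+z. u z * k (fst z) (snd z) \<partial>(count_space UNIV \<Otimes>\<^sub>M lborel)) =
     (\<Sum>j\<in>UNIV. \<integral>\<^sup>+s. u (j, s) * k j s \<partial>lborel)"
    by (subst lborel.nn_integral_fst[symmetric])
       (auto simp: nn_integral_count_space_finite)
  also have "\<dots> = (\<Sum>j\<in>UNIV. ennreal (1 / L) * (\<integral>\<^sup>+s. indicator {a $ j..b $ j} s * k j s \<partial>lborel))"
    using k by (intro sum.cong refl) (simp add: u_def mult.assoc nn_integral_cmult)
  finally show ?thesis .
qed

section \<open>Nodes whose cell contains \<open>x\<close>, and their dependence on earlier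
  nodes\<close>

lemma lower_upper_formation_time_cong:
  assumes "\<And>i. i < n \<Longrightarrow> h i = h' i"
  shows "lower h n = lower h' n" "upper h n = upper h' n" "formation_time h n = formation_time h' n"
proof -
  have "lower h n = lower h' n \<and> upper h n = upper h' n \<and> formation_time h n = formation_time h' n"
    using assms
  proof (induction n rule: less_induct)
    case (less n)
    show ?case
    proof (cases n)
      case (Suc m)
      have "lower h (m div 2) = lower h' (m div 2) \<and> upper h (m div 2) = upper h' (m div 2) \<and>
          formation_time h (m div 2) = formation_time h' (m div 2)"
        using less.prems Suc by (intro less.IH) auto
      moreover have "h (m div 2) = h' (m div 2)"
        using less.prems Suc by simp
      ultimately show ?thesis
        by (simp add: Suc Let_def coord_def loc_def waiting_time_def cong: if_cong)
    qed simp
  qed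
  then show "lower h n = lower h' n" "upper h n = upper h' n" "formation_time h n = formation_time h' n"
    by auto
qed

lemma borel_measurable_pred_le [measurable (raw)]:
  fixes f :: "'a \<Rightarrow> 'b::{second_countable_topology, linorder_topology}"
  shows "f \<in> borel_measurable M \<Longrightarrow> g \<in> borel_measurable M \<Longrightarrow> Measurable.pred M (\<lambda>w. f w \<le> g w)"
  unfolding Measurable.pred_def by (rule borel_measurable_le)

definition covers :: "real ^ 'd::finite \<Rightarrow> real ^ 'd \<Rightarrow> 'd history \<Rightarrow> nat \<Rightarrow> bool" where
  "covers p q h n \<longleftrightarrow> (\<forall>i. lower h n $ i \<le> p $ i \<and> q $ i \<le> upper h n $ i)"

text \<open>Like \<open>formed\<close>, but along the branch of cells around \<open>x\<close> and
  with two kinds of null events removed: a split exactly at a coordinate of \<open>x\<close>, and a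
  location outside the side being cut, which the space of histories allows. What remains are
  histories for which \<open>lower\<close> and \<open>upper\<close> are really the corners of the
  cell.\<close>

fun active :: "real \<Rightarrow> real ^ 'd::finite \<Rightarrow> 'd history \<Rightarrow> nat \<Rightarrow> bool" where
  "active l x h 0 \<longleftrightarrow> True"
| "active l x h (Suc m) \<longleftrightarrow> (let p = m div 2; j = coord h p; s = loc h p in
     active l x h p \<and> split_due h p \<le> l \<and> lower h p $ j \<le> s \<and> s \<le> upper h p $ j \<and>
     (if even m then x $ j < s else s < x $ j))"

lemma active_formed: "active l x h n \<Longrightarrow> formed l h n"
proof (induction n rule: less_induct)
  case (less n)
  then show ?case by (cases n) (auto simp: Let_def)
qed

lemma active_formation_time: "0 \<le> l \<Longrightarrow> active l x h n \<Longrightarrow> formation_time h n \<le> l"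
  by (cases n) (auto simp: Let_def split_due_def)

text \<open>The strict inequalities keep \<open>x\<close> off every face. An active cell therefore
  has positive side lengths, and its split follows the density and not the point mass that
  \<open>split_law\<close> gives to degenerate cells.\<close>

lemma active_corners:
  assumes x: "x \<in> box 0 1" and "active l x h n"
  shows "0 \<le> lower h n $ i \<and> lower h n $ i < x $ i \<and> x $ i < upper h n $ i \<and> upper h n $ i \<le> 1"
  using assms(2)
proof (induction n arbitrary: i rule: less_induct)
  case (less n)
  show ?case
  proof (cases n)
    case 0
    then show ?thesis using x by (auto simp: mem_box_cart)
  next
    case (Suc m)
    let ?p = "m div 2"
    have p: "?p < n" "active l x h ?p" using less.prems Suc by (auto simp: Let_def)
    note IH = less.IH[OF p]
    show ?thesis
      using IH[of i] IH[of "coord h ?p"] less.prems Suc by (auto simp: Let_def split: if_splits)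
  qed
qed

lemma cell_subset_cbox: "cell h n \<subseteq> cbox (lower h n) (upper h n)"
proof (induction n rule: less_induct)
  case (less n)
  show ?case
  proof (cases n)
    case (Suc m)
    then show ?thesis
      using less.IH[of "m div 2"] by (auto simp: Let_def mem_box_cart subset_iff less_imp_le)
  qed simp
qed

text \<open>Splits make cells half-open, so a cell is only enclosed between the open and the closed
  box with its corners. Unlike the outer inclusion, this one requires each location to lie within
  the side of the parent, which \<open>active\<close> provides.\<close>

lemma active_box_subset_cell:
  assumes x: "x \<in> box 0 1" and "active l x h n"
  shows "box (lower h n) (upper h n) \<subseteq> cell h n"
  using assms(2)
proof (induction n rule: less_induct)
  case (less n)
  show ?case
  proof (cases n)
    case 0
    then show ?thesis by (auto simp: mem_box_cart less_imp_le)
  next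
    case (Suc m)
    let ?p = "m div 2"
    have p: "?p < n" "active l x h ?p" using less.prems Suc by (auto simp: Let_def)
    have s: "lower h ?p $ coord h ?p \<le> loc h ?p" "loc h ?p \<le> upper h ?p $ coord h ?p"
      using less.prems Suc by (auto simp: Let_def)
    show ?thesis
    proof
      fix y assume y: "y \<in> box (lower h n) (upper h n)"
      have "lower h ?p $ i < y $ i \<and> y $ i < upper h ?p $ i" for i
        using y s unfolding mem_box_cart Suc
        by (cases "i = coord h ?p"; cases "even m") (auto simp: Let_def dest!: spec[of _ i])
      then have "y \<in> cell h ?p" using less.IH[OF p] by (auto simp: mem_box_cart)
      moreover have "if even m then y $ coord h ?p < loc h ?p else loc h ?p < y $ coord h ?p"
        using y unfolding mem_box_cart Suc by (auto simp: Let_def dest!: spec[of _ "coord h ?p"])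
      ultimately show "y \<in> cell h n"
        unfolding Suc by (auto simp: Let_def split: if_splits)
    qed
  qed
qed

lemma active_mem_cell:
  assumes x: "x \<in> box 0 1" and a: "active l x h n"
  shows "x \<in> cell h n"
  using active_box_subset_cell[OF assms] active_corners[OF assms] by (auto simp: mem_box_cart)

text \<open>The infinite descent of \<open>x\<close> through the tree, every split being carried out
  regardless of the lifetime. All nodes whose cell contains \<open>x\<close> lie on it, so any two
  of them are comparable.\<close>

fun node_path :: "real ^ 'd::finite \<Rightarrow> 'd history \<Rightarrow> nat \<Rightarrow> nat" where
  "node_path x h 0 = 0"
| "node_path x h (Suc k) =
    (let n = node_path x h k in if x $ coord h n \<le> loc h n then 2 * n + 1 else 2 * n + 2)"

lemma cell_node_path: "x \<in> cell h n \<Longrightarrow> \<exists>k. n = node_path x h k"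
proof (induction n rule: less_induct)
  case (less n)
  show ?case
  proof (cases n)
    case 0
    then show ?thesis by (metis node_path.simps(1))
  next
    case (Suc m)
    have "x \<in> cell h (m div 2)" using less.prems Suc by (auto simp: Let_def split: if_splits)
    moreover have "m div 2 < n" using Suc by simp
    ultimately obtain k where k: "m div 2 = node_path x h k" using less.IH by blast
    have "node_path x h (Suc k) = n"
      using less.prems unfolding node_path.simps k[symmetric] Suc
      by (auto simp: Let_def split: if_splits elim!: evenE oddE)
    then show ?thesis by metis
  qed
qed

lemma formed_node_path_split: "formed l h (node_path x h k) \<Longrightarrow> k' < k \<Longrightarrow> split_due h (node_path x h k') \<le> l"
proof (induction k)
  case (Suc k)
  have "formed l h (node_path x h k) \<and> split_due h (node_path x h k) \<le> l"
    using Suc.prems(1) by (auto simp: Let_def split: if_splits)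
  then show ?case using Suc by (cases "k' = k") auto
qed simp

text \<open>Of two different nodes on the path of \<open>x\<close>, the upper one must have split
  within the lifetime for the lower one to be formed, so the upper one is not final.\<close>

lemma final_node_unique:
  assumes "x \<in> cell h n" "formed l h n" "l < split_due h n"
    and "x \<in> cell h m" "formed l h m" "l < split_due h m"
  shows "n = m"
proof -
  obtain i j where ij: "n = node_path x h i" "m = node_path x h j"
    using cell_node_path assms by blast
  show ?thesis
    using formed_node_path_split[of l h x i j] formed_node_path_split[of l h x j i] assms ij
    by (cases i j rule: linorder_cases) auto
qed

text \<open>As the final node is unique, the union in \<open>cell_of\<close> has a single
  member.\<close>

lemma mondrian_cell_of_eq:
  assumes "x \<in> cell h n" "formed l h n" "l < split_due h n"
  shows "cell_of (mondrian_partition l h) x = cell h n"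
proof -
  have "{D \<in> mondrian_partition l h. x \<in> D} = {cell h n}"
  proof (intro equalityI subsetI)
    fix D assume "D \<in> {D \<in> mondrian_partition l h. x \<in> D}"
    then obtain m where "D = cell h m" "x \<in> cell h m" "formed l h m" "l < split_due h m"
      unfolding mondrian_partition_def by blast
    then show "D \<in> {cell h n}" using final_node_unique[OF assms] by blast
  next
    fix D assume "D \<in> {cell h n}"
    then show "D \<in> {D \<in> mondrian_partition l h. x \<in> D}"
      using assms unfolding mondrian_partition_def by blast
  qed
  then show ?thesis by (simp add: cell_of_def)
qed

section \<open>Measurability of events at a node\<close>

lemma active_restrict [simp]: "active l x (restrict h {0..<n}) n = active l x h n"
proof -
  have cong: "(\<And>i. i < n \<Longrightarrow> h i = h' i) \<Longrightarrow> active l x h n = active l x h' n" for h h' :: "'a history"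
  proof (induction n rule: less_induct)
    case (less n)
    show ?case
    proof (cases n)
      case (Suc m)
      have "active l x h (m div 2) = active l x h' (m div 2)"
        using less.prems Suc by (intro less.IH) auto
      moreover have "h (m div 2) = h' (m div 2)"
        using less.prems Suc by simp
      moreover have "lower h (m div 2) = lower h' (m div 2)" "upper h (m div 2) = upper h' (m div 2)"
          "formation_time h (m div 2) = formation_time h' (m div 2)"
        using less.prems Suc by (auto intro!: lower_upper_formation_time_cong)
      ultimately show ?thesis
        by (simp add: Suc Let_def coord_def loc_def waiting_time_def split_due_def cong: if_cong)
    qed simp
  qed
  show ?thesis by (rule cong) simp
qed

lemma lower_upper_formation_time_restrict [simp]:
  "lower (restrict h {0..<n}) n = lower h n" "upper (restrict h {0..<n}) n = upper h n"
  "formation_time (restrict h {0..<n}) n = formation_time h n"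
  by (auto intro!: lower_upper_formation_time_cong)

lemma covers_restrict [simp]: "covers p q (restrict h {0..<n}) n = covers p q h n"
  by (simp add: covers_def)

lemma measurable_formation_time:
  "k \<le> n \<Longrightarrow> (\<lambda>h. formation_time h k) \<in> borel_measurable (PiM {0..<n} (\<lambda>_. split_space :: 'd::finite split measure))"
proof (induction k rule: less_induct)
  case (less k)
  show ?case
  proof (cases k)
    case (Suc m)
    have [measurable]: "(\<lambda>h. formation_time h (m div 2)) \<in> borel_measurable (PiM {0..<n} (\<lambda>_. split_space :: 'd split measure))"
      using less Suc by (intro less.IH) auto
    note [measurable] = measurable_history_component(1)[of "m div 2" n]
    show ?thesis using less.prems Suc by simp
  qed simp
qed

lemma measurable_active:
  "k \<le> n \<Longrightarrow> Measurable.pred (PiM {0..<n} (\<lambda>_. split_space :: 'd::finite split measure)) (\<lambda>h. active l x h k)"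
proof (induction k rule: less_induct)
  case (less k)
  show ?case
  proof (cases k)
    case (Suc m)
    let ?p = "m div 2"
    have p: "?p < n" "?p \<le> n" "?p < k" using less.prems Suc by auto
    have [measurable]: "Measurable.pred (PiM {0..<n} (\<lambda>_. split_space :: 'd split measure)) (\<lambda>h. active l x h ?p)"
      using p by (intro less.IH) auto
    note [measurable] = measurable_history_component[OF p(1)] measurable_corners[OF p(2)] measurable_formation_time[OF p(2)]
    \<comment> \<open>Quantifying over the possible values \<open>j\<close> of
      \<open>coord h ?p\<close> turns the evaluation at a random coordinate into a finite
      conjunction of measurable conditions.\<close>
    have eq: "active l x h k \<longleftrightarrow> active l x h ?p \<and> formation_time h ?p + waiting_time h ?p \<le> l \<and>
       (\<forall>j. coord h ?p = j \<longrightarrow> lower h ?p $ j \<le> loc h ?p \<and> loc h ?p \<le> upper h ?p $ j \<and>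
          (if even m then x $ j < loc h ?p else loc h ?p < x $ j))" for h
      by (auto simp: Suc Let_def split_due_def)
    show ?thesis unfolding eq by measurable
  qed simp
qed

lemma measurable_covers:
  assumes "k \<le> n"
  shows "Measurable.pred (PiM {0..<n} (\<lambda>_. split_space :: 'd::finite split measure)) (\<lambda>h. covers p q h k)"
proof -
  note [measurable] = measurable_corners[OF assms]
  show ?thesis unfolding covers_def by measurable
qed

lemma measurable_restrict_mondrian_law:
  "(\<lambda>h. restrict h {0..<n}) \<in> measurable mondrian_law (PiM {0..<n} (\<lambda>_. split_space :: 'd::finite split measure))"
  by measurable

lemma measurable_node [measurable]:
  "Measurable.pred mondrian_law (\<lambda>h. active l x h n)"
  "Measurable.pred mondrian_law (\<lambda>h. covers p q h n)"
  "(\<lambda>h. formation_time h n) \<in> borel_measurable mondrian_law"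
  "(\<lambda>h. lower h n $ i) \<in> borel_measurable mondrian_law"
  "(\<lambda>h. upper h n $ i) \<in> borel_measurable mondrian_law"
  by (rule measurable_compose[OF measurable_restrict_mondrian_law measurable_active[OF order_refl], unfolded active_restrict]
        measurable_compose[OF measurable_restrict_mondrian_law measurable_covers[OF order_refl], unfolded covers_restrict]
        measurable_compose[OF measurable_restrict_mondrian_law measurable_formation_time[OF order_refl],
          unfolded lower_upper_formation_time_restrict]
        measurable_compose[OF measurable_restrict_mondrian_law measurable_corners(1)[OF order_refl],
          unfolded lower_upper_formation_time_restrict]
        measurable_compose[OF measurable_restrict_mondrian_law measurable_corners(2)[OF order_refl],
          unfolded lower_upper_formation_time_restrict])+

lemma measurable_node_split [measurable]:
  "(\<lambda>h. waiting_time h n) \<in> borel_measurable mondrian_law"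
  "(\<lambda>h. coord h n) \<in> measurable mondrian_law (count_space UNIV)"
  "(\<lambda>h. loc h n) \<in> borel_measurable mondrian_law"
proof -
  show "(\<lambda>h. waiting_time h n) \<in> borel_measurable mondrian_law"
    unfolding waiting_time_def
    using measurable_compose[OF measurable_restrict_mondrian_law measurable_history_component(1)[of n "Suc n"]]
    by (simp add: waiting_time_def)
  show "(\<lambda>h. coord h n) \<in> measurable mondrian_law (count_space UNIV)"
    unfolding coord_def
    using measurable_compose[OF measurable_restrict_mondrian_law measurable_history_component(2)[of n "Suc n"]]
    by (simp add: coord_def)
  show "(\<lambda>h. loc h n) \<in> borel_measurable mondrian_law"
    unfolding loc_def
    using measurable_compose[OF measurable_restrict_mondrian_law measurable_history_component(3)[of n "Suc n"]]
    by (simp add: loc_def)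
qed

lemma measurable_split_due [measurable]: "(\<lambda>h. split_due h n) \<in> borel_measurable mondrian_law"
  unfolding split_due_def by measurable

text \<open>In heap order every positive node is the child of exactly one node, and the nodes below
  \<open>2 * N + 1\<close> are the root together with the children of the nodes below
  \<open>N\<close>.\<close>

lemma suminf_binary_tree:
  fixes f :: "nat \<Rightarrow> ennreal"
  shows "(\<Sum>n. f n) = f 0 + (\<Sum>n. f (2 * n + 1) + f (2 * n + 2))"
proof -
  have "(\<Sum>k<2 * N + 1. f k) = f 0 + (\<Sum>n<N. f (2 * n + 1) + f (2 * n + 2))" for N
    by (induction N) (auto simp: algebra_simps)
  moreover have "(\<lambda>N. \<Sum>k<2 * N + 1. f k) \<longlonglongrightarrow> (\<Sum>n. f n)"
    using LIMSEQ_subseq_LIMSEQ[OF summable_LIMSEQ[OF summableI[of f]], of "\<lambda>N. 2 * N + 1"]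
    by (auto simp: strict_mono_def comp_def)
  moreover have "(\<lambda>N. f 0 + (\<Sum>n<N. f (2 * n + 1) + f (2 * n + 2))) \<longlonglongrightarrow>
      f 0 + (\<Sum>n. f (2 * n + 1) + f (2 * n + 2))"
    by (intro tendsto_intros summable_LIMSEQ summableI)
  ultimately show ?thesis
    using LIMSEQ_unique by simp
qed

text \<open>A partial sum s over the first \<open>2 * N + 1\<close> nodes satisfies s \<le> 1 +
  \<rho> s, as it consists of the root and of children of the first \<open>N\<close> nodes. The
  bound \<open>f1\<close> makes s finite, so this can be solved for s; for that the argument moves
  to the reals.\<close>

lemma suminf_binary_tree_contraction:
  fixes f :: "nat \<Rightarrow> ennreal" and \<rho> :: real
  assumes step: "\<And>n. f (2 * n + 1) + f (2 * n + 2) \<le> ennreal \<rho> * f n"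
    and f1: "\<And>n. f n \<le> 1" and \<rho>: "0 \<le> \<rho>" "\<rho> < 1"
  shows "(\<Sum>n. f n) \<noteq> \<infinity>"
proof -
  define g where "g n = enn2real (f n)" for n
  have fg: "f n = ennreal (g n)" for n
    using f1[of n] unfolding g_def by (metis ennreal_enn2real ennreal_one_less_top le_less_trans)
  have g: "0 \<le> g n" "g n \<le> 1" for n
    using enn2real_leI[of 1 "f n"] f1[of n] by (auto simp: g_def)
  have gstep: "g (2 * n + 1) + g (2 * n + 2) \<le> \<rho> * g n" for n
    using step[of n] g \<rho> unfolding fg
    by (simp add: ennreal_plus[symmetric] ennreal_mult'[symmetric] del: ennreal_plus)
  have sumeq: "(\<Sum>k<2 * N + 1. g k) = g 0 + (\<Sum>n<N. g (2 * n + 1) + g (2 * n + 2))" for N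
    by (induction N) (auto simp: algebra_simps)
  have bound: "(\<Sum>k<N. g k) \<le> 1 / (1 - \<rho>)" for N
  proof -
    let ?s = "\<Sum>k<2 * N + 1. g k"
    have le: "(\<Sum>k<N. g k) \<le> ?s"
      using g by (intro sum_mono2) auto
    have "?s \<le> 1 + (\<Sum>n<N. \<rho> * g n)"
      unfolding sumeq using g gstep by (intro add_mono sum_mono) auto
    also have "\<dots> \<le> 1 + \<rho> * ?s"
      using le \<rho> by (simp add: sum_distrib_left[symmetric] mult_left_mono)
    finally have "?s \<le> 1 / (1 - \<rho>)"
      using \<rho> by (simp add: field_simps)
    with le show ?thesis by simp
  qed
  have "(\<Sum>n. f n) \<le> ennreal (1 / (1 - \<rho>))"
  proof (rule suminf_le_const[OF summableI])
    fix N
    have "(\<Sum>k<N. f k) = ennreal (\<Sum>k<N. g k)"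
      unfolding fg using g by (simp add: sum_ennreal)
    also have "\<dots> \<le> ennreal (1 / (1 - \<rho>))"
      using bound by (intro ennreal_leI)
    finally show "(\<Sum>k<N. f k) \<le> ennreal (1 / (1 - \<rho>))" .
  qed
  then show ?thesis by (auto simp: top_unique)
qed

text \<open>The weight \<open>u\<close> sees the formation time because the chance of a cell to keep
  the box until \<open>l\<close> depends on the time left. With
  \<open>u t = exp (- (l - t) * r)\<close>, for a box of perimeter \<open>r\<close>, the mass is
  meant as the probability that \<open>n\<close> is active with the box inside and that the box then
  stays uncut until \<open>l\<close>.\<close>

definition node_mass :: "real \<Rightarrow> real ^ 'd::finite \<Rightarrow> real ^ 'd \<Rightarrow> real ^ 'd \<Rightarrow> (real \<Rightarrow> ennreal) \<Rightarrow> nat \<Rightarrow> ennreal" where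
  "node_mass l x p q u n =
     (\<integral>\<^sup>+h. indicator {h. active l x h n \<and> covers p q h n} h * u (formation_time h n) \<partial>mondrian_law)"

definition final_mass :: "real \<Rightarrow> real ^ 'd::finite \<Rightarrow> real ^ 'd \<Rightarrow> real ^ 'd \<Rightarrow> nat \<Rightarrow> ennreal" where
  "final_mass l x p q n =
     (\<integral>\<^sup>+h. indicator {h. active l x h n \<and> covers p q h n \<and> l < split_due h n} h \<partial>mondrian_law)"

definition perimeter :: "'d::finite history \<Rightarrow> nat \<Rightarrow> real" where
  "perimeter h n = (\<Sum>i\<in>UNIV. upper h n $ i - lower h n $ i)"

lemma fun_upd_node:
  "lower (h(n := z)) n = lower h n" "upper (h(n := z)) n = upper h n"
  "formation_time (h(n := z)) n = formation_time h n" 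
  "active l x (h(n := z)) n = active l x h n" "covers p q (h(n := z)) n = covers p q h n"
proof -
  show *: "lower (h(n := z)) n = lower h n" "upper (h(n := z)) n = upper h n"
    "formation_time (h(n := z)) n = formation_time h n"
    by (auto intro!: lower_upper_formation_time_cong)
  have "restrict (h(n := z)) {0..<n} = restrict h {0..<n}" by auto
  then show "active l x (h(n := z)) n = active l x h n"
    by (metis active_restrict)
  show "covers p q (h(n := z)) n = covers p q h n" by (simp add: covers_def *)
qed

text \<open>The two conditions on \<open>loc\<close> in each case have different origins: the strict
  one against \<open>x\<close> comes from \<open>active\<close>, the weak one against the box from
  \<open>covers\<close>. When the box touches \<open>x\<close> in that coordinate, the second does
  not give the first.\<close>

lemma active_child_covers:
  fixes h :: "'d::finite history"
  assumes pq: "\<And>i. p $ i \<le> x $ i" "\<And>i. x $ i \<le> q $ i"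
  shows "active l x h (2 * n + 1) \<and> covers p q h (2 * n + 1) \<longleftrightarrow>
      active l x h n \<and> covers p q h n \<and> split_due h n \<le> l \<and>
      loc h n \<in> {lower h n $ coord h n..upper h n $ coord h n} \<and>
      x $ coord h n < loc h n \<and> q $ coord h n \<le> loc h n" (is ?A)
    and "active l x h (2 * n + 2) \<and> covers p q h (2 * n + 2) \<longleftrightarrow>
      active l x h n \<and> covers p q h n \<and> split_due h n \<le> l \<and>
      loc h n \<in> {lower h n $ coord h n..upper h n $ coord h n} \<and>
      loc h n < x $ coord h n \<and> loc h n \<le> p $ coord h n" (is ?B)
    and "formation_time h (2 * n + 1) = split_due h n" "formation_time h (2 * n + 2) = split_due h n"
proof -
  have e: "2 * n + 2 = Suc (2 * n + 1)" by simp
  have c1: "covers p q h (2 * n + 1) \<longleftrightarrow>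
      (\<forall>i. lower h n $ i \<le> p $ i \<and> q $ i \<le> (if i = coord h n then loc h n else upper h n $ i))"
    by (simp add: covers_def)
  have c2: "covers p q h (2 * n + 2) \<longleftrightarrow>
      (\<forall>i. (if i = coord h n then loc h n else lower h n $ i) \<le> p $ i \<and> q $ i \<le> upper h n $ i)"
    unfolding e covers_def by simp
  let ?s = "loc h n" and ?j = "coord h n"
  have "covers p q h (2 * n + 1) \<and> ?s \<le> upper h n $ ?j \<longleftrightarrow>
      covers p q h n \<and> q $ ?j \<le> ?s \<and> ?s \<le> upper h n $ ?j" (is "?l \<longleftrightarrow> ?r")
  proof
    assume ?l
    then have *: "lower h n $ i \<le> p $ i" "q $ i \<le> (if i = ?j then ?s else upper h n $ i)" "?s \<le> upper h n $ ?j" for i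
      unfolding c1 by blast+
    have "q $ i \<le> upper h n $ i" for i
      using *(2)[of i] *(3) by (cases "i = ?j") auto
    then show ?r using *(1) *(2)[of ?j] *(3) by (auto simp: covers_def)
  qed (auto simp: c1 covers_def)
  moreover have "active l x h (2 * n + 1) \<longleftrightarrow>
      active l x h n \<and> split_due h n \<le> l \<and> lower h n $ ?j \<le> ?s \<and> ?s \<le> upper h n $ ?j \<and> x $ ?j < ?s"
    by (simp add: Let_def)
  ultimately show ?A
    unfolding atLeastAtMost_iff by blast
  have "covers p q h (2 * n + 2) \<and> lower h n $ ?j \<le> ?s \<longleftrightarrow>
      covers p q h n \<and> ?s \<le> p $ ?j \<and> lower h n $ ?j \<le> ?s" (is "?l \<longleftrightarrow> ?r")
  proof
    assume ?l
    then have *: "(if i = ?j then ?s else lower h n $ i) \<le> p $ i" "q $ i \<le> upper h n $ i" "lower h n $ ?j \<le> ?s" for i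
      unfolding c2 by blast+
    have "lower h n $ i \<le> p $ i" for i
      using *(1)[of i] *(3) by (cases "i = ?j") auto
    then show ?r using *(1)[of ?j] *(2) *(3) by (auto simp: covers_def)
  qed (auto simp: c2 covers_def)
  moreover have "active l x h (2 * n + 2) \<longleftrightarrow>
      active l x h n \<and> split_due h n \<le> l \<and> lower h n $ ?j \<le> ?s \<and> ?s \<le> upper h n $ ?j \<and> ?s < x $ ?j"
    unfolding e by (simp add: Let_def)
  ultimately show ?B
    unfolding atLeastAtMost_iff by blast
  show "formation_time h (2 * n + 1) = split_due h n" "formation_time h (2 * n + 2) = split_due h n"
    unfolding e by (simp_all add: split_due_def)
qed

text \<open>The test function is a product because the waiting time is independent of coordinate and
  location given the earlier nodes, while formation time and corners are functions of those nodes.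
  On active nodes the cell is nondegenerate, so \<open>nn_integral_split_law\<close>
  applies.\<close>

lemma nn_integral_node_split:
  fixes g :: "real \<Rightarrow> real \<Rightarrow> ennreal" and k :: "real ^ 'd::finite \<Rightarrow> real ^ 'd \<Rightarrow> 'd \<Rightarrow> real \<Rightarrow> ennreal"
  assumes l: "l > 0" and x: "x \<in> box 0 1"
    and g: "(\<lambda>z. g (fst z) (snd z)) \<in> borel_measurable (borel \<Otimes>\<^sub>M borel)"
    and k: "\<And>a b j. k a b j \<in> borel_measurable borel"
    and gk: "(\<lambda>h. g (formation_time h n) (waiting_time h n) * k (lower h n) (upper h n) (coord h n) (loc h n))
        \<in> borel_measurable (PiM {0..<Suc n} (\<lambda>_. split_space :: 'd split measure))"
  shows "(\<integral>\<^sup>+h. indicator {h. active l x h n \<and> covers p q h n} h *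
        (g (formation_time h n) (waiting_time h n) * k (lower h n) (upper h n) (coord h n) (loc h n)) \<partial>mondrian_law) =
     (\<integral>\<^sup>+h. indicator {h. active l x h n \<and> covers p q h n} h *
        ((\<integral>\<^sup>+e. ennreal (exponential_density (perimeter h n) e) * g (formation_time h n) e \<partial>lborel) *
        (\<Sum>j\<in>UNIV. ennreal (1 / perimeter h n) *
          (\<integral>\<^sup>+s. indicator {lower h n $ j..upper h n $ j} s * k (lower h n) (upper h n) j s \<partial>lborel))) \<partial>mondrian_law)"
    (is "?L = ?R")
proof -
  let ?F = "\<lambda>h. indicator {h. active l x h n \<and> covers p q h n} h *
        (g (formation_time h n) (waiting_time h n) * k (lower h n) (upper h n) (coord h n) (loc h n))"
  have F: "?F \<in> borel_measurable (PiM {0..<Suc n} (\<lambda>_. split_space :: 'd split measure))"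
  proof -
    note [measurable] = gk measurable_active[of n "Suc n"] measurable_covers[of n "Suc n"]
    show ?thesis by measurable
  qed
  have res: "lower (restrict h {0..<Suc n}) n = lower h n" "upper (restrict h {0..<Suc n}) n = upper h n"
     "formation_time (restrict h {0..<Suc n}) n = formation_time h n"
     "active l x (restrict h {0..<Suc n}) n = active l x h n" for h :: "'d history"
  proof -
    show "lower (restrict h {0..<Suc n}) n = lower h n" "upper (restrict h {0..<Suc n}) n = upper h n"
     "formation_time (restrict h {0..<Suc n}) n = formation_time h n"
      by (auto intro!: lower_upper_formation_time_cong)
    have "restrict (restrict h {0..<Suc n}) {0..<n} = restrict h {0..<n}" by auto
    then show "active l x (restrict h {0..<Suc n}) n = active l x h n"
      by (metis active_restrict)
  qed
  have "?L = (\<integral>\<^sup>+h. ?F (restrict h {0..<Suc n}) \<partial>mondrian_law)"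
    by (intro nn_integral_cong) (simp add: res indicator_def covers_def waiting_time_def coord_def loc_def)
  also have "\<dots> = (\<integral>\<^sup>+h. (\<integral>\<^sup>+z. ?F ((restrict h {0..<n})(n := z)) \<partial>split_kernel n (restrict h {0..<n})) \<partial>mondrian_law)"
    by (rule nn_integral_mondrian_law_step[OF F])
  also have "\<dots> = ?R"
  proof (rule nn_integral_cong)
    fix h :: "'d history"
    show "(\<integral>\<^sup>+z. ?F ((restrict h {0..<n})(n := z)) \<partial>split_kernel n (restrict h {0..<n})) =
      indicator {h. active l x h n \<and> covers p q h n} h *
        ((\<integral>\<^sup>+e. ennreal (exponential_density (perimeter h n) e) * g (formation_time h n) e \<partial>lborel) *
        (\<Sum>j\<in>UNIV. ennreal (1 / perimeter h n) *
          (\<integral>\<^sup>+s. indicator {lower h n $ j..upper h n $ j} s * k (lower h n) (upper h n) j s \<partial>lborel)))"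
    proof (cases "active l x h n \<and> covers p q h n")
      case True
      have "(\<integral>\<^sup>+z. ?F ((restrict h {0..<n})(n := z)) \<partial>split_kernel n (restrict h {0..<n})) =
         (\<integral>\<^sup>+z. g (formation_time h n) (fst z) * k (lower h n) (upper h n) (fst (snd z)) (snd (snd z))
           \<partial>split_law (lower h n) (upper h n))"
        unfolding waiting_time_def coord_def loc_def indicator_def mem_Collect_eq fun_upd_node active_restrict
          covers_restrict lower_upper_formation_time_restrict split_kernel_def using True by simp
      also have "\<dots> = (\<integral>\<^sup>+e. ennreal (exponential_density (perimeter h n) e) * g (formation_time h n) e \<partial>lborel) *
        (\<Sum>j\<in>UNIV. ennreal (1 / perimeter h n) *
          (\<integral>\<^sup>+s. indicator {lower h n $ j..upper h n $ j} s * k (lower h n) (upper h n) j s \<partial>lborel))"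
      proof (rule nn_integral_split_law[OF _ _ _ k])
        show "lower h n $ i < upper h n $ i" for i
          using active_corners[OF x conjunct1[OF True]] by (meson less_trans)
        show "g (formation_time h n) \<in> borel_measurable borel"
          using measurable_compose[OF measurable_Pair1'[of "formation_time h n" borel borel] g] by simp
      qed (simp add: perimeter_def)
      finally show ?thesis using True by simp
    next
      case False
      then show ?thesis
        unfolding indicator_def mem_Collect_eq fun_upd_node active_restrict covers_restrict by auto
    qed
  qed
  finally show ?thesis .
qed

lemma perimeter_bounds:
  fixes h :: "'d::finite history"
  assumes "x \<in> box 0 1" "active l x h n"
  shows "0 < perimeter h n" "perimeter h n \<le> CARD('d)"
proof -
  note c = active_corners[OF assms]
  show "0 < perimeter h n"
    unfolding perimeter_def using c by (intro sum_pos) (auto intro: less_trans)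
  have "perimeter h n \<le> (\<Sum>i\<in>(UNIV :: 'd set). 1)"
    unfolding perimeter_def
  proof (rule sum_mono)
    fix i show "upper h n $ i - lower h n $ i \<le> 1" using c[of i] by linarith
  qed
  then show "perimeter h n \<le> CARD('d)" by simp
qed

text \<open>If a cell of perimeter L splits, the cut avoids a box of perimeter r inside it with
  probability 1 - r / L, and then exactly one child, the one containing \<open>x\<close>, keeps the
  box. So both children together contribute a factor that does not depend on the position of the box
  in the cell.\<close>

lemma node_mass_children:
  fixes x p q :: "real ^ 'd::finite"
  assumes l: "l > 0" and x: "x \<in> box 0 1"
    and pq: "\<And>i. p $ i \<le> x $ i" "\<And>i. x $ i \<le> q $ i"
    and u [measurable]: "u \<in> borel_measurable borel"
  shows "node_mass l x p q u (2 * n + 1) + node_mass l x p q u (2 * n + 2) =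
    (\<integral>\<^sup>+h. indicator {h. active l x h n \<and> covers p q h n} h *
       ((\<integral>\<^sup>+e. ennreal (exponential_density (perimeter h n) e) *
           (indicator {..l - formation_time h n} e * u (formation_time h n + e)) \<partial>lborel) *
        ennreal (1 - (\<Sum>i\<in>UNIV. q $ i - p $ i) / perimeter h n)) \<partial>mondrian_law)"
proof -
  define g where "g = (\<lambda>t e :: real. indicator {..l - t} e * u (t + e))"
  define k where "k = (\<lambda>(a :: real ^ 'd) (b :: real ^ 'd) j s. indicator {a $ j..b $ j} s *
     ((indicator {s. x $ j < s \<and> q $ j \<le> s} s :: ennreal) + indicator {s. s < x $ j \<and> s \<le> p $ j} s))"
  have g: "(\<lambda>z. g (fst z) (snd z)) \<in> borel_measurable (borel \<Otimes>\<^sub>M borel)"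
    unfolding g_def indicator_def atMost_iff by measurable
  have k: "k a b j \<in> borel_measurable borel" for a b j
    unfolding k_def by measurable
  have gk: "(\<lambda>h. g (formation_time h n) (waiting_time h n) * k (lower h n) (upper h n) (coord h n) (loc h n))
        \<in> borel_measurable (PiM {0..<Suc n} (\<lambda>_. split_space :: 'd split measure))"
  proof -
    note [measurable] = measurable_history_component[of n "Suc n"] measurable_corners[of n "Suc n"]
      measurable_formation_time[of n "Suc n"]
    have "(\<lambda>h. k (lower h n) (upper h n) j (loc h n)) \<in> borel_measurable (PiM {0..<Suc n} (\<lambda>_. split_space :: 'd split measure))" for j
      unfolding k_def indicator_def mem_Collect_eq atLeastAtMost_iff by measurable
    then have [measurable]: "(\<lambda>h. k (lower h n) (upper h n) (coord h n) (loc h n)) \<in> borel_measurable (PiM {0..<Suc n} (\<lambda>_. split_space :: 'd split measure))"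
      by (rule measurable_compose_countable'[where I = UNIV]) auto
    show ?thesis
      unfolding g_def indicator_def atMost_iff by measurable
  qed
  have "node_mass l x p q u (2 * n + 1) + node_mass l x p q u (2 * n + 2) =
     (\<integral>\<^sup>+h. indicator {h. active l x h (2 * n + 1) \<and> covers p q h (2 * n + 1)} h * u (formation_time h (2 * n + 1)) +
        indicator {h. active l x h (2 * n + 2) \<and> covers p q h (2 * n + 2)} h * u (formation_time h (2 * n + 2)) \<partial>mondrian_law)"
    unfolding node_mass_def by (intro nn_integral_add[symmetric]) measurable
  also have "\<dots> = (\<integral>\<^sup>+h. indicator {h. active l x h n \<and> covers p q h n} h *
        (g (formation_time h n) (waiting_time h n) * k (lower h n) (upper h n) (coord h n) (loc h n)) \<partial>mondrian_law)"
    unfolding active_child_covers[OF pq]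
    by (intro nn_integral_cong)
       (auto simp: g_def k_def split_due_def indicator_def add.commute le_diff_eq)
  also have "\<dots> = (\<integral>\<^sup>+h. indicator {h. active l x h n \<and> covers p q h n} h *
        ((\<integral>\<^sup>+e. ennreal (exponential_density (perimeter h n) e) * g (formation_time h n) e \<partial>lborel) *
        (\<Sum>j\<in>UNIV. ennreal (1 / perimeter h n) *
          (\<integral>\<^sup>+s. indicator {lower h n $ j..upper h n $ j} s * k (lower h n) (upper h n) j s \<partial>lborel))) \<partial>mondrian_law)"
    by (rule nn_integral_node_split[OF l x g k gk])
  also have "\<dots> = (\<integral>\<^sup>+h. indicator {h. active l x h n \<and> covers p q h n} h *
       ((\<integral>\<^sup>+e. ennreal (exponential_density (perimeter h n) e) * g (formation_time h n) e \<partial>lborel) *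
        ennreal (1 - (\<Sum>i\<in>UNIV. q $ i - p $ i) / perimeter h n)) \<partial>mondrian_law)"
  proof (rule nn_integral_cong)
    fix h :: "'d history"
    show "indicator {h. active l x h n \<and> covers p q h n} h *
        ((\<integral>\<^sup>+e. ennreal (exponential_density (perimeter h n) e) * g (formation_time h n) e \<partial>lborel) *
        (\<Sum>j\<in>UNIV. ennreal (1 / perimeter h n) *
          (\<integral>\<^sup>+s. indicator {lower h n $ j..upper h n $ j} s * k (lower h n) (upper h n) j s \<partial>lborel))) =
       indicator {h. active l x h n \<and> covers p q h n} h *
       ((\<integral>\<^sup>+e. ennreal (exponential_density (perimeter h n) e) * g (formation_time h n) e \<partial>lborel) *
        ennreal (1 - (\<Sum>i\<in>UNIV. q $ i - p $ i) / perimeter h n))"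
    proof (cases "active l x h n \<and> covers p q h n")
      case True
      let ?a = "lower h n" and ?b = "upper h n"
      have L: "0 < perimeter h n" using perimeter_bounds[OF x] True by blast
      have ord: "?a $ j \<le> p $ j" "q $ j \<le> ?b $ j" for j using True by (auto simp: covers_def)
      have int: "(\<integral>\<^sup>+s. indicator {?a $ j..?b $ j} s * k ?a ?b j s \<partial>lborel) =
          ennreal ((?b $ j - ?a $ j) - (q $ j - p $ j))" for j
      proof -
        have "(\<integral>\<^sup>+s. indicator {?a $ j..?b $ j} s * k ?a ?b j s \<partial>lborel) =
            (\<integral>\<^sup>+s. indicator {q $ j..?b $ j} s + indicator {?a $ j..p $ j} s \<partial>lborel)"
          \<comment> \<open>If the box touches \<open>x\<close> in coordinate \<open>j\<close>, a
            cut exactly at \<open>x $ j\<close> is counted for neither child; it has measure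
            zero.\<close>
          using AE_lborel_singleton[of "x $ j"]
        proof (intro nn_integral_cong_AE, eventually_elim)
          case (elim s)
          then show ?case
            using ord[of j] pq[of j] by (auto simp: k_def indicator_def)
        qed
        also have "\<dots> = ennreal (?b $ j - q $ j) + ennreal (p $ j - ?a $ j)"
          using ord[of j] by (subst nn_integral_add) auto
        also have "\<dots> = ennreal ((?b $ j - ?a $ j) - (q $ j - p $ j))"
          using ord[of j] by (simp add: ennreal_plus[symmetric] del: ennreal_plus)
        finally show ?thesis .
      qed
      have nonneg: "0 \<le> (?b $ j - ?a $ j) - (q $ j - p $ j)" for j
        using ord[of j] by simp
      have "(\<Sum>j\<in>UNIV. ennreal (1 / perimeter h n) *
          (\<integral>\<^sup>+s. indicator {lower h n $ j..upper h n $ j} s * k (lower h n) (upper h n) j s \<partial>lborel)) =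
          (\<Sum>j\<in>UNIV. ennreal (1 / perimeter h n * ((?b $ j - ?a $ j) - (q $ j - p $ j))))"
        unfolding int using L nonneg by (intro sum.cong refl ennreal_mult[symmetric]) auto
      also have "\<dots> = ennreal (\<Sum>j\<in>UNIV. 1 / perimeter h n * ((?b $ j - ?a $ j) - (q $ j - p $ j)))"
        using L nonneg by (intro sum_ennreal) simp
      also have "(\<Sum>j\<in>UNIV. 1 / perimeter h n * ((?b $ j - ?a $ j) - (q $ j - p $ j))) =
          1 / perimeter h n * (perimeter h n - (\<Sum>i\<in>UNIV. q $ i - p $ i))"
        unfolding perimeter_def sum_distrib_left[symmetric] sum_subtractf by simp
      also have "\<dots> = 1 - (\<Sum>i\<in>UNIV. q $ i - p $ i) / perimeter h n"
        using L by (simp add: right_diff_distrib)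
      finally show ?thesis by simp
    next
      case False
      then show ?thesis by simp
    qed
  qed
  finally show ?thesis by (simp add: g_def)
qed

text \<open>The same integration as for the children, with the event that the waiting time exceeds
  the remaining lifetime; the location integrates out to 1.\<close>

lemma final_mass_eq:
  fixes x p q :: "real ^ 'd::finite"
  assumes l: "l > 0" and x: "x \<in> box 0 1"
  shows "final_mass l x p q n =
    (\<integral>\<^sup>+h. indicator {h. active l x h n \<and> covers p q h n} h *
       (\<integral>\<^sup>+e. ennreal (exponential_density (perimeter h n) e) *
           indicator {l - formation_time h n<..} e \<partial>lborel) \<partial>mondrian_law)"
proof -
  define g where "g = (\<lambda>t e :: real. indicator {l - t<..} e :: ennreal)"
  define k where "k = (\<lambda>(a :: real ^ 'd) (b :: real ^ 'd) (j :: 'd) (s :: real). 1 :: ennreal)"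
  have g: "(\<lambda>z. g (fst z) (snd z)) \<in> borel_measurable (borel \<Otimes>\<^sub>M borel)"
    unfolding g_def indicator_def greaterThan_iff by measurable
  have k: "k a b j \<in> borel_measurable borel" for a b j
    unfolding k_def by measurable
  have gk: "(\<lambda>h. g (formation_time h n) (waiting_time h n) * k (lower h n) (upper h n) (coord h n) (loc h n))
        \<in> borel_measurable (PiM {0..<Suc n} (\<lambda>_. split_space :: 'd split measure))"
  proof -
    note [measurable] = measurable_history_component[of n "Suc n"] measurable_formation_time[of n "Suc n"]
    show ?thesis
      unfolding g_def k_def indicator_def greaterThan_iff by measurable
  qed
  have "final_mass l x p q n = (\<integral>\<^sup>+h. indicator {h. active l x h n \<and> covers p q h n} h *
        (g (formation_time h n) (waiting_time h n) * k (lower h n) (upper h n) (coord h n) (loc h n)) \<partial>mondrian_law)"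
    unfolding final_mass_def
    by (intro nn_integral_cong) (auto simp: g_def k_def split_due_def indicator_def)
  also have "\<dots> = (\<integral>\<^sup>+h. indicator {h. active l x h n \<and> covers p q h n} h *
        ((\<integral>\<^sup>+e. ennreal (exponential_density (perimeter h n) e) * g (formation_time h n) e \<partial>lborel) *
        (\<Sum>j\<in>UNIV. ennreal (1 / perimeter h n) *
          (\<integral>\<^sup>+s. indicator {lower h n $ j..upper h n $ j} s * k (lower h n) (upper h n) j s \<partial>lborel))) \<partial>mondrian_law)"
    by (rule nn_integral_node_split[OF l x g k gk])
  also have "\<dots> = (\<integral>\<^sup>+h. indicator {h. active l x h n \<and> covers p q h n} h *
       (\<integral>\<^sup>+e. ennreal (exponential_density (perimeter h n) e) * g (formation_time h n) e \<partial>lborel) \<partial>mondrian_law)"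
  proof (rule nn_integral_cong)
    fix h :: "'d history"
    show "indicator {h. active l x h n \<and> covers p q h n} h *
        ((\<integral>\<^sup>+e. ennreal (exponential_density (perimeter h n) e) * g (formation_time h n) e \<partial>lborel) *
        (\<Sum>j\<in>UNIV. ennreal (1 / perimeter h n) *
          (\<integral>\<^sup>+s. indicator {lower h n $ j..upper h n $ j} s * k (lower h n) (upper h n) j s \<partial>lborel))) =
       indicator {h. active l x h n \<and> covers p q h n} h *
       (\<integral>\<^sup>+e. ennreal (exponential_density (perimeter h n) e) * g (formation_time h n) e \<partial>lborel)"
    proof (cases "active l x h n \<and> covers p q h n")
      case True
      have L: "0 < perimeter h n" using perimeter_bounds[OF x] True by blast
      have ab: "lower h n $ i \<le> upper h n $ i" for i
        using active_corners[OF x conjunct1[OF True], of i] by simp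
      have "(\<Sum>j\<in>UNIV. ennreal (1 / perimeter h n) *
          (\<integral>\<^sup>+s. indicator {lower h n $ j..upper h n $ j} s * k (lower h n) (upper h n) j s \<partial>lborel)) =
          (\<Sum>j\<in>UNIV. ennreal (1 / perimeter h n * (upper h n $ j - lower h n $ j)))"
      proof (intro sum.cong refl)
        fix j
        show "ennreal (1 / perimeter h n) *
          (\<integral>\<^sup>+s. indicator {lower h n $ j..upper h n $ j} s * k (lower h n) (upper h n) j s \<partial>lborel) =
          ennreal (1 / perimeter h n * (upper h n $ j - lower h n $ j))"
          using L ab[of j] by (subst ennreal_mult) (auto simp: k_def)
      qed
      also have "\<dots> = ennreal (\<Sum>j\<in>UNIV. 1 / perimeter h n * (upper h n $ j - lower h n $ j))"
        using L ab by (intro sum_ennreal) simp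
      also have "(\<Sum>j\<in>UNIV. 1 / perimeter h n * (upper h n $ j - lower h n $ j)) = 1"
        using L by (simp add: sum_distrib_left[symmetric] perimeter_def[symmetric] sum_divide_distrib[symmetric])
      finally show ?thesis by simp
    next
      case False
      then show ?thesis by simp
    qed
  qed
  finally show ?thesis by (simp add: g_def)
qed

section \<open>Survival of a box\<close>

lemma nn_integral_exponential_density_greaterThan:
  assumes "L > 0" "T \<ge> 0"
  shows "(\<integral>\<^sup>+e. ennreal (exponential_density L e) * indicator {T<..} e \<partial>lborel) = ennreal (exp (- L * T))"
proof -
  have "(\<integral>\<^sup>+e. ennreal (exponential_density L e) * indicator {T<..} e \<partial>lborel) =
      (\<integral>\<^sup>+e. ennreal (L * exp (- L * e)) * indicator {T..} e \<partial>lborel)"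
    using AE_lborel_singleton[of T]
  proof (intro nn_integral_cong_AE, eventually_elim)
    case (elim e)
    then show ?case using assms by (auto simp: exponential_density_def indicator_def mult.commute)
  qed
  also have "\<dots> = ennreal (0 - (- exp (- L * T)))"
  proof (rule nn_integral_FTC_atLeast)
    show "((\<lambda>e. - exp (- L * e)) \<longlongrightarrow> 0) at_top"
    proof -
      have "filterlim (\<lambda>e. - (L * e)) at_bot at_top"
        unfolding filterlim_uminus_at_bot minus_minus
        using assms(1) by (intro filterlim_tendsto_pos_mult_at_top[OF tendsto_const]) (auto simp: filterlim_ident)
      then have "((\<lambda>e. exp (- (L * e))) \<longlongrightarrow> 0) at_top"
        using filterlim_compose[OF exp_at_bot] by blast
      then show ?thesis using tendsto_minus by fastforce
    qed
  qed (use assms in \<open>auto intro!: derivative_eq_intros\<close>)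
  finally show ?thesis by simp
qed

text \<open>Either a cell of perimeter \<open>L\<close> survives for time \<open>T\<close>, or its first split avoids a covered
  box of perimeter \<open>r\<close> and the child then keeps the box for the remaining time.\<close>

lemma survival_recursion:
  assumes L: "L > 0" and r: "0 \<le> r" "r \<le> L" and T: "0 \<le> T"
  shows "
    (\<integral>\<^sup>+e. ennreal (exponential_density L e) * (indicator {..T} e * ennreal (exp (- (T - e) * r))) \<partial>lborel) *
      ennreal (1 - r / L) = ennreal (exp (- T * r) - exp (- L * T))"
proof -
  \<comment> \<open>Since \<open>L * (1 - r / L) = L - r\<close>, the integrand collapses to
    \<open>(L - r) * exp (- T * r) * exp (- (L - r) * e)\<close>, which has the antiderivative
    \<open>F\<close>, also when \<open>r = L\<close>.\<close>
  define F where "F e = - exp (- T * r) * exp (- (L - r) * e)" for e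
  define f where "f e = (L - r) * exp (- L * e) * exp (- (T - e) * r)" for e
  have rL: "0 \<le> 1 - r / L" using L r by simp
  have "(\<integral>\<^sup>+e. ennreal (exponential_density L e) * (indicator {..T} e * ennreal (exp (- (T - e) * r))) \<partial>lborel) * ennreal (1 - r / L)
     = (\<integral>\<^sup>+e. ennreal (exponential_density L e) * (indicator {..T} e * ennreal (exp (- (T - e) * r))) * ennreal (1 - r / L) \<partial>lborel)"
    by (rule nn_integral_multc[symmetric]) measurable
  also have "\<dots> = (\<integral>\<^sup>+e. ennreal (f e) * indicator {0..T} e \<partial>lborel)"
  proof (rule nn_integral_cong)
    fix e :: real
    show "ennreal (exponential_density L e) * (indicator {..T} e * ennreal (exp (- (T - e) * r))) * ennreal (1 - r / L) =
        ennreal (f e) * indicator {0..T} e"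
    proof (cases "0 \<le> e \<and> e \<le> T")
      case True
      have "ennreal (exponential_density L e) * ennreal (exp (- (T - e) * r)) * ennreal (1 - r / L) =
          ennreal ((L * exp (- e * L)) * exp (- (T - e) * r) * (1 - r / L))"
        using True L rL by (simp add: exponential_density_def ennreal_mult'')
      also have "(L * exp (- e * L)) * exp (- (T - e) * r) * (1 - r / L) = f e"
        using L by (simp add: f_def field_simps)
      finally show ?thesis using True by simp
    next
      case False
      then show ?thesis by (auto simp: exponential_density_def indicator_def)
    qed
  qed
  also have "\<dots> = ennreal (F T - F 0)"
  proof (rule nn_integral_FTC_Icc)
    show "f \<in> borel_measurable borel" unfolding f_def by measurable
    show "DERIV F e :> f e" for e
      unfolding F_def f_def
      by (auto intro!: derivative_eq_intros simp: algebra_simps exp_add[symmetric] mult_exp_exp)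
    show "0 \<le> f e" for e using r by (simp add: f_def)
  qed (use T in auto)
  also have "F T - F 0 = exp (- T * r) - exp (- L * T)"
    by (simp add: F_def mult_exp_exp algebra_simps)
  finally show ?thesis .
qed

text \<open>At 1 the Laplace transform of the exponential law of rate \<open>L\<close> is
  \<open>L / (L + 1)\<close>, which increases with \<open>L\<close>. A common bound \<open>d\<close>
  on the rates thus gives a common factor below 1, and truncation at \<open>T\<close> only decreases
  the integral.\<close>

lemma exponential_contraction:
  assumes L: "L > 0" "L \<le> d"
  shows "(\<integral>\<^sup>+e. ennreal (exponential_density L e) * (indicator {..T} e * ennreal (exp (- (t + e)))) \<partial>lborel)
     \<le> ennreal (d / (d + 1)) * ennreal (exp (- t))"
proof -
  have "(\<integral>\<^sup>+e. ennreal (exponential_density L e) * (indicator {..T} e * ennreal (exp (- (t + e)))) \<partial>lborel)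
     \<le> (\<integral>\<^sup>+e. ennreal (L / (L + 1) * exp (- t)) * ennreal (exponential_density (L + 1) e) \<partial>lborel)"
  proof (rule nn_integral_mono)
    fix e :: real
    have "ennreal (exponential_density L e) * ennreal (exp (- (t + e))) =
        ennreal (exponential_density L e * exp (- (t + e)))"
      by (simp add: ennreal_mult'')
    also have "exponential_density L e * exp (- (t + e)) = L / (L + 1) * exp (- t) * exponential_density (L + 1) e"
      using L by (simp add: exponential_density_def mult_exp_exp field_simps exp_add[symmetric])
    also have "ennreal \<dots> = ennreal (L / (L + 1) * exp (- t)) * ennreal (exponential_density (L + 1) e)"
      using L by (intro ennreal_mult) (auto intro!: exponential_density_nonneg)
    finally show "ennreal (exponential_density L e) * (indicator {..T} e * ennreal (exp (- (t + e)))) \<le>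
        ennreal (L / (L + 1) * exp (- t)) * ennreal (exponential_density (L + 1) e)"
      by (auto simp: indicator_def)
  qed
  also have "\<dots> = ennreal (L / (L + 1) * exp (- t))"
    using prob_space.emeasure_space_1[OF prob_space_exponential_density[of "L + 1"]] L
    by (simp add: nn_integral_cmult emeasure_density)
  also have "\<dots> \<le> ennreal (d / (d + 1) * exp (- t))"
    using L by (intro ennreal_leI mult_right_mono) (auto simp: field_simps)
  also have "\<dots> = ennreal (d / (d + 1)) * ennreal (exp (- t))"
    using L by (intro ennreal_mult) auto
  finally show ?thesis .
qed
text \<open>\<open>?M n\<close> weights node \<open>n\<close> with the conjectured survival
  probability over the remaining time. By \<open>survival_recursion\<close> it equals the mass that
  is final at \<open>n\<close> plus the masses of the two children. In the sum over all nodes every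
  node except the root occurs once as a child, so what remains is that the final masses add up to
  \<open>?M 0\<close>, which is the claimed value because the root is formed at time 0.\<close>

lemma suminf_final_mass:
  fixes x p q :: "real ^ 'd::finite"
  assumes l: "l > 0" and x: "x \<in> box 0 1"
    and px: "\<And>i. p $ i \<le> x $ i" and xq: "\<And>i. x $ i \<le> q $ i"
    and p0: "\<And>i. 0 \<le> p $ i" and q1: "\<And>i. q $ i \<le> 1"
  shows "(\<Sum>n. final_mass l x p q n) = ennreal (exp (- l * (\<Sum>i\<in>UNIV. q $ i - p $ i)))"
proof -
  define r where "r = (\<Sum>i\<in>UNIV. q $ i - p $ i)"
  have pq: "p $ i \<le> q $ i" for i using px[of i] xq[of i] by simp
  have r0: "0 \<le> r" unfolding r_def using pq by (intro sum_nonneg) simp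
  define u where "u t = ennreal (exp (- (l - t) * r))" for t
  have [measurable]: "u \<in> borel_measurable borel" unfolding u_def by measurable
  let ?M = "node_mass l x p q u"
  let ?I = "\<lambda>n h. indicator {h. active l x h n \<and> covers p q h n} h :: ennreal"
  have [measurable]: "(\<lambda>h. perimeter h n) \<in> borel_measurable mondrian_law" for n :: nat
    unfolding perimeter_def by measurable
  have step: "?M n = final_mass l x p q n + (?M (2 * n + 1) + ?M (2 * n + 2))" for n
  proof -
    let ?T = "\<lambda>h. l - formation_time h n" and ?L = "\<lambda>h. perimeter h n"
    have bnds: "0 < ?L h \<and> 0 \<le> ?T h \<and> r \<le> ?L h" if "active l x h n" "covers p q h n" for h
    proof -
      have "r \<le> ?L h"
        unfolding r_def perimeter_def using that(2) by (intro sum_mono) (auto simp: covers_def intro: diff_mono)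
      then show ?thesis
        using perimeter_bounds[OF x that(1)] active_formation_time[OF _ that(1)] l by simp
    qed
    have f: "final_mass l x p q n = (\<integral>\<^sup>+h. ?I n h * ennreal (exp (- ?L h * ?T h)) \<partial>mondrian_law)"
      unfolding final_mass_eq[OF l x]
    proof (rule nn_integral_cong)
      fix h :: "'d history"
      show "?I n h * (\<integral>\<^sup>+e. ennreal (exponential_density (?L h) e) * indicator {?T h<..} e \<partial>lborel) =
         ?I n h * ennreal (exp (- ?L h * ?T h))"
        using bnds[of h] nn_integral_exponential_density_greaterThan[of "?L h" "?T h"]
        by (cases "active l x h n \<and> covers p q h n") auto
    qed
    have c: "?M (2 * n + 1) + ?M (2 * n + 2) =
        (\<integral>\<^sup>+h. ?I n h * ennreal (exp (- ?T h * r) - exp (- ?L h * ?T h)) \<partial>mondrian_law)"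
      unfolding node_mass_children[OF l x px xq \<open>u \<in> borel_measurable borel\<close>]
    proof (rule nn_integral_cong)
      fix h :: "'d history"
      have "(\<integral>\<^sup>+e. ennreal (exponential_density (?L h) e) * (indicator {..?T h} e * u (formation_time h n + e)) \<partial>lborel) *
          ennreal (1 - r / ?L h) = ennreal (exp (- ?T h * r) - exp (- ?L h * ?T h))"
        if "active l x h n" "covers p q h n"
        using survival_recursion[of "?L h" r "?T h"] bnds[OF that] r0 by (simp add: u_def algebra_simps)
      then show "?I n h * ((\<integral>\<^sup>+e. ennreal (exponential_density (?L h) e) * (indicator {..?T h} e * u (formation_time h n + e)) \<partial>lborel) *
          ennreal (1 - (\<Sum>i\<in>UNIV. q $ i - p $ i) / ?L h)) = ?I n h * ennreal (exp (- ?T h * r) - exp (- ?L h * ?T h))"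
        unfolding r_def[symmetric] by (cases "active l x h n \<and> covers p q h n") auto
    qed
    have "final_mass l x p q n + (?M (2 * n + 1) + ?M (2 * n + 2)) =
        (\<integral>\<^sup>+h. ?I n h * ennreal (exp (- ?L h * ?T h)) + ?I n h * ennreal (exp (- ?T h * r) - exp (- ?L h * ?T h)) \<partial>mondrian_law)"
      unfolding f c by (rule nn_integral_add[symmetric]) measurable
    also have "\<dots> = ?M n"
      unfolding node_mass_def
    proof (rule nn_integral_cong)
      fix h :: "'d history"
      have "exp (- ?L h * ?T h) \<le> exp (- ?T h * r)" if "active l x h n" "covers p q h n"
        using bnds[OF that] mult_left_mono[of r "?L h" "?T h"] by (simp add: algebra_simps)
      then show "?I n h * ennreal (exp (- ?L h * ?T h)) + ?I n h * ennreal (exp (- ?T h * r) - exp (- ?L h * ?T h)) =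
          ?I n h * u (formation_time h n)"
        by (cases "active l x h n \<and> covers p q h n") (auto simp: u_def ennreal_plus[symmetric] simp del: ennreal_plus)
    qed
    finally show ?thesis by simp
  qed
  \<comment> \<open>Weighting with \<open>exp (- t)\<close> makes the mass contract from one generation to the next: there is
    no explosion.\<close>
  have fin: "(\<Sum>n. ?M n) \<noteq> \<infinity>"
  proof -
    define v :: "real \<Rightarrow> ennreal" where "v t = ennreal (exp (- t))" for t
    have v [measurable]: "v \<in> borel_measurable borel" unfolding v_def by measurable
    let ?R = "node_mass l x x x v"
    let ?J = "\<lambda>n h. indicator {h. active l x h n \<and> covers x x h n} h :: ennreal"
    interpret P: prob_space "mondrian_law :: 'd history measure" by (rule prob_space_mondrian_law)
    have Rstep: "?R (2 * n + 1) + ?R (2 * n + 2) \<le> ennreal (real CARD('d) / (real CARD('d) + 1)) * ?R n" for n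
    proof -
      have "?R (2 * n + 1) + ?R (2 * n + 2) \<le>
          (\<integral>\<^sup>+h. ennreal (real CARD('d) / (real CARD('d) + 1)) * (?J n h * v (formation_time h n)) \<partial>mondrian_law)"
        unfolding node_mass_children[OF l x order_refl order_refl v]
      proof (rule nn_integral_mono)
        fix h :: "'d history"
        show "?J n h * ((\<integral>\<^sup>+e. ennreal (exponential_density (perimeter h n) e) *
            (indicator {..l - formation_time h n} e * v (formation_time h n + e)) \<partial>lborel) *
            ennreal (1 - (\<Sum>i\<in>UNIV. x $ i - x $ i) / perimeter h n)) \<le>
            ennreal (real CARD('d) / (real CARD('d) + 1)) * (?J n h * v (formation_time h n))"
          using exponential_contraction[OF perimeter_bounds[OF x], of l h n] 
          by (cases "active l x h n \<and> covers x x h n") (auto simp: v_def)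
      qed
      also have "\<dots> = ennreal (real CARD('d) / (real CARD('d) + 1)) * ?R n"
        unfolding node_mass_def by (rule nn_integral_cmult) measurable
      finally show "?R (2 * n + 1) + ?R (2 * n + 2) \<le> ennreal (real CARD('d) / (real CARD('d) + 1)) * ?R n" .
    qed
    \<comment> \<open>A node has at most the mass of itself and its sibling together, hence at most
      that of its parent; the root has mass 1.\<close>
    have R1: "?R n \<le> 1" for n
    proof (induction n rule: less_induct)
      case (less n)
      show ?case
      proof (cases n)
        case 0
        have "?R 0 = (\<integral>\<^sup>+h. 1 \<partial>(mondrian_law :: 'd history measure))"
          unfolding node_mass_def using x
          by (intro nn_integral_cong) (auto simp: covers_def v_def mem_box_cart less_imp_le)
        then show ?thesis using P.emeasure_space_1 0 by simp
      next
        case (Suc m)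
        let ?k = "m div 2"
        have "?R n \<le> ?R (2 * ?k + 1) + ?R (2 * ?k + 2)"
        proof (cases "even m")
          case True
          then have "n = 2 * ?k + 1" using Suc by simp
          then show ?thesis by (metis add_increasing2 order_refl zero_le)
        next
          case False
          then have "n = 2 * ?k + 2" using Suc by presburger
          then show ?thesis by (metis add_increasing order_refl zero_le)
        qed
        also have "\<dots> \<le> ennreal (real CARD('d) / (real CARD('d) + 1)) * ?R ?k" by (rule Rstep)
        also have "\<dots> \<le> 1 * 1"
          using less.IH[of ?k] Suc by (intro mult_mono) (auto simp: ennreal_le_1)
        finally show ?thesis by simp
      qed
    qed
    have "(\<Sum>n. ?R n) \<noteq> \<infinity>"
      by (rule suminf_binary_tree_contraction[OF Rstep R1]) auto
    \<comment> \<open>The survival weight is at most 1, while \<open>exp l * v t\<close> is at least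
      1 at a formation time \<open>t \<le> l\<close>, as it is on active nodes. An active node
      always covers the degenerate box at \<open>x\<close>.\<close>
    moreover have "(\<Sum>n. ?M n) \<le> (\<Sum>n. ennreal (exp l) * ?R n)"
    proof (intro suminf_le summableI)
      fix n
      have "?M n \<le> (\<integral>\<^sup>+h. ennreal (exp l) * (?J n h * v (formation_time h n)) \<partial>mondrian_law)"
        unfolding node_mass_def
      proof (rule nn_integral_mono)
        fix h :: "'d history"
        show "?I n h * u (formation_time h n) \<le> ennreal (exp l) * (?J n h * v (formation_time h n))"
        proof (cases "active l x h n \<and> covers p q h n")
          case True
          have t: "formation_time h n \<le> l" using active_formation_time[OF less_imp_le[OF l]] True by blast
          have "covers x x h n"
            using active_corners[OF x conjunct1[OF True]] by (auto simp: covers_def less_imp_le)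
          moreover have "exp (- (l - formation_time h n) * r) \<le> exp (l - formation_time h n)"
          proof -
            have "0 \<le> (l - formation_time h n) * r" using t r0 by simp
            then show ?thesis using t by (simp only: exp_le_cancel_iff)
          qed
          ultimately show ?thesis
            using True by (simp add: u_def v_def ennreal_mult''[symmetric] mult_exp_exp)
        qed simp
      qed
      also have "\<dots> = ennreal (exp l) * ?R n"
        unfolding node_mass_def by (rule nn_integral_cmult) measurable
      finally show "?M n \<le> ennreal (exp l) * ?R n" .
    qed
    ultimately show ?thesis
      by (auto simp: ennreal_suminf_cmult ennreal_mult_eq_top_iff top_unique)
  qed
  have "?M 0 + (\<Sum>n. ?M (2 * n + 1) + ?M (2 * n + 2)) = (\<Sum>n. ?M n)"
    by (rule suminf_binary_tree[symmetric])
  also have "\<dots> = (\<Sum>n. final_mass l x p q n + (?M (2 * n + 1) + ?M (2 * n + 2)))"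
    using step by (intro suminf_cong)
  also have "\<dots> = (\<Sum>n. final_mass l x p q n) + (\<Sum>n. ?M (2 * n + 1) + ?M (2 * n + 2))"
    by (intro suminf_add[symmetric] summableI)
  finally have "(\<Sum>n. ?M (2 * n + 1) + ?M (2 * n + 2)) + ?M 0 =
      (\<Sum>n. ?M (2 * n + 1) + ?M (2 * n + 2)) + (\<Sum>n. final_mass l x p q n)"
    by (simp only: add.commute)
  \<comment> \<open>In \<open>ennreal\<close> only a finite summand can be cancelled; this is what
    \<open>fin\<close> is for.\<close>
  moreover have "(\<Sum>n. ?M (2 * n + 1) + ?M (2 * n + 2)) \<noteq> \<infinity>"
    using fin unfolding suminf_binary_tree[of ?M] by auto
  ultimately have "(\<Sum>n. final_mass l x p q n) = ?M 0"
    unfolding ennreal_add_left_cancel by simp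
  also have "?M 0 = ennreal (exp (- l * r))"
  proof -
    interpret P: prob_space "mondrian_law :: 'd history measure" by (rule prob_space_mondrian_law)
    have "?M 0 = (\<integral>\<^sup>+h. ennreal (exp (- l * r)) \<partial>(mondrian_law :: 'd history measure))"
      unfolding node_mass_def using p0 q1 by (intro nn_integral_cong) (simp add: covers_def u_def)
    then show ?thesis using P.emeasure_space_1 by simp
  qed
  finally show ?thesis by (simp add: r_def)
qed

section \<open>Law of the cell containing a point\<close>

text \<open>\<open>LEAST\<close> yields a total function whose measurability is evident. There is
  never more than one such node, and almost surely there is one; on the exceptional null set the
  value is arbitrary.\<close>

definition final_node :: "real \<Rightarrow> real ^ 'd::finite \<Rightarrow> 'd history \<Rightarrow> nat" where
  "final_node l x h = (LEAST n. active l x h n \<and> l < split_due h n)"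

definition final_lower :: "real \<Rightarrow> real ^ 'd::finite \<Rightarrow> 'd history \<Rightarrow> real ^ 'd" where
  "final_lower l x h = lower h (final_node l x h)"

definition final_upper :: "real \<Rightarrow> real ^ 'd::finite \<Rightarrow> 'd history \<Rightarrow> real ^ 'd" where
  "final_upper l x h = upper h (final_node l x h)"

lemma final_node_eq:
  assumes "x \<in> box 0 1" "active l x h n" "l < split_due h n"
  shows "final_node l x h = n"
proof -
  have "active l x h (final_node l x h) \<and> l < split_due h (final_node l x h)"
    unfolding final_node_def by (rule LeastI[of _ n]) (use assms in simp)
  then show ?thesis
    using assms by (intro final_node_unique[of x h _ l]) (auto intro: active_mem_cell active_formed)
qed

lemma measurable_final [measurable]:
  "(\<lambda>h. final_lower l x h $ i) \<in> borel_measurable mondrian_law"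
  "(\<lambda>h. final_upper l x h $ i) \<in> borel_measurable mondrian_law"
proof -
  have [measurable]: "final_node l x \<in> measurable mondrian_law (count_space UNIV)"
    unfolding final_node_def[abs_def] by measurable
  have "(\<lambda>h. (\<lambda>n h. lower h n $ i) (final_node l x h) h) \<in> borel_measurable mondrian_law"
    by (rule measurable_compose_countable) measurable
  then show "(\<lambda>h. final_lower l x h $ i) \<in> borel_measurable mondrian_law"
    by (simp add: final_lower_def)
  have "(\<lambda>h. (\<lambda>n h. upper h n $ i) (final_node l x h) h) \<in> borel_measurable mondrian_law"
    by (rule measurable_compose_countable) measurable
  then show "(\<lambda>h. final_upper l x h $ i) \<in> borel_measurable mondrian_law"
    by (simp add: final_upper_def)
qed

text \<open>By uniqueness of the final node the events for different \<open>n\<close> are disjoint,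
  so the final masses add up to the probability of the union.\<close>

lemma emeasure_final_node:
  fixes x p q :: "real ^ 'd::finite"
  assumes l: "l > 0" and x: "x \<in> box 0 1"
    and px: "\<And>i. p $ i \<le> x $ i" and xq: "\<And>i. x $ i \<le> q $ i"
    and p0: "\<And>i. 0 \<le> p $ i" and q1: "\<And>i. q $ i \<le> 1"
  shows "emeasure mondrian_law {h. \<exists>n. active l x h n \<and> covers p q h n \<and> l < split_due h n} =
    ennreal (exp (- l * (\<Sum>i\<in>UNIV. q $ i - p $ i)))"
proof -
  let ?A = "\<lambda>n. {h. active l x h n \<and> covers p q h n \<and> l < split_due h n}"
  have A: "?A n \<in> sets mondrian_law" for n
  proof -
    have "{h \<in> space mondrian_law. active l x h n \<and> covers p q h n \<and> l < split_due h n} \<in> sets mondrian_law"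
      by measurable
    then show ?thesis by simp
  qed
  have "disjoint_family ?A"
    unfolding disjoint_family_on_def using final_node_eq[OF x] by blast
  then have "(\<Sum>n. emeasure mondrian_law (?A n)) = emeasure mondrian_law (\<Union>n. ?A n)"
    using A by (intro suminf_emeasure) auto
  moreover have "emeasure mondrian_law (?A n) = final_mass l x p q n" for n
    unfolding final_mass_def using A[of n] by simp
  moreover have "(\<Union>n. ?A n) = {h. \<exists>n. active l x h n \<and> covers p q h n \<and> l < split_due h n}"
    by auto
  ultimately show ?thesis
    using suminf_final_mass[OF l x px xq p0 q1] by simp
qed

text \<open>The box reduced to the point \<open>x\<close> has perimeter 0, so it survives with
  probability 1. This excludes at once infinitely many cuts before \<open>l\<close> and cuts through
  \<open>x\<close>.\<close>

lemma AE_final_node: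
  fixes x :: "real ^ 'd::finite"
  assumes l: "l > 0" and x: "x \<in> box 0 1"
  shows "AE h in mondrian_law. \<exists>n. active l x h n \<and> l < split_due h n"
proof -
  interpret P: prob_space "mondrian_law :: 'd history measure" by (rule prob_space_mondrian_law)
  have x01: "0 \<le> x $ i" "x $ i \<le> 1" for i using x by (auto simp: mem_box_cart less_imp_le)
  have "emeasure mondrian_law {h. \<exists>n. active l x h n \<and> covers x x h n \<and> l < split_due h n} = 1"
    using emeasure_final_node[OF l x order_refl order_refl x01] by simp
  then have "AE h in mondrian_law. h \<in> {h. \<exists>n. active l x h n \<and> covers x x h n \<and> l < split_due h n}"
    by (intro P.AE_prob_1) (simp add: P.emeasure_eq_measure)
  then show ?thesis by eventually_elim blast
qed

lemma AE_final_cell: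
  fixes x :: "real ^ 'd::finite"
  assumes l: "l > 0" and x: "x \<in> box 0 1"
  shows "AE h in mondrian_law.
     (\<forall>i. 0 \<le> final_lower l x h $ i \<and> final_lower l x h $ i < x $ i \<and>
          x $ i < final_upper l x h $ i \<and> final_upper l x h $ i \<le> 1) \<and>
     box (final_lower l x h) (final_upper l x h) \<subseteq> cell_of (mondrian_partition l h) x \<and>
     cell_of (mondrian_partition l h) x \<subseteq> cbox (final_lower l x h) (final_upper l x h)"
  using AE_final_node[OF assms]
proof eventually_elim
  case (elim h)
  then obtain n where n: "active l x h n" "l < split_due h n" by blast
  have e: "final_node l x h = n" by (rule final_node_eq[OF x n])
  have "cell_of (mondrian_partition l h) x = cell h n"
    using n x by (intro mondrian_cell_of_eq active_mem_cell active_formed) auto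
  then show ?case
    using active_corners[OF x n(1)] active_box_subset_cell[OF x n(1)] cell_subset_cbox[of h n]
    by (simp add: final_lower_def final_upper_def e)
qed

lemma prob_final_covers:
  fixes x p q :: "real ^ 'd::finite"
  assumes l: "l > 0" and x: "x \<in> box 0 1"
    and px: "\<And>i. p $ i \<le> x $ i" and xq: "\<And>i. x $ i \<le> q $ i"
    and p0: "\<And>i. 0 \<le> p $ i" and q1: "\<And>i. q $ i \<le> 1"
  shows "measure mondrian_law {h. \<forall>i. final_lower l x h $ i \<le> p $ i \<and> q $ i \<le> final_upper l x h $ i} =
    exp (- l * (\<Sum>i\<in>UNIV. q $ i - p $ i))"
proof -
  interpret P: prob_space "mondrian_law :: 'd history measure" by (rule prob_space_mondrian_law)
  let ?E = "{h. \<exists>n. active l x h n \<and> covers p q h n \<and> l < split_due h n}"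
  let ?F = "{h. \<forall>i. final_lower l x h $ i \<le> p $ i \<and> q $ i \<le> final_upper l x h $ i}"
  have "{h \<in> space mondrian_law. \<exists>n. active l x h n \<and> covers p q h n \<and> l < split_due h n} \<in> sets mondrian_law"
    "{h \<in> space mondrian_law. \<forall>i. final_lower l x h $ i \<le> p $ i \<and> q $ i \<le> final_upper l x h $ i} \<in> sets mondrian_law"
    by measurable
  then have sets: "?E \<in> sets mondrian_law" "?F \<in> sets mondrian_law" by simp_all
  have "measure mondrian_law ?F = measure mondrian_law ?E"
  proof (rule P.finite_measure_eq_AE[OF _ sets(2,1)])
    show "AE h in mondrian_law. h \<in> ?F \<longleftrightarrow> h \<in> ?E"
      using AE_final_node[OF l x]
    proof eventually_elim
      case (elim h)
      then obtain n where n: "active l x h n" "l < split_due h n" by blast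
      have e: "final_node l x h = m" if "active l x h m" "l < split_due h m" for m
        using that by (rule final_node_eq[OF x])
      show ?case
        using n e[of n] e by (auto simp: final_lower_def final_upper_def covers_def)
    qed
  qed
  also have "\<dots> = exp (- l * (\<Sum>i\<in>UNIV. q $ i - p $ i))"
    using emeasure_final_node[OF l x px xq p0 q1] by (simp add: measure_def)
  finally show ?thesis .
qed

section \<open>The 2 d distances from \<open>x\<close> to the faces of its final cell\<close>

definition margin :: "real \<Rightarrow> real ^ 'd::finite \<Rightarrow> 'd \<times> bool \<Rightarrow> 'd history \<Rightarrow> real" where
  "margin l x k h = (if snd k then x $ fst k - final_lower l x h $ fst k
     else final_upper l x h $ fst k - x $ fst k)"

definition max_margin :: "real ^ 'd::finite \<Rightarrow> 'd \<times> bool \<Rightarrow> real" where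
  "max_margin x k = (if snd k then x $ fst k else 1 - x $ fst k)"

lemma max_margin_pos: "x \<in> box 0 1 \<Longrightarrow> 0 < max_margin x k"
  by (auto simp: max_margin_def mem_box_cart)

lemma measurable_margin [measurable]: "margin l x k \<in> borel_measurable mondrian_law"
  unfolding margin_def[abs_def] by measurable

lemma AE_margin:
  assumes "l > 0" "x \<in> box 0 1"
  shows "AE h in mondrian_law. \<forall>k. 0 < margin l x k h \<and> margin l x k h \<le> max_margin x k"
  using AE_final_cell[OF assms] by eventually_elim (auto simp: margin_def max_margin_def)

lemma sum_prod_bool:
  fixes f :: "'d::finite \<times> bool \<Rightarrow> 'a::comm_monoid_add"
  shows "(\<Sum>k\<in>UNIV. f k) = (\<Sum>i\<in>UNIV. f (i, True) + f (i, False))"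
proof -
  have "(\<Sum>k\<in>UNIV. f k) = (\<Sum>i\<in>UNIV. \<Sum>b\<in>UNIV. f (i, b))"
    by (simp add: sum.cartesian_product)
  then show ?thesis by (simp add: UNIV_bool add.commute)
qed

text \<open>The probability that min(E, c) \<ge> r for E exponential of rate \<open>l\<close>. A
  margin that reaches the face of the cube equals \<open>c\<close>, an atom of mass
  \<open>exp (- l * c)\<close>.\<close>

definition margin_tail :: "real \<Rightarrow> real \<Rightarrow> real \<Rightarrow> real" where
  "margin_tail l c r = (if r \<le> 0 then 1 else if r \<le> c then exp (- l * r) else 0)"

text \<open>All margins reach their thresholds exactly if the final cell covers the box with these
  distances from \<open>x\<close>. The perimeter of the box is the sum of the thresholds, so the
  survival probability factorises. Negative thresholds are clipped to 0, and one beyond the cube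
  makes both sides 0.\<close>

lemma prob_margins_ge:
  fixes x :: "real ^ 'd::finite" and r :: "'d \<times> bool \<Rightarrow> real"
  assumes l: "l > 0" and x: "x \<in> box 0 1"
  shows "measure mondrian_law {h. \<forall>k. r k \<le> margin l x k h} = (\<Prod>k\<in>UNIV. margin_tail l (max_margin x k) (r k))"
proof -
  interpret P: prob_space "mondrian_law :: 'd history measure" by (rule prob_space_mondrian_law)
  have "{h \<in> space mondrian_law. \<forall>k. r k \<le> margin l x k h} \<in> sets mondrian_law" by measurable
  then have sets [measurable]: "{h. \<forall>k. r k \<le> margin l x k h} \<in> sets mondrian_law" by simp
  show ?thesis
  proof (cases "\<exists>k. max_margin x k < r k")
    case True
    then obtain k where k: "max_margin x k < r k" by blast
    have "AE h in mondrian_law. h \<notin> {h. \<forall>k. r k \<le> margin l x k h}"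
      using AE_margin[OF l x]
    proof eventually_elim
      case (elim h)
      then have "margin l x k h < r k" using k by (meson le_less_trans)
      then have "\<not> r k \<le> margin l x k h" by simp
      then show ?case by blast
    qed
    then have "measure mondrian_law {h. \<forall>k. r k \<le> margin l x k h} = 0"
      using AE_iff_measurable[OF sets, of "\<lambda>h. h \<notin> {h. \<forall>k. r k \<le> margin l x k h}"]
      by (simp add: measure_def)
    moreover have "margin_tail l (max_margin x k) (r k) = 0"
      using k max_margin_pos[OF x, of k] by (simp add: margin_tail_def)
    then have "(\<Prod>k\<in>UNIV. margin_tail l (max_margin x k) (r k)) = 0"
      by (intro prod_zero bexI[of _ k]) auto
    ultimately show ?thesis by simp
  next
    case False
    then have le: "r k \<le> max_margin x k" for k by (meson not_le)
    define r' where "r' k = max 0 (r k)" for k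
    have r': "0 \<le> r' k" "r' k \<le> max_margin x k" for k
      using le[of k] max_margin_pos[OF x, of k] by (auto simp: r'_def)
    define p :: "real ^ 'd" where "p = (\<chi> i. x $ i - r' (i, True))"
    define q :: "real ^ 'd" where "q = (\<chi> i. x $ i + r' (i, False))"
    have "measure mondrian_law {h. \<forall>k. r k \<le> margin l x k h} =
        measure mondrian_law {h. \<forall>i. final_lower l x h $ i \<le> p $ i \<and> q $ i \<le> final_upper l x h $ i}"
    proof (rule P.finite_measure_eq_AE)
      show "AE h in mondrian_law. h \<in> {h. \<forall>k. r k \<le> margin l x k h} \<longleftrightarrow>
          h \<in> {h. \<forall>i. final_lower l x h $ i \<le> p $ i \<and> q $ i \<le> final_upper l x h $ i}"
        using AE_margin[OF l x]
      proof eventually_elim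
        case (elim h)
        have "r k \<le> margin l x k h \<longleftrightarrow> r' k \<le> margin l x k h" for k
          using spec[OF elim, of k] by (auto simp: r'_def)
        then have "(\<forall>k. r k \<le> margin l x k h) \<longleftrightarrow>
            (\<forall>i. r' (i, True) \<le> margin l x (i, True) h \<and> r' (i, False) \<le> margin l x (i, False) h)"
          by (metis (full_types) surj_pair)
        also have "\<dots> \<longleftrightarrow> (\<forall>i. final_lower l x h $ i \<le> p $ i \<and> q $ i \<le> final_upper l x h $ i)"
          by (auto simp: margin_def p_def q_def algebra_simps)
        finally show ?case by simp
      qed
      have "{h \<in> space mondrian_law. \<forall>i. final_lower l x h $ i \<le> p $ i \<and> q $ i \<le> final_upper l x h $ i} \<in> sets mondrian_law"
        by measurable
      then show "{h. \<forall>i. final_lower l x h $ i \<le> p $ i \<and> q $ i \<le> final_upper l x h $ i} \<in> sets mondrian_law"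
        by simp
    qed (rule sets)
    also have "\<dots> = exp (- l * (\<Sum>i\<in>UNIV. q $ i - p $ i))"
    proof (rule prob_final_covers[OF l x])
      fix i
      show "p $ i \<le> x $ i" "x $ i \<le> q $ i" using r'(1) by (auto simp: p_def q_def)
      show "0 \<le> p $ i" "q $ i \<le> 1"
        using r'(2)[of "(i, True)"] r'(2)[of "(i, False)"] by (auto simp: p_def q_def max_margin_def)
    qed
    also have "(\<Sum>i\<in>UNIV. q $ i - p $ i) = (\<Sum>k\<in>UNIV. r' k)"
      by (simp add: sum_prod_bool p_def q_def add.commute)
    also have "exp (- l * (\<Sum>k\<in>UNIV. r' k)) = (\<Prod>k\<in>UNIV. exp (- l * r' k))"
      by (simp only: sum_distrib_left exp_sum finite)
    also have "\<dots> = (\<Prod>k\<in>UNIV. margin_tail l (max_margin x k) (r k))"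
      using le by (intro prod.cong refl) (auto simp: margin_tail_def r'_def)
    finally show ?thesis .
  qed
qed

text \<open>The threshold 0 in all other directions is met almost surely and contributes the factor
  1.\<close>

lemma prob_margin_ge:
  fixes x :: "real ^ 'd::finite"
  assumes l: "l > 0" and x: "x \<in> box 0 1"
  shows "measure mondrian_law {h. r \<le> margin l x k h} = margin_tail l (max_margin x k) r"
proof -
  interpret P: prob_space "mondrian_law :: 'd history measure" by (rule prob_space_mondrian_law)
  define s where "s k' = (if k' = k then r else 0)" for k'
  have "measure mondrian_law {h. r \<le> margin l x k h} = measure mondrian_law {h. \<forall>k'. s k' \<le> margin l x k' h}"
  proof (rule P.finite_measure_eq_AE)
    show "AE h in mondrian_law. h \<in> {h. r \<le> margin l x k h} \<longleftrightarrow> h \<in> {h. \<forall>k'. s k' \<le> margin l x k' h}"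
      using AE_margin[OF l x]
    proof eventually_elim
      case (elim h)
      then have "s k' \<le> margin l x k' h \<longleftrightarrow> (k' = k \<longrightarrow> r \<le> margin l x k h)" for k'
        using less_imp_le by (auto simp: s_def simp del: split_paired_All)
      then show ?case by blast
    qed
    have "{h \<in> space mondrian_law. \<forall>k'. s k' \<le> margin l x k' h} \<in> sets mondrian_law"
      "{h \<in> space mondrian_law. r \<le> margin l x k h} \<in> sets mondrian_law" by measurable
    then show "{h. r \<le> margin l x k h} \<in> sets mondrian_law" "{h. \<forall>k'. s k' \<le> margin l x k' h} \<in> sets mondrian_law"
      by simp_all
  qed
  also have "\<dots> = (\<Prod>k'\<in>UNIV. margin_tail l (max_margin x k') (s k'))"
    by (rule prob_margins_ge[OF l x])
  also have "\<dots> = (\<Prod>k'\<in>UNIV. if k' = k then margin_tail l (max_margin x k) r else 1)"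
    by (intro prod.cong refl) (auto simp: s_def margin_tail_def)
  also have "\<dots> = margin_tail l (max_margin x k) r"
    by (simp add: prod.delta)
  finally show ?thesis .
qed

text \<open>The half-lines \<open>{r..}\<close> generate the Borel sets and are closed under
  intersection, so the factorised joint tail suffices. \<open>UNIV\<close> must belong to the
  generator as well; for it the threshold 0 serves, since margins are almost surely
  positive.\<close>

lemma indep_margins:
  fixes x :: "real ^ 'd::finite"
  assumes l: "l > 0" and x: "x \<in> box 0 1"
  shows "prob_space.indep_vars mondrian_law (\<lambda>_. borel) (margin l x) UNIV"
proof -
  interpret P: prob_space "mondrian_law :: 'd history measure" by (rule prob_space_mondrian_law)
  define E where "E = insert UNIV (range (atLeast :: real \<Rightarrow> real set))"
  have sb: "sets (borel :: real measure) = sigma_sets UNIV E"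
  proof -
    have "sets (borel :: real measure) = sigma_sets UNIV (range atLeast)"
      by (subst borel_Ici) simp
    moreover have "sigma_sets UNIV E = sigma_sets UNIV (range (atLeast :: real \<Rightarrow> real set))"
      unfolding E_def
      by (intro sigma_sets_eqI) (auto intro: sigma_sets_top sigma_sets.Basic)
    ultimately show ?thesis by simp
  qed
  have stable: "Int_stable E"
  proof -
    have "{a..} \<inter> {b..} = {max a b..}" for a b :: real by auto
    then show ?thesis unfolding E_def Int_stable_def by auto
  qed
  show ?thesis
  proof (subst P.indep_vars_finite[where E = "\<lambda>_. E"])
    show "\<forall>A\<in>UNIV \<rightarrow> E. P.prob (\<Inter>j\<in>UNIV. margin l x j -` A j \<inter> space mondrian_law) =
        (\<Prod>j\<in>UNIV. P.prob (margin l x j -` A j \<inter> space mondrian_law))"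
    proof
      fix A :: "'d \<times> bool \<Rightarrow> real set" assume "A \<in> UNIV \<rightarrow> E"
      then have A: "A k = UNIV \<or> (\<exists>r. A k = {r..})" for k
        unfolding E_def by blast
      define r where "r k = (if A k = UNIV then 0 else SOME r. A k = {r..})" for k
      have r: "A k = UNIV \<and> r k = 0 \<or> A k = {r k..}" for k
        using A[of k] someI_ex[of "\<lambda>r. A k = {r..}"] by (auto simp: r_def)
      have mem: "h \<in> margin l x k -` A k \<longleftrightarrow> r k \<le> margin l x k h" if "0 < margin l x k h" for h k
        using r[of k] that by auto
      have Aset [measurable]: "A k \<in> sets borel" for k
        using A[of k] by auto
      have "{h \<in> space mondrian_law. \<forall>k. margin l x k h \<in> A k} \<in> sets mondrian_law"
        "{h \<in> space mondrian_law. \<forall>k. r k \<le> margin l x k h} \<in> sets mondrian_law" by measurable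
      then have s1: "{h. \<forall>k. margin l x k h \<in> A k} \<in> sets mondrian_law" "{h. \<forall>k. r k \<le> margin l x k h} \<in> sets mondrian_law"
        by simp_all
      have "{h \<in> space mondrian_law. margin l x k h \<in> A k} \<in> sets mondrian_law"
        "{h \<in> space mondrian_law. r k \<le> margin l x k h} \<in> sets mondrian_law" for k by measurable
      then have s2: "{h. margin l x k h \<in> A k} \<in> sets mondrian_law" "{h. r k \<le> margin l x k h} \<in> sets mondrian_law" for k
        by simp_all
      have "(\<Inter>j\<in>UNIV. margin l x j -` A j \<inter> space mondrian_law) = {h. \<forall>k. margin l x k h \<in> A k}"
        by auto
      then have "P.prob (\<Inter>j\<in>UNIV. margin l x j -` A j \<inter> space mondrian_law) =
          P.prob {h. \<forall>k. margin l x k h \<in> A k}" by simp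
      also have "\<dots> = P.prob {h. \<forall>k. r k \<le> margin l x k h}"
      proof (rule P.finite_measure_eq_AE[OF _ s1])
        show "AE h in mondrian_law. h \<in> {h. \<forall>k. margin l x k h \<in> A k} \<longleftrightarrow> h \<in> {h. \<forall>k. r k \<le> margin l x k h}"
          using AE_margin[OF l x] by eventually_elim (use mem in \<open>simp add: vimage_def del: split_paired_All\<close>)
      qed
      also have "\<dots> = (\<Prod>k\<in>UNIV. margin_tail l (max_margin x k) (r k))"
        by (rule prob_margins_ge[OF l x])
      also have "\<dots> = (\<Prod>k\<in>UNIV. P.prob (margin l x k -` A k \<inter> space mondrian_law))"
      proof (rule prod.cong[OF refl])
        fix k
        have "margin l x k -` A k \<inter> space mondrian_law = {h. margin l x k h \<in> A k}" by auto
        then have "P.prob (margin l x k -` A k \<inter> space mondrian_law) = P.prob {h. r k \<le> margin l x k h}"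
        proof (simp only:, intro P.finite_measure_eq_AE[OF _ s2])
          show "AE h in mondrian_law. h \<in> {h. margin l x k h \<in> A k} \<longleftrightarrow> h \<in> {h. r k \<le> margin l x k h}"
            using AE_margin[OF l x] by eventually_elim (use mem in \<open>simp add: vimage_def del: split_paired_All\<close>)
        qed
        then show "margin_tail l (max_margin x k) (r k) = P.prob (margin l x k -` A k \<inter> space mondrian_law)"
          by (simp add: prob_margin_ge[OF l x])
      qed
      finally show "P.prob (\<Inter>j\<in>UNIV. margin l x j -` A j \<inter> space mondrian_law) =
        (\<Prod>j\<in>UNIV. P.prob (margin l x j -` A j \<inter> space mondrian_law))" .
    qed
    show "sets borel = sigma_sets (space borel) E" using sb by simp
    show "space borel \<in> E" by (simp add: E_def)
  qed (use stable in auto)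
qed

section \<open>Moments of the margins\<close>

lemma nn_integral_inverse_sqrt_tail:
  assumes "c > 0"
  shows "(\<integral>\<^sup>+t. ennreal (t powr (- 3 / 2) / 2) * indicator {c..} t \<partial>lborel) = ennreal (c powr (- 1 / 2))"
proof -
  have "((\<lambda>t::real. t powr (- 3 / 2)) has_integral - (c powr (- 3 / 2 + 1)) / (- 3 / 2 + 1)) {c..}"
    using assms by (intro has_integral_powr_to_inf) auto
  from has_integral_mult_right[OF this, of "1 / 2"]
  have "((\<lambda>t::real. t powr (- 3 / 2) / 2) has_integral (c powr (- 1 / 2))) {c..}"
    by simp
  from nn_integral_has_integral_lebesgue'[OF _ this]
  show ?thesis by simp
qed

lemma nn_integral_inverse_sqrt_head:
  assumes "c \<ge> 0"
  shows "(\<integral>\<^sup>+t. ennreal (t powr (- 1 / 2)) * indicator {0..c} t \<partial>lborel) = ennreal (2 * c powr (1 / 2))"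
proof -
  have "((\<lambda>t. t powr (- 1 / 2)) has_integral (c powr (- 1 / 2 + 1) / (- 1 / 2 + 1))) {0..c}"
    using assms by (intro has_integral_powr_from_0) auto
  from nn_integral_has_integral_lebesgue'[OF _ this]
  show ?thesis by simp
qed

text \<open>Layer-cake formula by Fubini. It serves increasing functions of a margin, with
  \<open>Q\<close> saying that \<open>t\<close> is at most the margin, and decreasing ones, with
  \<open>Q\<close> saying that the margin is below \<open>t\<close>.\<close>

lemma (in sigma_finite_measure) nn_integral_layers:
  assumes [measurable]: "\<phi> \<in> borel_measurable borel" "Measurable.pred (M \<Otimes>\<^sub>M borel) (\<lambda>z. Q (fst z) (snd z))"
  shows "(\<integral>\<^sup>+h. (\<integral>\<^sup>+t. \<phi> t * indicator {t. Q h t} t \<partial>lborel) \<partial>M) =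
    (\<integral>\<^sup>+(t::real). \<phi> t * emeasure M {h \<in> space M. Q h t} \<partial>lborel)"
proof -
  interpret P: pair_sigma_finite M "lborel :: real measure" by standard
  have [measurable]: "Measurable.pred (M \<Otimes>\<^sub>M lborel) (\<lambda>z. Q (fst z) (snd z))"
    using assms(2) by (simp cong: measurable_cong_sets)
  have "(\<integral>\<^sup>+h. (\<integral>\<^sup>+t. \<phi> t * indicator {t. Q h t} t \<partial>lborel) \<partial>M) =
      (\<integral>\<^sup>+h. (\<integral>\<^sup>+t. (\<lambda>(h, t). \<phi> t * of_bool (Q h t)) (h, t) \<partial>lborel) \<partial>M)"
    by (simp add: indicator_def)
  also have "\<dots> = (\<integral>\<^sup>+t. (\<integral>\<^sup>+h. (\<lambda>(h, t). \<phi> t * of_bool (Q h t)) (h, t) \<partial>M) \<partial>lborel)"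
    by (rule P.Fubini'[symmetric]) (simp add: case_prod_beta of_bool_def)
  also have "\<dots> = (\<integral>\<^sup>+t. \<phi> t * emeasure M {h \<in> space M. Q h t} \<partial>lborel)"
  proof (rule nn_integral_cong)
    fix t :: real
    have "Measurable.pred M (\<lambda>h. (\<lambda>z. Q (fst z) (snd z)) (h, t))"
      by (rule measurable_compose[OF measurable_Pair2' assms(2)]) simp
    then have [measurable]: "Measurable.pred M (\<lambda>h. Q h t)" by simp
    have "(\<integral>\<^sup>+h. \<phi> t * of_bool (Q h t) \<partial>M) = \<phi> t * (\<integral>\<^sup>+h. of_bool (Q h t) \<partial>M)"
      by (rule nn_integral_cmult) (simp add: of_bool_def)
    also have "(\<integral>\<^sup>+h. of_bool (Q h t) \<partial>M) = (\<integral>\<^sup>+h. indicator {h \<in> space M. Q h t} h \<partial>M)"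
      by (intro nn_integral_cong) (simp add: indicator_def)
    also have "\<dots> = emeasure M {h \<in> space M. Q h t}" by simp
    finally show "(\<integral>\<^sup>+h. (\<lambda>(h, t). \<phi> t * of_bool (Q h t)) (h, t) \<partial>M) = \<phi> t * emeasure M {h \<in> space M. Q h t}"
      by simp
  qed
  finally show ?thesis .
qed

text \<open>The exact value is kept and not just the bound \<open>1 / l\<close>: in the offset of
  the centre the leading terms of opposite margins have to cancel.\<close>

lemma nn_integral_margin:
  fixes x :: "real ^ 'd::finite"
  assumes l: "l > 0" and x: "x \<in> box 0 1"
  shows "(\<integral>\<^sup>+h. ennreal (margin l x k h) \<partial>mondrian_law) = ennreal ((1 - exp (- l * max_margin x k)) / l)"
proof -
  interpret P: prob_space "mondrian_law :: 'd history measure" by (rule prob_space_mondrian_law)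
  let ?c = "max_margin x k"
  have c: "0 < ?c" by (rule max_margin_pos[OF x])
  have "(\<integral>\<^sup>+h. ennreal (margin l x k h) \<partial>mondrian_law) =
      (\<integral>\<^sup>+h. (\<integral>\<^sup>+t. indicator {0..} t * indicator {t. t \<le> margin l x k h} t \<partial>lborel) \<partial>mondrian_law)"
    using AE_margin[OF l x]
  proof (intro nn_integral_cong_AE, eventually_elim)
    case (elim h)
    have "(\<integral>\<^sup>+t. indicator {0..} t * indicator {t. t \<le> margin l x k h} t \<partial>lborel) =
        (\<integral>\<^sup>+t. indicator {0..margin l x k h} t \<partial>(lborel :: real measure))"
      by (intro nn_integral_cong) (auto simp: indicator_def)
    then show ?case using spec[OF elim(2), of k] by simp
  qed
  also have "\<dots> = (\<integral>\<^sup>+t. indicator {0..} t * emeasure mondrian_law {h \<in> space mondrian_law. t \<le> margin l x k h} \<partial>lborel)"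
    by (rule P.nn_integral_layers) measurable
  also have "\<dots> = (\<integral>\<^sup>+t. ennreal (exp (- l * t)) * indicator {0..?c} t \<partial>lborel)"
    using c by (intro nn_integral_cong) (auto simp: P.emeasure_eq_measure prob_margin_ge[OF l x] margin_tail_def indicator_def)
  also have "\<dots> = ennreal (- exp (- l * ?c) / l - (- exp (- l * 0) / l))"
    by (rule nn_integral_FTC_Icc) (use l c in \<open>auto intro!: derivative_eq_intros\<close>)
  also have "- exp (- l * ?c) / l - (- exp (- l * 0) / l) = (1 - exp (- l * ?c)) / l"
    by (simp add: diff_divide_distrib)
  finally show ?thesis .
qed

lemma nn_integral_margin_square:
  fixes x :: "real ^ 'd::finite"
  assumes l: "l > 0" and x: "x \<in> box 0 1"
  shows "(\<integral>\<^sup>+h. ennreal ((margin l x k h)\<^sup>2) \<partial>mondrian_law) \<le> ennreal (2 / l\<^sup>2)"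
proof -
  interpret P: prob_space "mondrian_law :: 'd history measure" by (rule prob_space_mondrian_law)
  have "(\<integral>\<^sup>+h. ennreal ((margin l x k h)\<^sup>2) \<partial>mondrian_law) =
      (\<integral>\<^sup>+h. (\<integral>\<^sup>+t. ennreal (2 * t) * indicator {t. t \<le> margin l x k h} t \<partial>lborel) \<partial>mondrian_law)"
    using AE_margin[OF l x]
  proof (intro nn_integral_cong_AE, eventually_elim)
    case (elim h)
    have "(\<integral>\<^sup>+t. ennreal (2 * t) * indicator {t. t \<le> margin l x k h} t \<partial>lborel) =
        (\<integral>\<^sup>+t. ennreal (2 * t) * indicator {0..margin l x k h} t \<partial>lborel)"
      by (intro nn_integral_cong) (auto simp: indicator_def ennreal_neg)
    also have "\<dots> = ennreal ((margin l x k h)\<^sup>2 - 0\<^sup>2)"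
      by (rule nn_integral_FTC_Icc) (use spec[OF elim(2), of k] in \<open>auto intro!: derivative_eq_intros\<close>)
    finally show ?case by simp
  qed
  also have "\<dots> = (\<integral>\<^sup>+t. ennreal (2 * t) * emeasure mondrian_law {h \<in> space mondrian_law. t \<le> margin l x k h} \<partial>lborel)"
    by (rule P.nn_integral_layers) measurable
  \<comment> \<open>Without the truncation the integrand is \<open>2 * t * exp (- l * t)\<close>,
    which is \<open>2 / l\<^sup>2\<close> times \<open>erlang_density 1 l\<close>, the density of a
    sum of two exponential variables.\<close>
  also have "\<dots> \<le> (\<integral>\<^sup>+t. ennreal (2 / l\<^sup>2) * ennreal (erlang_density 1 l t) \<partial>lborel)"
  proof (rule nn_integral_mono)
    fix t :: real
    show "ennreal (2 * t) * emeasure mondrian_law {h \<in> space mondrian_law. t \<le> margin l x k h}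
       \<le> ennreal (2 / l\<^sup>2) * ennreal (erlang_density 1 l t)"
    proof (cases "t > 0")
      case True
      have "2 * t * margin_tail l (max_margin x k) t \<le> 2 / l\<^sup>2 * erlang_density 1 l t"
        using True l by (auto simp: margin_tail_def erlang_density_def power2_eq_square mult.commute)
      then have "ennreal (2 * t * margin_tail l (max_margin x k) t) \<le> ennreal (2 / l\<^sup>2 * erlang_density 1 l t)"
        by (rule ennreal_leI)
      moreover have "ennreal (2 / l\<^sup>2 * erlang_density 1 l t) = ennreal (2 / l\<^sup>2) * ennreal (erlang_density 1 l t)"
        using l by (intro ennreal_mult) (auto intro!: erlang_density_nonneg)
      moreover have "ennreal (2 * t * margin_tail l (max_margin x k) t) =
          ennreal (2 * t) * ennreal (margin_tail l (max_margin x k) t)"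
        using True by (intro ennreal_mult) (auto simp: margin_tail_def)
      ultimately show ?thesis
        by (simp add: P.emeasure_eq_measure prob_margin_ge[OF l x])
    qed (simp add: ennreal_neg)
  qed
  also have "\<dots> = ennreal (2 / l\<^sup>2)"
    using prob_space.emeasure_space_1[OF prob_space_erlang_density[OF l, of 1]]
    by (simp add: nn_integral_cmult emeasure_density)
  finally show ?thesis .
qed

text \<open>An exponential variable has positive density at 0, so its inverse is not integrable, but
  its power -1/2 is. The margin is below \<open>t\<close> with probability at most
  \<open>l * t\<close> as long as \<open>t\<close> is below both \<open>1 / l\<close> and the
  distance to the face of the cube, and at most 1 otherwise. The range up to \<open>1 / l\<close>
  and the tail beyond it give \<open>l powr (1 / 2)\<close> each, the tail beyond the face the last
  term.\<close>

lemma nn_integral_margin_inverse_sqrt: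
  fixes x :: "real ^ 'd::finite"
  assumes l: "l > 0" and x: "x \<in> box 0 1"
  shows "(\<integral>\<^sup>+h. ennreal (margin l x k h powr (- 1 / 2)) \<partial>mondrian_law) \<le>
    ennreal (2 * l powr (1 / 2) + max_margin x k powr (- 1 / 2))"
proof -
  interpret P: prob_space "mondrian_law :: 'd history measure" by (rule prob_space_mondrian_law)
  let ?c = "max_margin x k"
  define \<phi> where "\<phi> t = ennreal (t powr (- 3 / 2) / 2) * indicator {0<..} t" for t :: real
  have [measurable]: "\<phi> \<in> borel_measurable borel" unfolding \<phi>_def by measurable
  have c: "0 < ?c" by (rule max_margin_pos[OF x])
  have "(\<integral>\<^sup>+h. ennreal (margin l x k h powr (- 1 / 2)) \<partial>mondrian_law) =
      (\<integral>\<^sup>+h. (\<integral>\<^sup>+t. \<phi> t * indicator {t. margin l x k h < t} t \<partial>lborel) \<partial>mondrian_law)"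
    using AE_margin[OF l x]
  proof (intro nn_integral_cong_AE, eventually_elim)
    case (elim h)
    then have m: "0 < margin l x k h" by blast
    have "(\<integral>\<^sup>+t. \<phi> t * indicator {t. margin l x k h < t} t \<partial>lborel) =
        (\<integral>\<^sup>+t. ennreal (t powr (- 3 / 2) / 2) * indicator {margin l x k h..} t \<partial>lborel)"
      using AE_lborel_singleton[of "margin l x k h"]
      by (intro nn_integral_cong_AE, eventually_elim) (use m in \<open>auto simp: \<phi>_def indicator_def\<close>)
    then show ?case using nn_integral_inverse_sqrt_tail[OF m] by simp
  qed
  also have "\<dots> = (\<integral>\<^sup>+t. \<phi> t * emeasure mondrian_law {h \<in> space mondrian_law. margin l x k h < t} \<partial>lborel)"
    by (rule P.nn_integral_layers) measurable
  also have "\<dots> \<le> (\<integral>\<^sup>+t. ennreal (l / 2) * (ennreal (t powr (- 1 / 2)) * indicator {0..1/l} t) +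
      (ennreal (t powr (- 3 / 2) / 2) * indicator {1/l..} t + ennreal (t powr (- 3 / 2) / 2) * indicator {?c..} t) \<partial>lborel)"
  proof (rule nn_integral_mono)
    fix t :: real
    have "{h \<in> space mondrian_law. margin l x k h < t} = space mondrian_law - {h. t \<le> margin l x k h}" by auto
    moreover have "{h \<in> space mondrian_law. t \<le> margin l x k h} \<in> sets mondrian_law" by measurable
    ultimately have prob: "emeasure mondrian_law {h \<in> space mondrian_law. margin l x k h < t} =
        ennreal (1 - margin_tail l ?c t)"
      using P.prob_compl[of "{h. t \<le> margin l x k h}"]
      by (simp add: P.emeasure_eq_measure prob_margin_ge[OF l x])
    show "\<phi> t * emeasure mondrian_law {h \<in> space mondrian_law. margin l x k h < t} \<le>
      ennreal (l / 2) * (ennreal (t powr (- 1 / 2)) * indicator {0..1/l} t) +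
      (ennreal (t powr (- 3 / 2) / 2) * indicator {1/l..} t + ennreal (t powr (- 3 / 2) / 2) * indicator {?c..} t)"
    proof (cases "t > 0")
      case True
      show ?thesis
      proof (cases "t \<le> ?c \<and> t \<le> 1 / l")
        case le: True
        have "1 - margin_tail l ?c t \<le> l * t"
          using True le exp_ge_add_one_self[of "- l * t"] by (simp add: margin_tail_def)
        then have "t powr (- 3 / 2) / 2 * (1 - margin_tail l ?c t) \<le> t powr (- 3 / 2) / 2 * (l * t)"
          using True by (intro mult_left_mono) auto
        also have "\<dots> = l / 2 * t powr (- 1 / 2)"
        proof -
          have "t powr (- 3 / 2) * t = t powr (- 3 / 2 + 1)"
            using True by (subst powr_add) simp
          then show ?thesis by (simp add: field_simps)
        qed
        finally have "ennreal (t powr (- 3 / 2) / 2 * (1 - margin_tail l ?c t)) \<le> ennreal (l / 2 * t powr (- 1 / 2))"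
          by (rule ennreal_leI)
        then have "ennreal (t powr (- 3 / 2) / 2) * ennreal (1 - margin_tail l ?c t) \<le> ennreal (l / 2) * ennreal (t powr (- 1 / 2))"
          using l by (subst (asm) (1 2) ennreal_mult') auto
        then show ?thesis
          unfolding prob \<phi>_def using True le by (simp add: add_increasing2)
      next
        case False
        have "ennreal (1 - margin_tail l ?c t) \<le> 1"
          by (intro ennreal_le_1[THEN iffD2]) (simp add: margin_tail_def)
        then have "ennreal (t powr (- 3 / 2) / 2) * ennreal (1 - margin_tail l ?c t) \<le> ennreal (t powr (- 3 / 2) / 2) * 1"
          by (rule mult_left_mono) simp
        also have "\<dots> \<le> ennreal (t powr (- 3 / 2) / 2) * indicator {1/l..} t + ennreal (t powr (- 3 / 2) / 2) * indicator {?c..} t"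
          using False by (auto simp: indicator_def)
        finally show ?thesis
          unfolding prob \<phi>_def using True by (simp add: add_increasing)
      qed
    qed (simp add: \<phi>_def)
  qed
  also have "\<dots> = ennreal (l / 2) * ennreal (2 * (1 / l) powr (1 / 2)) +
      (ennreal ((1 / l) powr (- 1 / 2)) + ennreal (?c powr (- 1 / 2)))"
    using l c nn_integral_inverse_sqrt_head[of "1 / l"] nn_integral_inverse_sqrt_tail[of "1 / l"]
       nn_integral_inverse_sqrt_tail[of ?c]
    by (simp add: nn_integral_add nn_integral_cmult)
  also have "ennreal (l / 2) * ennreal (2 * (1 / l) powr (1 / 2)) = ennreal (l / 2 * (2 * (1 / l) powr (1 / 2)))"
    using l by (intro ennreal_mult[symmetric]) auto
  also have "\<dots> + (ennreal ((1 / l) powr (- 1 / 2)) + ennreal (?c powr (- 1 / 2))) =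
      ennreal (l / 2 * (2 * (1 / l) powr (1 / 2)) + ((1 / l) powr (- 1 / 2) + ?c powr (- 1 / 2)))"
    using l by simp
  also have "l / 2 * (2 * (1 / l) powr (1 / 2)) + ((1 / l) powr (- 1 / 2) + ?c powr (- 1 / 2)) =
      2 * l powr (1 / 2) + ?c powr (- 1 / 2)"
  proof -
    have "(1 / l) powr a = l powr (- a)" for a
      using l by (simp only: powr_divide powr_minus_divide powr_one_eq_one less_imp_le zero_le_one)
    from this[of "1 / 2"] this[of "- 1 / 2"]
    have "(1 / l) powr (1 / 2) = l powr (- 1 / 2)" "(1 / l) powr (- 1 / 2) = l powr (1 / 2)"
      by simp_all
    moreover have "l * l powr (- 1 / 2) = l powr (1 + - 1 / 2)"
      using l by (subst powr_add) simp
    ultimately show ?thesis by simp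
  qed
  finally show ?thesis .
qed

text \<open>There are twice as many factors as coordinates, each of order
  \<open>l powr (1 / 2)\<close>. The constant has to serve all \<open>l \<ge> l0\<close> at once, so
  the term of each cube face is absorbed by means of
  \<open>1 \<le> l powr (1 / 2) / l0 powr (1 / 2)\<close>.\<close>

lemma nn_integral_inverse_volume:
  fixes x :: "real ^ 'd::finite"
  assumes x: "x \<in> box 0 1" and l0: "l0 > 0"
  shows "\<exists>K\<ge>0. \<forall>l\<ge>l0. (\<integral>\<^sup>+h. ennreal (1 / (\<Prod>i\<in>UNIV. final_upper l x h $ i - final_lower l x h $ i)) \<partial>mondrian_law)
     \<le> ennreal (K * l ^ CARD('d))"
proof -
  define K where "K = (\<Prod>k\<in>(UNIV :: ('d \<times> bool) set). 2 + max_margin x k powr (- 1 / 2) / l0 powr (1 / 2))"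
  have "K \<ge> 0" unfolding K_def by (intro prod_nonneg) simp
  moreover have "(\<integral>\<^sup>+h. ennreal (1 / (\<Prod>i\<in>UNIV. final_upper l x h $ i - final_lower l x h $ i)) \<partial>mondrian_law)
     \<le> ennreal (K * l ^ CARD('d))" if "l \<ge> l0" for l
  proof -
    have l: "l > 0" using that l0 by simp
    interpret P: prob_space "mondrian_law :: 'd history measure" by (rule prob_space_mondrian_law)
    have "(\<integral>\<^sup>+h. ennreal (1 / (\<Prod>i\<in>UNIV. final_upper l x h $ i - final_lower l x h $ i)) \<partial>mondrian_law) \<le>
        (\<integral>\<^sup>+h. (\<Prod>k\<in>UNIV. ennreal (margin l x k h powr (- 1 / 2))) \<partial>mondrian_law)"
      using AE_margin[OF l x]
    proof (intro nn_integral_mono_AE, eventually_elim)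
      case (elim h)
      have m: "0 < margin l x k h" for k using elim(2) by blast
      have side: "final_upper l x h $ i - final_lower l x h $ i = margin l x (i, True) h + margin l x (i, False) h" for i
        by (simp add: margin_def)
      \<comment> \<open>The two margins of a coordinate are decoupled, so that independence applies.\<close>
      have le: "1 / (a + b) \<le> a powr (- 1 / 2) * b powr (- 1 / 2)" if "0 < a" "0 < b" for a b :: real
      proof -
        have "sqrt (a * b) \<le> a + b"
          using arith_geo_mean_sqrt[of a b] that by simp
        then have "1 / (a + b) \<le> 1 / sqrt (a * b)"
          using that by (intro divide_left_mono) auto
        also have "\<dots> = a powr (- 1 / 2) * b powr (- 1 / 2)"
          using that by (simp add: powr_minus_divide powr_half_sqrt real_sqrt_mult)
        finally show ?thesis .
      qed
      have "1 / (\<Prod>i\<in>UNIV. final_upper l x h $ i - final_lower l x h $ i) =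
          (\<Prod>i\<in>UNIV. 1 / (margin l x (i, True) h + margin l x (i, False) h))"
        by (simp add: side prod_dividef)
      also have "\<dots> \<le> (\<Prod>i\<in>UNIV. margin l x (i, True) h powr (- 1 / 2) * margin l x (i, False) h powr (- 1 / 2))"
        using m le by (intro prod_mono) (auto simp: less_imp_le add_nonneg_nonneg)
      also have "\<dots> = (\<Prod>i\<in>UNIV. \<Prod>b\<in>UNIV. margin l x (i, b) h powr (- 1 / 2))"
        by (simp add: UNIV_bool mult.commute)
      also have "\<dots> = (\<Prod>k\<in>UNIV. margin l x k h powr (- 1 / 2))"
        by (simp add: prod.cartesian_product)
      finally have "ennreal (1 / (\<Prod>i\<in>UNIV. final_upper l x h $ i - final_lower l x h $ i)) \<le>
          ennreal (\<Prod>k\<in>UNIV. margin l x k h powr (- 1 / 2))"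
        by (rule ennreal_leI)
      then show ?case by (simp add: prod_ennreal)
    qed
    also have "\<dots> = (\<Prod>k\<in>UNIV. \<integral>\<^sup>+h. ennreal (margin l x k h powr (- 1 / 2)) \<partial>mondrian_law)"
      by (intro P.indep_vars_nn_integral P.indep_vars_compose2[OF indep_margins[OF l x]]) auto
    also have "\<dots> \<le> (\<Prod>k\<in>UNIV. ennreal (2 * l powr (1 / 2) + max_margin x k powr (- 1 / 2)))"
      by (intro prod_mono_ennreal nn_integral_margin_inverse_sqrt[OF l x])
    also have "\<dots> \<le> (\<Prod>k\<in>(UNIV :: ('d \<times> bool) set). ennreal (l powr (1 / 2) * (2 + max_margin x k powr (- 1 / 2) / l0 powr (1 / 2))))"
    proof (intro prod_mono_ennreal ennreal_leI)
      fix k :: "'d \<times> bool"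
      have "1 \<le> l powr (1 / 2) / l0 powr (1 / 2)"
        using that l0 by (simp add: powr_mono2)
      then have "max_margin x k powr (- 1 / 2) * 1 \<le> max_margin x k powr (- 1 / 2) * (l powr (1 / 2) / l0 powr (1 / 2))"
        by (intro mult_left_mono) auto
      then show "2 * l powr (1 / 2) + max_margin x k powr (- 1 / 2) \<le>
          l powr (1 / 2) * (2 + max_margin x k powr (- 1 / 2) / l0 powr (1 / 2))"
        by (simp add: algebra_simps)
    qed
    also have "\<dots> = ennreal (\<Prod>k\<in>(UNIV :: ('d \<times> bool) set). l powr (1 / 2) * (2 + max_margin x k powr (- 1 / 2) / l0 powr (1 / 2)))"
      by (intro prod_ennreal) simp
    also have "(\<Prod>k\<in>(UNIV :: ('d \<times> bool) set). l powr (1 / 2) * (2 + max_margin x k powr (- 1 / 2) / l0 powr (1 / 2))) =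
        (l powr (1 / 2)) ^ CARD('d \<times> bool) * K"
      by (simp add: prod.distrib K_def)
    also have "(l powr (1 / 2)) ^ CARD('d \<times> bool) = l ^ CARD('d)"
    proof -
      have "(l powr (1 / 2)) ^ CARD('d \<times> bool) = ((l powr (1 / 2)) ^ 2) ^ CARD('d)"
        by (simp add: power_mult[symmetric] mult.commute)
      also have "(l powr (1 / 2)) ^ 2 = l"
        using l by (simp add: powr_half_sqrt)
      finally show ?thesis .
    qed
    finally show ?thesis by (simp add: mult.commute)
  qed
  ultimately show ?thesis by blast
qed

text \<open>The 8 d is the number 2 d of margins, times 2 for the square of a sum of two, times the
  2 from the second moment of an exponential variable.\<close>

lemma nn_integral_square_diameter:
  fixes x :: "real ^ 'd::finite"
  assumes l: "l > 0" and x: "x \<in> box 0 1"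
  shows "(\<integral>\<^sup>+h. ennreal ((norm (final_upper l x h - final_lower l x h))\<^sup>2) \<partial>mondrian_law) \<le>
    ennreal (8 * real CARD('d) / l\<^sup>2)"
proof -
  have "(norm (final_upper l x h - final_lower l x h))\<^sup>2 \<le> (\<Sum>k\<in>UNIV. 2 * (margin l x k h)\<^sup>2)" for h
  proof -
    have "(norm (final_upper l x h - final_lower l x h))\<^sup>2 =
        (\<Sum>i\<in>UNIV. (margin l x (i, True) h + margin l x (i, False) h)\<^sup>2)"
      by (simp add: norm_vec_def L2_set_def sum_nonneg margin_def)
    also have "\<dots> \<le> (\<Sum>i\<in>UNIV. 2 * (margin l x (i, True) h)\<^sup>2 + 2 * (margin l x (i, False) h)\<^sup>2)"
    proof (rule sum_mono)
      fix i
      show "(margin l x (i, True) h + margin l x (i, False) h)\<^sup>2 \<le> 2 * (margin l x (i, True) h)\<^sup>2 + 2 * (margin l x (i, False) h)\<^sup>2"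
        using sum_squares_bound[of "margin l x (i, True) h" "margin l x (i, False) h"] by (simp add: power2_sum)
    qed
    finally show ?thesis by (simp add: sum_prod_bool)
  qed
  then have "(\<integral>\<^sup>+h. ennreal ((norm (final_upper l x h - final_lower l x h))\<^sup>2) \<partial>mondrian_law) \<le>
     (\<integral>\<^sup>+h. ennreal (\<Sum>k\<in>UNIV. 2 * (margin l x k h)\<^sup>2) \<partial>mondrian_law)"
    by (intro nn_integral_mono ennreal_leI)
  also have "\<dots> = (\<integral>\<^sup>+h. (\<Sum>k\<in>UNIV. ennreal 2 * ennreal ((margin l x k h)\<^sup>2)) \<partial>mondrian_law)"
    by (simp add: sum_ennreal[symmetric] ennreal_mult del: sum_ennreal)
  also have "\<dots> = (\<Sum>k\<in>UNIV. ennreal 2 * (\<integral>\<^sup>+h. ennreal ((margin l x k h)\<^sup>2) \<partial>mondrian_law))"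
    by (simp add: nn_integral_sum nn_integral_cmult)
  also have "\<dots> \<le> (\<Sum>k\<in>(UNIV :: ('d \<times> bool) set). ennreal 2 * ennreal (2 / l\<^sup>2))"
    by (intro sum_mono mult_left_mono nn_integral_margin_square[OF l x]) simp
  also have "\<dots> = (\<Sum>k\<in>(UNIV :: ('d \<times> bool) set). ennreal (4 / l\<^sup>2))"
    by (subst ennreal_mult[symmetric]) auto
  also have "\<dots> = ennreal (\<Sum>k\<in>(UNIV :: ('d \<times> bool) set). 4 / l\<^sup>2)"
    by (intro sum_ennreal) simp
  finally show ?thesis by simp
qed

text \<open>The centre minus \<open>x\<close> is half the difference of the opposite margins.
  Untruncated they would have equal means; truncation changes these by exponentially small terms,
  for which \<open>exp (- y) \<le> 1 / y\<close> already supplies the second factor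
  \<open>1 / l\<close>. Bounding the offset by the diameter would give only one such factor.\<close>

lemma center_bias:
  fixes x :: "real ^ 'd::finite"
  assumes l: "l > 0" and x: "x \<in> box 0 1"
  shows "integrable mondrian_law (\<lambda>h. final_upper l x h $ i)" "integrable mondrian_law (\<lambda>h. final_lower l x h $ i)"
    and "\<bar>(\<integral>h. (final_lower l x h $ i + final_upper l x h $ i) / 2 - x $ i \<partial>mondrian_law)\<bar> \<le>
      (1 / x $ i + 1 / (1 - x $ i)) / l\<^sup>2"
proof -
  interpret P: prob_space "mondrian_law :: 'd history measure" by (rule prob_space_mondrian_law)
  show iu: "integrable mondrian_law (\<lambda>h. final_upper l x h $ i)"
    by (rule P.integrable_const_bound[where B = 1])
       (use AE_final_cell[OF l x] in \<open>eventually_elim, auto simp: abs_le_iff dest!: spec[of _ i]\<close>, measurable)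
  show il: "integrable mondrian_law (\<lambda>h. final_lower l x h $ i)"
    by (rule P.integrable_const_bound[where B = 1])
       (use AE_final_cell[OF l x] in \<open>eventually_elim, auto simp: abs_le_iff dest!: spec[of _ i]\<close>, measurable)
  have xi: "0 < x $ i" "x $ i < 1" using x by (auto simp: mem_box_cart)
  have E: "(\<integral>h. margin l x k h \<partial>mondrian_law) = (1 - exp (- l * max_margin x k)) / l" for k
  proof -
    have "AE h in mondrian_law. 0 \<le> margin l x k h"
      using AE_margin[OF l x] by eventually_elim (auto simp: less_imp_le simp del: split_paired_All)
    then have "(\<integral>h. margin l x k h \<partial>mondrian_law) = enn2real (\<integral>\<^sup>+h. ennreal (margin l x k h) \<partial>mondrian_law)"
      by (intro integral_eq_nn_integral) measurable
    then show ?thesis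
      using max_margin_pos[OF x, of k] l by (simp add: nn_integral_margin[OF l x])
  qed
  have im: "integrable mondrian_law (margin l x (i, b))" for b
    using iu il by (cases b) (auto simp: margin_def[abs_def])
  have "(\<integral>h. (final_lower l x h $ i + final_upper l x h $ i) / 2 - x $ i \<partial>mondrian_law) =
      (\<integral>h. (margin l x (i, False) h - margin l x (i, True) h) / 2 \<partial>mondrian_law)"
    by (intro Bochner_Integration.integral_cong refl) (simp add: margin_def field_simps)
  also have "\<dots> = (exp (- l * x $ i) - exp (- l * (1 - x $ i))) / (2 * l)"
    using im by (simp add: E max_margin_def diff_divide_distrib)
  also have "\<bar>\<dots>\<bar> \<le> (exp (- l * x $ i) + exp (- l * (1 - x $ i))) / l"
  proof -
    have "\<bar>a - b\<bar> / (2 * l) \<le> (a + b) / l" if "0 \<le> a" "0 \<le> b" for a b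
      using l that by (auto simp: field_simps abs_if)
    from this[of "exp (- l * x $ i)" "exp (- l * (1 - x $ i))"] show ?thesis
      using l by (simp add: abs_divide)
  qed
  also have "\<dots> \<le> (1 / (l * x $ i) + 1 / (l * (1 - x $ i))) / l"
  proof -
    have "exp (- y) \<le> 1 / y" if "0 < y" for y :: real
    proof -
      have "y \<le> exp y" using exp_ge_add_one_self[of y] by linarith
      then show ?thesis using that by (simp add: exp_minus field_simps)
    qed
    from this[of "l * x $ i"] this[of "l * (1 - x $ i)"] show ?thesis
      using l xi by (intro divide_right_mono add_mono) auto
  qed
  also have "\<dots> = (1 / x $ i + 1 / (1 - x $ i)) / l\<^sup>2"
    using l by (simp add: power2_eq_square add_divide_distrib mult_ac)
  finally show "\<bar>(\<integral>h. (final_lower l x h $ i + final_upper l x h $ i) / 2 - x $ i \<partial>mondrian_law)\<bar> \<le>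
      (1 / x $ i + 1 / (1 - x $ i)) / l\<^sup>2" .
qed

section \<open>Averages over a fixed cell\<close>

text \<open>The mean of \<phi>(N) for N binomial with the given number of trials and success
  probability \<open>p\<close>, by conditioning on one trial. In this form it matches the removal of
  one coordinate from a product measure, and no binomial coefficients appear.\<close>

fun binomial_mean :: "nat \<Rightarrow> real \<Rightarrow> (nat \<Rightarrow> real) \<Rightarrow> real" where
  "binomial_mean 0 p \<phi> = \<phi> 0"
| "binomial_mean (Suc m) p \<phi> = p * binomial_mean m p (\<lambda>k. \<phi> (Suc k)) + (1 - p) * binomial_mean m p \<phi>"

lemma binomial_mean_add: "binomial_mean m p (\<lambda>k. \<phi> k + \<psi> k) = binomial_mean m p \<phi> + binomial_mean m p \<psi>"
  by (induction m arbitrary: \<phi> \<psi>) (simp_all add: algebra_simps)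

lemma binomial_mean_mono:
  assumes "0 \<le> p" "p \<le> 1" "\<And>k. \<phi> k \<le> \<psi> k"
  shows "binomial_mean m p \<phi> \<le> binomial_mean m p \<psi>"
  using assms(3)
proof (induction m arbitrary: \<phi> \<psi>)
  case (Suc m)
  show ?case
    using Suc.IH[OF Suc.prems] Suc.IH[of "\<lambda>k. \<phi> (Suc k)" "\<lambda>k. \<psi> (Suc k)"] Suc.prems assms(1,2)
    by (auto intro!: add_mono mult_left_mono)
qed simp

lemma binomial_mean_const: "binomial_mean m p (\<lambda>_. c) = c"
  by (induction m) (simp_all add: algebra_simps)

lemma binomial_mean_nonneg:
  "0 \<le> p \<Longrightarrow> p \<le> 1 \<Longrightarrow> (\<And>k. 0 \<le> \<phi> k) \<Longrightarrow> 0 \<le> binomial_mean m p \<phi>"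
  using binomial_mean_mono[of p "\<lambda>_. 0" \<phi> m] by (simp add: binomial_mean_const)

text \<open>Size-biasing: N is a sum of indicators with equal roles, and given that one of them is a
  success, the others form a binomial variable with one trial less.\<close>

lemma binomial_mean_times:
  "binomial_mean (Suc m) p (\<lambda>k. real k * \<phi> k) = real (Suc m) * p * binomial_mean m p (\<lambda>k. \<phi> (Suc k))"
proof (induction m arbitrary: \<phi>)
  case (Suc m)
  have "binomial_mean (Suc (Suc m)) p (\<lambda>k. real k * \<phi> k) =
     p * binomial_mean (Suc m) p (\<lambda>k. real k * \<phi> (Suc k) + \<phi> (Suc k)) +
     (1 - p) * binomial_mean (Suc m) p (\<lambda>k. real k * \<phi> k)"
    by (subst binomial_mean.simps(2)) (simp add: algebra_simps)
  also have "\<dots> = p * (real (Suc m) * p * binomial_mean m p (\<lambda>k. \<phi> (Suc (Suc k))) + binomial_mean (Suc m) p (\<lambda>k. \<phi> (Suc k))) +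
     (1 - p) * (real (Suc m) * p * binomial_mean m p (\<lambda>k. \<phi> (Suc k)))"
    unfolding binomial_mean_add Suc.IH by simp
  also have "\<dots> = real (Suc (Suc m)) * p * binomial_mean (Suc m) p (\<lambda>k. \<phi> (Suc k))"
    by (simp add: algebra_simps)
  finally show ?case .
qed simp

text \<open>Size-biasing with \<phi>(k) = 1 / k: the product \<open>real k * (1 / real k)\<close> is
  1, or 0 at \<open>k = 0\<close>.\<close>

lemma binomial_mean_inverse:
  assumes "0 < p" "p \<le> 1"
  shows "binomial_mean m p (\<lambda>k. 1 / (real k + 1)) \<le> 1 / (real (Suc m) * p)"
proof -
  have "real (Suc m) * p * binomial_mean m p (\<lambda>k. 1 / (real k + 1)) =
      binomial_mean (Suc m) p (\<lambda>k. real k * (1 / real k))"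
    unfolding binomial_mean_times by (simp add: add.commute)
  also have "\<dots> \<le> binomial_mean (Suc m) p (\<lambda>k. 1)"
    using assms by (intro binomial_mean_mono) auto
  finally have "real (Suc m) * p * binomial_mean m p (\<lambda>k. 1 / (real k + 1)) \<le> 1"
    by (simp add: binomial_mean_const)
  then show ?thesis
    using assms by (subst pos_le_divide_eq) (auto simp: mult.commute)
qed

text \<open>Size-biasing with 1 / k squared leaves the mean of 1 / k, read as 0 at
  \<open>k = 0\<close>. This is at most 2 / (k + 1), so \<open>binomial_mean_inverse\<close> gives
  the second factor, and the 2 in the bound.\<close>

lemma binomial_mean_inverse_square:
  assumes "0 < p" "p \<le> 1"
  shows "binomial_mean m p (\<lambda>k. 1 / (real k + 1)\<^sup>2) \<le> 2 / (real (Suc m) * p)\<^sup>2"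
proof -
  let ?q = "real (Suc m) * p"
  have q: "0 < ?q" using assms by simp
  have "?q * binomial_mean m p (\<lambda>k. 1 / (real k + 1)\<^sup>2) =
      binomial_mean (Suc m) p (\<lambda>k. real k * (1 / (real k)\<^sup>2))"
    unfolding binomial_mean_times by (simp add: add.commute)
  also have "\<dots> \<le> binomial_mean (Suc m) p (\<lambda>k. 1 / (real k + 1) + 1 / (real k + 1))"
  proof (rule binomial_mean_mono)
    show "real k * (1 / (real k)\<^sup>2) \<le> 1 / (real k + 1) + 1 / (real k + 1)" for k
      by (cases "k = 0") (auto simp: power2_eq_square field_simps)
  qed (use assms in auto)
  also have "\<dots> \<le> 1 / (real (Suc (Suc m)) * p) + 1 / (real (Suc (Suc m)) * p)"
    unfolding binomial_mean_add by (intro add_mono binomial_mean_inverse assms)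
  also have "\<dots> \<le> 1 / ?q + 1 / ?q"
    using assms by (intro add_mono divide_left_mono mult_right_mono mult_pos_pos) auto
  finally have "binomial_mean m p (\<lambda>k. 1 / (real k + 1)\<^sup>2) \<le> (2 / ?q) / ?q"
    using q by (subst pos_le_divide_eq) (auto simp: mult.commute)
  then show ?thesis by (simp add: power2_eq_square)
qed

section \<open>The number of observations in a cell\<close>

definition hits :: "nat set \<Rightarrow> 'z set \<Rightarrow> (nat \<Rightarrow> 'z) \<Rightarrow> nat" where
  "hits I D w = card {i \<in> I. w i \<in> D}"

lemma hits_insert:
  assumes "finite I" "i \<notin> I"
  shows "hits (insert i I) D (w(i := z)) = (if z \<in> D then Suc (hits I D w) else hits I D w)"
proof -
  have "{k \<in> insert i I. (w(i := z)) k \<in> D} = (if z \<in> D then insert i {k \<in> I. w k \<in> D} else {k \<in> I. w k \<in> D})"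
    using assms(2) by auto
  then show ?thesis using assms by (simp add: hits_def)
qed

lemma measurable_hits [measurable]:
  assumes [measurable]: "D \<in> sets P"
  shows "hits I D \<in> measurable (PiM I (\<lambda>_. P)) (count_space UNIV)"
proof -
  have "{w \<in> space (PiM I (\<lambda>_. P)). i \<in> {i \<in> I. w i \<in> D}} \<in> sets (PiM I (\<lambda>_. P))" for i
    by (cases "i \<in> I") auto
  then show ?thesis unfolding hits_def[abs_def] by (rule measurable_card)
qed

text \<open>Integrating out one coordinate splits according to whether it lies in \<open>D\<close>,
  which is the recursion of \<open>binomial_mean\<close>.\<close>

lemma nn_integral_hits:
  assumes P: "prob_space P" and I: "finite I" and D: "D \<in> sets P" and \<phi>: "\<And>k. 0 \<le> \<phi> k"
  shows "(\<integral>\<^sup>+w. ennreal (\<phi> (hits I D w)) \<partial>PiM I (\<lambda>_. P)) = ennreal (binomial_mean (card I) (measure P D) \<phi>)"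
  using I \<phi>
proof (induction I arbitrary: \<phi>)
  case empty
  interpret E: prob_space "PiM ({} :: nat set) (\<lambda>_. P)" by (rule prob_space_PiM) (rule P)
  show ?case using E.emeasure_space_1 by (simp add: hits_def)
next
  case (insert i I)
  interpret P: prob_space P by fact
  interpret product_sigma_finite "\<lambda>_ :: nat. P" by standard
  note D [measurable]
  let ?p = "measure P D"
  have p: "0 \<le> ?p" "?p \<le> 1" by auto
  have "(\<integral>\<^sup>+w. ennreal (\<phi> (hits (insert i I) D w)) \<partial>PiM (insert i I) (\<lambda>_. P)) =
    (\<integral>\<^sup>+w. (\<integral>\<^sup>+z. ennreal (\<phi> (hits (insert i I) D (w(i := z)))) \<partial>P) \<partial>PiM I (\<lambda>_. P))"
    using insert.hyps by (intro product_nn_integral_insert) auto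
  also have "\<dots> = (\<integral>\<^sup>+w. ennreal ?p * ennreal (\<phi> (Suc (hits I D w))) + ennreal (1 - ?p) * ennreal (\<phi> (hits I D w)) \<partial>PiM I (\<lambda>_. P))"
  proof (rule nn_integral_cong)
    fix w :: "nat \<Rightarrow> 'a"
    have "(\<integral>\<^sup>+z. ennreal (\<phi> (hits (insert i I) D (w(i := z)))) \<partial>P) =
        (\<integral>\<^sup>+z. ennreal (\<phi> (Suc (hits I D w))) * indicator D z + ennreal (\<phi> (hits I D w)) * indicator (space P - D) z \<partial>P)"
      using insert.hyps by (intro nn_integral_cong) (auto simp: hits_insert indicator_def)
    also have "\<dots> = ennreal (\<phi> (Suc (hits I D w))) * emeasure P D + ennreal (\<phi> (hits I D w)) * emeasure P (space P - D)"
      using D by (subst nn_integral_add) (auto simp: nn_integral_cmult)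
    finally show "(\<integral>\<^sup>+z. ennreal (\<phi> (hits (insert i I) D (w(i := z)))) \<partial>P) =
        ennreal ?p * ennreal (\<phi> (Suc (hits I D w))) + ennreal (1 - ?p) * ennreal (\<phi> (hits I D w))"
      using D by (simp add: P.emeasure_eq_measure P.prob_compl mult.commute)
  qed
  also have "\<dots> = ennreal ?p * ennreal (binomial_mean (card I) ?p (\<lambda>k. \<phi> (Suc k))) + ennreal (1 - ?p) * ennreal (binomial_mean (card I) ?p \<phi>)"
    using insert.IH[of "\<lambda>k. \<phi> (Suc k)"] insert.IH[of \<phi>] insert.prems
    by (simp add: nn_integral_add nn_integral_cmult)
  also have "\<dots> = ennreal (?p * binomial_mean (card I) ?p (\<lambda>k. \<phi> (Suc k)) + (1 - ?p) * binomial_mean (card I) ?p \<phi>)"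
    using p binomial_mean_nonneg[OF p, of "\<lambda>k. \<phi> (Suc k)"] binomial_mean_nonneg[OF p, of \<phi>] insert.prems
    by (simp add: ennreal_mult ennreal_plus)
  finally show ?case using insert.hyps by simp
qed

text \<open>Independence as Fubini for one coordinate: that \<open>R\<close> does not look at
  coordinate \<open>i\<close> is expressed by invariance under updates at \<open>i\<close>.\<close>

lemma PiM_split_coordinate:
  fixes f :: "'z \<Rightarrow> real" and R :: "(nat \<Rightarrow> 'z) \<Rightarrow> real"
  assumes P: "prob_space P" and I: "finite I" "i \<in> I"
    and R: "\<And>w z. R (w(i := z)) = R w"
    and int: "integrable (PiM I (\<lambda>_. P)) (\<lambda>w. f (w i) * R w)"
  shows "(\<integral>w. f (w i) * R w \<partial>PiM I (\<lambda>_. P)) = (\<integral>z. f z \<partial>P) * (\<integral>w. R w \<partial>PiM (I - {i}) (\<lambda>_. P))"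
proof -
  interpret P: prob_space P by fact
  interpret product_sigma_finite "\<lambda>_ :: nat. P" by standard
  have ins: "insert i (I - {i}) = I" using I by auto
  have "(\<integral>w. f (w i) * R w \<partial>PiM (insert i (I - {i})) (\<lambda>_. P)) =
      (\<integral>w. (\<integral>z. f ((w(i := z)) i) * R (w(i := z)) \<partial>P) \<partial>PiM (I - {i}) (\<lambda>_. P))"
    by (rule product_integral_insert) (use I int ins in auto)
  then show ?thesis unfolding ins by (simp add: R)
qed

definition local_average :: "nat set \<Rightarrow> 'z set \<Rightarrow> ('z \<Rightarrow> real) \<Rightarrow> (nat \<Rightarrow> 'z) \<Rightarrow> real" where
  "local_average I D y w = (\<Sum>i\<in>I. y (w i) * indicator D (w i)) / real (hits I D w)"

lemma abs_mult_le_sum_squares: "\<bar>a * b\<bar> \<le> a\<^sup>2 + (b :: real)\<^sup>2"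
proof -
  have "2 * (\<bar>a\<bar> * \<bar>b\<bar>) \<le> a\<^sup>2 + b\<^sup>2"
    using sum_squares_bound[of "\<bar>a\<bar>" "\<bar>b\<bar>"] by (simp add: mult.assoc)
  moreover have "0 \<le> \<bar>a\<bar> * \<bar>b\<bar>" by simp
  ultimately show ?thesis unfolding abs_mult by linarith
qed

lemma integrable_PiM_component:
  fixes f :: "'z \<Rightarrow> real"
  assumes "prob_space P" "i \<in> I" "integrable P f"
  shows "integrable (PiM I (\<lambda>_. P)) (\<lambda>w. f (w i))"
proof -
  have "integrable (distr (PiM I (\<lambda>_. P)) P (\<lambda>w. w i)) f"
    using assms by (subst distr_PiM_component) auto
  then show ?thesis
    using assms by (subst (asm) integrable_distr_eq) auto
qed

lemma integral_hits:
  assumes P: "prob_space P" and I: "finite I" and D: "D \<in> sets P" and \<phi>: "\<And>k. 0 \<le> \<phi> k"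
  shows "(\<integral>w. \<phi> (hits I D w) \<partial>PiM I (\<lambda>_. P)) = binomial_mean (card I) (measure P D) \<phi>"
proof -
  note D [measurable]
  interpret P: prob_space P by fact
  have "(\<integral>w. \<phi> (hits I D w) \<partial>PiM I (\<lambda>_. P)) = enn2real (\<integral>\<^sup>+w. ennreal (\<phi> (hits I D w)) \<partial>PiM I (\<lambda>_. P))"
    using \<phi> by (intro integral_eq_nn_integral) auto
  also have "\<dots> = enn2real (ennreal (binomial_mean (card I) (measure P D) \<phi>))"
    by (subst nn_integral_hits[OF P I D \<phi>]) (rule refl)
  also have "\<dots> = binomial_mean (card I) (measure P D) \<phi>"
    using binomial_mean_nonneg[of "measure P D" \<phi>] \<phi> by simp
  finally show ?thesis .
qed

lemma hits_Diff_singleton: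
  assumes "finite I" "i \<in> I" "w i \<in> D"
  shows "hits I D w = Suc (hits (I - {i}) D w)"
proof -
  have "hits (insert i (I - {i})) D (w(i := w i)) = Suc (hits (I - {i}) D w)"
    using assms by (subst hits_insert) auto
  then show ?thesis using assms by (simp add: insert_absorb)
qed

text \<open>The random denominator couples all observations. If \<open>w i\<close> lies in
  \<open>D\<close>, the denominator is one more than the number of other hits, and otherwise
  \<open>g (w i)\<close> is 0; so in row \<open>i\<close> of the double sum the weight can be
  replaced by one that does not involve \<open>w i\<close>. The last term is the empty cell, where
  the average is 0 by convention.\<close>

lemma local_average_deviation:
  fixes y :: "'z \<Rightarrow> real" and A :: real and D :: "'z set"
  assumes I: "finite I"
  defines "g \<equiv> \<lambda>z. (y z - A) * indicator D z"
  shows "(local_average I D y w - A)\<^sup>2 =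
     (\<Sum>i\<in>I. (g (w i))\<^sup>2 * (1 / (real (hits (I - {i}) D w) + 1)\<^sup>2)) +
     (\<Sum>i\<in>I. \<Sum>k\<in>I - {i}. g (w i) * (g (w k) * (1 / (real (hits (I - {i}) D w) + 1)\<^sup>2))) +
     A\<^sup>2 * of_bool (hits I D w = 0)"
proof -
  let ?N = "real (hits I D w)"
  have row: "g (w i) * (\<Sum>k\<in>I. g (w k)) / ?N\<^sup>2 =
      (g (w i))\<^sup>2 * (1 / (real (hits (I - {i}) D w) + 1)\<^sup>2) +
      (\<Sum>k\<in>I - {i}. g (w i) * (g (w k) * (1 / (real (hits (I - {i}) D w) + 1)\<^sup>2)))" if i: "i \<in> I" for i
  proof (cases "w i \<in> D")
    case True
    then have N: "?N = real (hits (I - {i}) D w) + 1" using hits_Diff_singleton[OF I i, of w D] by simp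
    have "(\<Sum>k\<in>I. g (w k)) = g (w i) + (\<Sum>k\<in>I - {i}. g (w k))"
      by (rule sum.remove[OF I i])
    then show ?thesis unfolding N
      by (simp add: power2_eq_square algebra_simps sum_distrib_left sum_divide_distrib add_divide_distrib)
  next
    case False
    then show ?thesis by (simp add: g_def)
  qed
  have split: "(\<Sum>i\<in>I. g (w i)) = (\<Sum>i\<in>I. y (w i) * indicator D (w i)) - A * ?N"
    using I by (simp add: g_def hits_def left_diff_distrib sum_subtractf sum_distrib_left[symmetric] indicator_def sum.If_cases Int_def)
  have "(local_average I D y w - A)\<^sup>2 = ((\<Sum>i\<in>I. g (w i)) / ?N)\<^sup>2 + A\<^sup>2 * of_bool (hits I D w = 0)"
  proof (cases "hits I D w = 0")
    case False
    then have "local_average I D y w - A = (\<Sum>i\<in>I. g (w i)) / ?N"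
      unfolding split local_average_def by (simp add: field_simps)
    then show ?thesis using False by simp
  qed (simp add: local_average_def)
  also have "((\<Sum>i\<in>I. g (w i)) / ?N)\<^sup>2 = (\<Sum>i\<in>I. g (w i) * (\<Sum>k\<in>I. g (w k)) / ?N\<^sup>2)"
  proof -
    have "(\<Sum>i\<in>I. g (w i) * (\<Sum>k\<in>I. g (w k)) / ?N\<^sup>2) = (\<Sum>i\<in>I. g (w i)) * (\<Sum>k\<in>I. g (w k)) / ?N\<^sup>2"
      by (simp only: sum_distrib_right sum_divide_distrib)
    then show ?thesis by (simp add: power_divide power2_eq_square)
  qed
  also have "\<dots> = (\<Sum>i\<in>I. (g (w i))\<^sup>2 * (1 / (real (hits (I - {i}) D w) + 1)\<^sup>2)) +
     (\<Sum>i\<in>I. \<Sum>k\<in>I - {i}. g (w i) * (g (w k) * (1 / (real (hits (I - {i}) D w) + 1)\<^sup>2)))"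
    using row by (simp add: sum.distrib)
  finally show ?thesis .
qed

text \<open>With n observations and p the mass of \<open>D\<close>, the constant 3 consists of 2
  from the squares, by \<open>binomial_mean_inverse_square\<close>, and 1 from the empty cell, whose
  probability is at most 1 / (n p) and where the error is the square of \<open>A\<close>, at most
  \<open>C\<close>.\<close>

lemma local_average_risk:
  fixes y :: "'z \<Rightarrow> real"
  assumes P: "prob_space P" and I: "finite I" "I \<noteq> {}" and D: "D \<in> sets P"
    and p: "0 < measure P D" and y: "y \<in> borel_measurable P"
    and int: "integrable P (\<lambda>z. (y z)\<^sup>2 * indicator D z)"
    and C: "(\<integral>z. (y z)\<^sup>2 * indicator D z \<partial>P) \<le> C * measure P D"
    and A: "A = (\<integral>z. y z * indicator D z \<partial>P) / measure P D"
  shows "(\<integral>\<^sup>+w. ennreal ((local_average I D y w - A)\<^sup>2) \<partial>PiM I (\<lambda>_. P)) \<le> ennreal (3 * C / (real (card I) * measure P D))"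
proof -
  interpret P: prob_space P by fact
  note D [measurable] and y [measurable]
  let ?Q = "PiM I (\<lambda>_. P)"
  interpret Q: prob_space ?Q by (rule prob_space_PiM) (rule P)
  let ?p = "measure P D" and ?n = "real (card I)"
  have n: "?n \<ge> 1" using I by (simp add: Suc_le_eq card_gt_0_iff)
  have p1: "?p \<le> 1" by simp
  define g where "g = (\<lambda>z. (y z - A) * indicator D z)"
  have [measurable]: "g \<in> borel_measurable P" unfolding g_def by measurable
  \<comment> \<open>\<open>R i\<close> is the squared weight of observation \<open>i\<close> whenever \<open>i\<close> hits \<open>D\<close>, but does not depend on it.\<close>
  define R where "R = (\<lambda>i w. 1 / (real (hits (I - {i}) D w) + 1)\<^sup>2)"
  have R01: "0 \<le> R i w" "R i w \<le> 1" for i w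
    unfolding R_def by (auto simp: divide_le_eq_1 one_le_power)
  have Rm: "R i \<in> borel_measurable ?Q" for i
  proof -
    have "{w \<in> space ?Q. k \<in> {k \<in> I - {i}. w k \<in> D}} \<in> sets ?Q" for k
      by (cases "k \<in> I - {i}") auto
    then have "(\<lambda>w. card {k \<in> I - {i}. w k \<in> D}) \<in> measurable ?Q (count_space UNIV)"
      by (rule measurable_card)
    then show ?thesis unfolding R_def hits_def by measurable
  qed
  have intY: "integrable P (\<lambda>z. y z * indicator D z)"
  proof (rule P.square_integrable_imp_integrable)
    have "(\<lambda>z. (y z * indicator D z)\<^sup>2) = (\<lambda>z. (y z)\<^sup>2 * indicator D z)"
      by (auto simp: fun_eq_iff indicator_def)
    then show "integrable P (\<lambda>z. (y z * indicator D z)\<^sup>2)" using int by simp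
  qed simp
  have intD: "integrable P (indicator D :: 'z \<Rightarrow> real)"
    by (simp add: P.emeasure_eq_measure)
  have g1: "integrable P g" "(\<integral>z. g z \<partial>P) = 0"
  proof -
    have e: "g = (\<lambda>z. y z * indicator D z - A * indicator D z)"
      by (auto simp: g_def algebra_simps)
    show "integrable P g" unfolding e using intY intD by simp
    show "(\<integral>z. g z \<partial>P) = 0" unfolding e using intY intD p by (simp add: A)
  qed
  have g2: "integrable P (\<lambda>z. (g z)\<^sup>2)"
    and g2_eq: "(\<integral>z. (g z)\<^sup>2 \<partial>P) = (\<integral>z. (y z)\<^sup>2 * indicator D z \<partial>P) - A\<^sup>2 * ?p"
  proof -
    have e: "(\<lambda>z. (g z)\<^sup>2) = (\<lambda>z. (y z)\<^sup>2 * indicator D z - 2 * A * (y z * indicator D z) + A\<^sup>2 * indicator D z)"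
      by (auto simp: g_def fun_eq_iff indicator_def power2_eq_square algebra_simps)
    show "integrable P (\<lambda>z. (g z)\<^sup>2)" unfolding e using int intY intD by simp
    have "(\<integral>z. (g z)\<^sup>2 \<partial>P) = (\<integral>z. (y z)\<^sup>2 * indicator D z \<partial>P) - 2 * A * (A * ?p) + A\<^sup>2 * ?p"
      unfolding e using int intY intD p by (simp add: A)
    then show "(\<integral>z. (g z)\<^sup>2 \<partial>P) = (\<integral>z. (y z)\<^sup>2 * indicator D z \<partial>P) - A\<^sup>2 * ?p"
      by (simp add: power2_eq_square)
  qed
  have g2_le: "(\<integral>z. (g z)\<^sup>2 \<partial>P) \<le> C * ?p"
    using C g2_eq p by (smt (verit) mult_nonneg_nonneg zero_le_power2)
  have g2_nonneg: "0 \<le> (\<integral>z. (g z)\<^sup>2 \<partial>P)" by simp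
  \<comment> \<open>The second moment of \<open>g\<close> is nonnegative, which is Cauchy-Schwarz on
    \<open>D\<close>.\<close>
  have A2: "A\<^sup>2 \<le> C"
  proof -
    have "A\<^sup>2 * ?p \<le> C * ?p" using C g2_eq g2_nonneg by linarith
    then show ?thesis using p by simp
  qed
  have comp2: "integrable ?Q (\<lambda>w. (g (w i))\<^sup>2)" if "i \<in> I" for i
    using integrable_PiM_component[OF P that g2] .
  have cm: "(\<lambda>w. g (w i)) \<in> borel_measurable ?Q" if "i \<in> I" for i
    using that by measurable
  note [measurable] = Rm
  have diag_int: "integrable ?Q (\<lambda>w. (g (w i))\<^sup>2 * R i w)" if i: "i \<in> I" for i
  proof (rule Bochner_Integration.integrable_bound[OF comp2[OF i]])
    show "(\<lambda>w. (g (w i))\<^sup>2 * R i w) \<in> borel_measurable ?Q"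
      using cm[OF i] by measurable
  qed (use R01 in \<open>auto intro!: AE_I2 mult_left_le\<close>)
  have cross_int: "integrable ?Q (\<lambda>w. g (w i) * (g (w k) * R i w))" if i: "i \<in> I" and k: "k \<in> I" for i k
  proof (rule Bochner_Integration.integrable_bound)
    show "integrable ?Q (\<lambda>w. (g (w i))\<^sup>2 + (g (w k))\<^sup>2)"
      using comp2[OF i] comp2[OF k] by simp
    show "(\<lambda>w. g (w i) * (g (w k) * R i w)) \<in> borel_measurable ?Q"
      using cm[OF i] cm[OF k] by measurable
    show "AE w in ?Q. norm (g (w i) * (g (w k) * R i w)) \<le> norm ((g (w i))\<^sup>2 + (g (w k))\<^sup>2)"
    proof (intro AE_I2)
      fix w
      have "\<bar>g (w i) * (g (w k) * R i w)\<bar> = \<bar>g (w i) * g (w k)\<bar> * R i w"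
        using R01(1)[of i w] by (simp add: abs_mult)
      also have "\<dots> \<le> \<bar>g (w i) * g (w k)\<bar>"
        using R01 by (intro mult_left_le) auto
      also have "\<dots> \<le> (g (w i))\<^sup>2 + (g (w k))\<^sup>2"
        by (rule abs_mult_le_sum_squares)
      finally show "norm (g (w i) * (g (w k) * R i w)) \<le> norm ((g (w i))\<^sup>2 + (g (w k))\<^sup>2)"
        by simp
    qed
  qed
  have Rinv: "R i (w(i := z)) = R i w" for i w z
  proof -
    have "{k \<in> I - {i}. (w(i := z)) k \<in> D} = {k \<in> I - {i}. w k \<in> D}" by auto
    then show ?thesis by (simp add: R_def hits_def)
  qed
  have diag: "(\<integral>w. (g (w i))\<^sup>2 * R i w \<partial>?Q) \<le> C * ?p * (2 / (?n * ?p)\<^sup>2)" if i: "i \<in> I" for i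
  proof -
    have "(\<integral>w. (g (w i))\<^sup>2 * R i w \<partial>?Q) = (\<integral>z. (g z)\<^sup>2 \<partial>P) * (\<integral>w. R i w \<partial>PiM (I - {i}) (\<lambda>_. P))"
      by (rule PiM_split_coordinate[where f = "\<lambda>z. (g z)\<^sup>2", OF P I(1) i Rinv diag_int[OF i]])
    also have "(\<integral>w. R i w \<partial>PiM (I - {i}) (\<lambda>_. P)) = binomial_mean (card (I - {i})) ?p (\<lambda>k. 1 / (real k + 1)\<^sup>2)"
      unfolding R_def using I by (intro integral_hits[OF P _ D]) auto
    also have "\<dots> \<le> 2 / (real (Suc (card (I - {i}))) * ?p)\<^sup>2"
      using p p1 by (rule binomial_mean_inverse_square)
    also have "Suc (card (I - {i})) = card I"
      using I i by (simp only: card_Suc_Diff1)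
    also have "(\<integral>z. (g z)\<^sup>2 \<partial>P) * (2 / (?n * ?p)\<^sup>2) \<le> C * ?p * (2 / (?n * ?p)\<^sup>2)"
      using g2_le by (intro mult_right_mono) auto
    finally show ?thesis using g2_nonneg by (simp add: mult_left_mono)
  qed
  \<comment> \<open>The weight \<open>R i\<close> still involves \<open>w k\<close>. It is enough
    that it does not involve \<open>w i\<close>: integrating over \<open>w i\<close> produces the
    mean of \<open>g\<close>, which is 0 by the choice of \<open>A\<close>.\<close>
  have cross: "(\<integral>w. g (w i) * (g (w k) * R i w) \<partial>?Q) = 0" if i: "i \<in> I" and k: "k \<in> I - {i}" for i k
  proof -
    have "(\<integral>w. g (w i) * (g (w k) * R i w) \<partial>?Q) = (\<integral>z. g z \<partial>P) * (\<integral>w. g (w k) * R i w \<partial>PiM (I - {i}) (\<lambda>_. P))"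
      by (rule PiM_split_coordinate[OF P I(1) i _ cross_int]) (use i k Rinv in auto)
    then show ?thesis by (simp add: g1)
  qed
  have zero_int: "integrable ?Q (\<lambda>w. A\<^sup>2 * of_bool (hits I D w = 0))"
    by (rule Q.integrable_const_bound[where B = "A\<^sup>2"]) auto
  have zero: "(\<integral>w. A\<^sup>2 * of_bool (hits I D w = 0) \<partial>?Q) \<le> C / (?n * ?p)"
  proof -
    have "(\<integral>w. of_bool (hits I D w = 0) \<partial>?Q) = binomial_mean (card I) ?p (\<lambda>k. of_bool (k = 0))"
      by (rule integral_hits[OF P I(1) D]) simp
    also have "\<dots> \<le> binomial_mean (card I) ?p (\<lambda>k. 1 / (real k + 1))"
      by (rule binomial_mean_mono) auto
    also have "\<dots> \<le> 1 / (real (Suc (card I)) * ?p)"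
      by (rule binomial_mean_inverse[OF p p1])
    also have "\<dots> \<le> 1 / (?n * ?p)"
      using n p by (intro divide_left_mono mult_right_mono mult_pos_pos) auto
    finally have "A\<^sup>2 * (\<integral>w. of_bool (hits I D w = 0) \<partial>?Q) \<le> C * (1 / (?n * ?p))"
      using A2 by (intro mult_mono) (auto intro: order_trans[OF zero_le_power2])
    then show ?thesis by simp
  qed
  let ?dev = "\<lambda>w. (\<Sum>i\<in>I. (g (w i))\<^sup>2 * R i w) + (\<Sum>i\<in>I. \<Sum>k\<in>I - {i}. g (w i) * (g (w k) * R i w)) +
     A\<^sup>2 * of_bool (hits I D w = 0)"
  have dev: "(local_average I D y w - A)\<^sup>2 = ?dev w" for w
    unfolding g_def R_def by (rule local_average_deviation[OF I(1)])
  have dev_int: "integrable ?Q ?dev"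
    using diag_int cross_int zero_int
    by (intro Bochner_Integration.integrable_add Bochner_Integration.integrable_sum) auto
  have "(\<integral>w. ?dev w \<partial>?Q) = (\<Sum>i\<in>I. \<integral>w. (g (w i))\<^sup>2 * R i w \<partial>?Q) +
      (\<Sum>i\<in>I. \<Sum>k\<in>I - {i}. \<integral>w. g (w i) * (g (w k) * R i w) \<partial>?Q) +
      (\<integral>w. A\<^sup>2 * of_bool (hits I D w = 0) \<partial>?Q)"
    using diag_int cross_int zero_int
    by (subst Bochner_Integration.integral_add Bochner_Integration.integral_sum;
        (intro Bochner_Integration.integrable_add Bochner_Integration.integrable_sum)?; auto)+
  also have "\<dots> \<le> (\<Sum>i\<in>I. C * ?p * (2 / (?n * ?p)\<^sup>2)) + (\<Sum>i\<in>I. \<Sum>k\<in>I - {i}. 0) + C / (?n * ?p)"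
    using diag cross zero by (intro add_mono sum_mono) auto
  also have "\<dots> = 3 * C / (?n * ?p)"
    using n p by (simp add: power2_eq_square field_simps)
  finally have "(\<integral>w. ?dev w \<partial>?Q) \<le> 3 * C / (?n * ?p)" .
  moreover have "(\<integral>\<^sup>+w. ennreal ((local_average I D y w - A)\<^sup>2) \<partial>?Q) = ennreal (\<integral>w. ?dev w \<partial>?Q)"
    unfolding dev using dev_int by (intro nn_integral_eq_integral) (auto simp flip: dev)
  ultimately show ?thesis by (simp add: ennreal_leI)
qed

section \<open>Averages over several trees\<close>

lemma integral_PiM_component:
  fixes f :: "'z \<Rightarrow> real"
  assumes "prob_space P" "i \<in> I" "f \<in> borel_measurable P"
  shows "(\<integral>w. f (w i) \<partial>PiM I (\<lambda>_. P)) = (\<integral>z. f z \<partial>P)"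
proof -
  have "(\<integral>z. f z \<partial>distr (PiM I (\<lambda>_. P)) P (\<lambda>w. w i)) = (\<integral>w. f (w i) \<partial>PiM I (\<lambda>_. P))"
    using assms by (intro integral_distr) auto
  then show ?thesis
    using assms by (subst (asm) distr_PiM_component) auto
qed

lemma nn_integral_PiM_component:
  assumes "prob_space P" "i \<in> I" "f \<in> borel_measurable P"
  shows "(\<integral>\<^sup>+w. f (w i) \<partial>PiM I (\<lambda>_. P)) = (\<integral>\<^sup>+z. f z \<partial>P)"
proof -
  have "(\<integral>\<^sup>+z. f z \<partial>distr (PiM I (\<lambda>_. P)) P (\<lambda>w. w i)) = (\<integral>\<^sup>+w. f (w i) \<partial>PiM I (\<lambda>_. P))"
    using assms by (intro nn_integral_distr) auto
  then show ?thesis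
    using assms by (subst (asm) distr_PiM_component) auto
qed

text \<open>After centring, the products of different coordinates have mean 0 by independence, so
  the fluctuation is divided by the number of coordinates while the mean stays.\<close>

lemma mean_square_average:
  fixes a :: "'h \<Rightarrow> real" and J :: "nat set"
  assumes M: "prob_space M" and J: "finite J" "J \<noteq> {}"
    and a: "a \<in> borel_measurable M" "integrable M (\<lambda>h. (a h)\<^sup>2)"
  shows "integrable (PiM J (\<lambda>_. M)) (\<lambda>h. ((\<Sum>b\<in>J. a (h b)) / real (card J))\<^sup>2)"
    and "(\<integral>h. ((\<Sum>b\<in>J. a (h b)) / real (card J))\<^sup>2 \<partial>PiM J (\<lambda>_. M)) \<le>
      (\<integral>h. (a h)\<^sup>2 \<partial>M) / real (card J) + (\<integral>h. a h \<partial>M)\<^sup>2"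
proof -
  interpret M: prob_space M by fact
  let ?Q = "PiM J (\<lambda>_. M)" and ?B = "real (card J)"
  interpret Q: prob_space ?Q by (rule prob_space_PiM) (rule M)
  note a(1) [measurable]
  have B: "?B > 0" using J by (simp add: card_gt_0_iff)
  have a1: "integrable M a"
    by (rule M.square_integrable_imp_integrable[OF a])
  define m where "m = (\<integral>h. a h \<partial>M)"
  define c where "c = (\<lambda>h. a h - m)"
  have [measurable]: "c \<in> borel_measurable M" unfolding c_def by measurable
  have c1: "integrable M c" "(\<integral>h. c h \<partial>M) = 0"
    unfolding c_def using a1 by (simp_all add: m_def[symmetric] M.prob_space)
  have e: "(\<lambda>h. (c h)\<^sup>2) = (\<lambda>h. (a h)\<^sup>2 - 2 * m * a h + m\<^sup>2)"
    by (auto simp: c_def fun_eq_iff power2_eq_square algebra_simps)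
  have c2: "integrable M (\<lambda>h. (c h)\<^sup>2)"
    unfolding e using a1 a(2) by simp
  have "(\<integral>h. (c h)\<^sup>2 \<partial>M) = (\<integral>h. (a h)\<^sup>2 \<partial>M) - 2 * m * m + m\<^sup>2"
    unfolding e using a1 a(2) by (simp add: M.prob_space m_def[symmetric])
  then have c2_le: "(\<integral>h. (c h)\<^sup>2 \<partial>M) \<le> (\<integral>h. (a h)\<^sup>2 \<partial>M)"
    by (simp add: power2_eq_square)
  have i1: "integrable ?Q (\<lambda>h. c (h b))" if "b \<in> J" for b
    using integrable_PiM_component[OF M that c1(1)] .
  have i2: "integrable ?Q (\<lambda>h. (c (h b))\<^sup>2)" if "b \<in> J" for b
    using integrable_PiM_component[OF M that c2] .
  have i3: "integrable ?Q (\<lambda>h. c (h b) * c (h k))" if b: "b \<in> J" and k: "k \<in> J" for b k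
  proof (rule Bochner_Integration.integrable_bound)
    show "integrable ?Q (\<lambda>h. (c (h b))\<^sup>2 + (c (h k))\<^sup>2)"
      using i2[OF b] i2[OF k] by simp
    show "(\<lambda>h. c (h b) * c (h k)) \<in> borel_measurable ?Q"
      using b k by measurable
    show "AE h in ?Q. norm (c (h b) * c (h k)) \<le> norm ((c (h b))\<^sup>2 + (c (h k))\<^sup>2)"
      using abs_mult_le_sum_squares by (intro AE_I2) simp
  qed
  have zero: "(\<integral>h. c (h b) * c (h k) \<partial>?Q) = 0" if b: "b \<in> J" and k: "k \<in> J - {b}" for b k
  proof -
    have "(\<integral>h. c (h b) * c (h k) \<partial>?Q) = (\<integral>h. c h \<partial>M) * (\<integral>h. c (h k) \<partial>PiM (J - {b}) (\<lambda>_. M))"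
      by (rule PiM_split_coordinate[OF M J(1) b, where f = c and R = "\<lambda>h. c (h k)"]) (use b k i3 in auto)
    then show ?thesis by (simp add: c1)
  qed
  have expand: "((\<Sum>b\<in>J. a (h b)) / ?B)\<^sup>2 =
      ((\<Sum>b\<in>J. (c (h b))\<^sup>2) + (\<Sum>b\<in>J. \<Sum>k\<in>J - {b}. c (h b) * c (h k))) / ?B\<^sup>2 +
      2 * m / ?B * (\<Sum>b\<in>J. c (h b)) + m\<^sup>2" for h
  proof -
    have "(\<Sum>b\<in>J. a (h b)) / ?B = (\<Sum>b\<in>J. c (h b)) / ?B + m"
      using B by (simp add: c_def sum_subtractf diff_divide_distrib)
    then have "((\<Sum>b\<in>J. a (h b)) / ?B)\<^sup>2 = (\<Sum>b\<in>J. c (h b))\<^sup>2 / ?B\<^sup>2 + 2 * m / ?B * (\<Sum>b\<in>J. c (h b)) + m\<^sup>2"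
      by (simp add: power2_sum power_divide)
    also have "(\<Sum>b\<in>J. c (h b))\<^sup>2 = (\<Sum>b\<in>J. c (h b) * (\<Sum>k\<in>J. c (h k)))"
      by (simp add: power2_eq_square sum_distrib_right)
    also have "\<dots> = (\<Sum>b\<in>J. (c (h b))\<^sup>2 + (\<Sum>k\<in>J - {b}. c (h b) * c (h k)))"
    proof (rule sum.cong[OF refl])
      fix b assume b: "b \<in> J"
      have "(\<Sum>k\<in>J. c (h k)) = c (h b) + (\<Sum>k\<in>J - {b}. c (h k))"
        by (rule sum.remove[OF J(1) b])
      then show "c (h b) * (\<Sum>k\<in>J. c (h k)) = (c (h b))\<^sup>2 + (\<Sum>k\<in>J - {b}. c (h b) * c (h k))"
        by (simp add: power2_eq_square distrib_left sum_distrib_left)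
    qed
    finally show ?thesis by (simp add: sum.distrib)
  qed
  have j1: "integrable ?Q (\<lambda>h. \<Sum>b\<in>J. (c (h b))\<^sup>2)"
    "integrable ?Q (\<lambda>h. \<Sum>b\<in>J. \<Sum>k\<in>J - {b}. c (h b) * c (h k))"
    "integrable ?Q (\<lambda>h. \<Sum>b\<in>J. c (h b))"
    using i1 i2 i3 by (auto intro!: Bochner_Integration.integrable_sum)
  show "integrable ?Q (\<lambda>h. ((\<Sum>b\<in>J. a (h b)) / ?B)\<^sup>2)"
    unfolding expand using j1 by simp
  have k1: "(\<integral>h. (\<Sum>b\<in>J. (c (h b))\<^sup>2) \<partial>?Q) = ?B * (\<integral>h. (c h)\<^sup>2 \<partial>M)"
    using i2 by (simp add: Bochner_Integration.integral_sum integral_PiM_component[OF M, of _ J "\<lambda>z. (c z)\<^sup>2"])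
  have k2: "(\<integral>h. (\<Sum>b\<in>J. \<Sum>k\<in>J - {b}. c (h b) * c (h k)) \<partial>?Q) = 0"
  proof -
    have "(\<integral>h. (\<Sum>k\<in>J - {b}. c (h b) * c (h k)) \<partial>?Q) = 0" if "b \<in> J" for b
      using i3 zero that by (subst Bochner_Integration.integral_sum) auto
    then show ?thesis
      using i3 by (subst Bochner_Integration.integral_sum) (auto intro!: Bochner_Integration.integrable_sum)
  qed
  have k3: "(\<integral>h. (\<Sum>b\<in>J. c (h b)) \<partial>?Q) = 0"
    using i1 c1 by (simp add: Bochner_Integration.integral_sum integral_PiM_component[OF M])
  have "(\<integral>h. ((\<Sum>b\<in>J. a (h b)) / ?B)\<^sup>2 \<partial>?Q) = (?B * (\<integral>h. (c h)\<^sup>2 \<partial>M)) / ?B\<^sup>2 + m\<^sup>2"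
    unfolding expand using j1 by (simp add: k1 k2 k3 Q.prob_space)
  also have "\<dots> \<le> (\<integral>h. (a h)\<^sup>2 \<partial>M) / ?B + m\<^sup>2"
    using B c2_le by (simp add: power2_eq_square divide_right_mono)
  finally show "(\<integral>h. ((\<Sum>b\<in>J. a (h b)) / ?B)\<^sup>2 \<partial>?Q) \<le> (\<integral>h. (a h)\<^sup>2 \<partial>M) / ?B + (\<integral>h. a h \<partial>M)\<^sup>2"
    by (simp add: m_def)
qed

lemma measurable_local_average:
  assumes I: "finite I"
    and D [measurable]: "Measurable.pred (M \<Otimes>\<^sub>M P) (\<lambda>z. snd z \<in> D (fst z))"
    and y [measurable]: "y \<in> borel_measurable P" and b: "b \<in> J"
  shows "(\<lambda>z. local_average I (D (snd z b)) y (fst z)) \<in> borel_measurable (PiM I (\<lambda>_. P) \<Otimes>\<^sub>M PiM J (\<lambda>_. M))"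
proof -
  let ?R = "PiM I (\<lambda>_. P) \<Otimes>\<^sub>M PiM J (\<lambda>_. M)"
  have pred: "Measurable.pred ?R (\<lambda>z. fst z i \<in> D (snd z b))" if i: "i \<in> I" for i
  proof -
    have "(\<lambda>z. (snd z b, fst z i)) \<in> measurable ?R (M \<Otimes>\<^sub>M P)"
      using i b by measurable
    from measurable_compose[OF this D] show ?thesis by simp
  qed
  have h: "(\<lambda>z. hits I (D (snd z b)) (fst z)) \<in> measurable ?R (count_space UNIV)"
    unfolding hits_def
  proof (rule measurable_card)
    fix i
    show "{z \<in> space ?R. i \<in> {i \<in> I. fst z i \<in> D (snd z b)}} \<in> sets ?R"
      using pred[of i] by (cases "i \<in> I") (auto simp: pred_def)
  qed
  have "(\<lambda>z. y (fst z i) * indicator (D (snd z b)) (fst z i)) \<in> borel_measurable ?R" if i: "i \<in> I" for i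
  proof -
    note [measurable] = pred[OF i]
    have "(\<lambda>z. y (fst z i)) \<in> borel_measurable ?R" using i by measurable
    then show ?thesis unfolding indicator_def by measurable
  qed
  then have "(\<lambda>z. \<Sum>i\<in>I. y (fst z i) * indicator (D (snd z b)) (fst z i)) \<in> borel_measurable ?R"
    by (rule borel_measurable_sum)
  then show ?thesis
    unfolding local_average_def using h by measurable
qed

lemma borel_measurable_sections:
  fixes y :: "'z \<Rightarrow> real" and D :: "'h \<Rightarrow> 'z set"
  assumes P: "prob_space P"
    and D [measurable]: "Measurable.pred (M \<Otimes>\<^sub>M P) (\<lambda>z. snd z \<in> D (fst z))" and DP: "\<And>h. h \<in> space M \<Longrightarrow> D h \<in> sets P"
    and y [measurable]: "y \<in> borel_measurable P"
  shows "(\<lambda>h. measure P (D h)) \<in> borel_measurable M"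
    and "(\<lambda>h. \<integral>z. y z * indicator (D h) z \<partial>P) \<in> borel_measurable M"
proof -
  interpret P: prob_space P by (rule P)
  show "(\<lambda>h. measure P (D h)) \<in> borel_measurable M"
  proof -
    have "(\<lambda>h. \<integral>z. (of_bool (z \<in> D h) :: real) \<partial>P) \<in> borel_measurable M"
      by (rule P.borel_measurable_lebesgue_integral) (unfold of_bool_def case_prod_beta, measurable)
    moreover have "(\<integral>z. (of_bool (z \<in> D h) :: real) \<partial>P) = measure P (D h)" if "h \<in> space M" for h
    proof -
      have "(\<integral>z. (of_bool (z \<in> D h) :: real) \<partial>P) = (\<integral>z. indicator (D h) z \<partial>P)"
        by (simp add: indicator_def)
      then show ?thesis using DP[OF that] by simp
    qed
    ultimately show ?thesis by (simp cong: measurable_cong)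
  qed
  show "(\<lambda>h. \<integral>z. y z * indicator (D h) z \<partial>P) \<in> borel_measurable M"
    by (rule P.borel_measurable_lebesgue_integral) (unfold indicator_def of_bool_def case_prod_beta, measurable)
qed

text \<open>The error is the average of \<open>T\<close>, the deviation of a tree from the mean
  response in its own cell, plus the average of the biases \<open>a\<close>. The trees share the
  data, so the \<open>T\<close> of different trees are dependent and only convexity of the square is
  used; each is bounded by \<open>local_average_risk\<close> with its cell held fixed. The biases
  depend on the trees alone and obey \<open>mean_square_average\<close>. Squaring a sum of two costs
  a factor 2, which also turns the 3 of \<open>local_average_risk\<close> into 6.\<close>

lemma forest_risk:
  fixes y :: "'z \<Rightarrow> real" and D :: "'h \<Rightarrow> 'z set" and m :: real and I J :: "nat set"
  assumes P: "prob_space P" and M: "prob_space M"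
    and I: "finite I" "I \<noteq> {}" and J: "finite J" "J \<noteq> {}"
    and D [measurable]: "Measurable.pred (M \<Otimes>\<^sub>M P) (\<lambda>z. snd z \<in> D (fst z))" and DP: "\<And>h. h \<in> space M \<Longrightarrow> D h \<in> sets P"
    and y [measurable]: "y \<in> borel_measurable P" and int: "integrable P (\<lambda>z. (y z)\<^sup>2)"
    and C0: "0 \<le> C" and C: "\<And>h. h \<in> space M \<Longrightarrow> (\<integral>z. (y z)\<^sup>2 * indicator (D h) z \<partial>P) \<le> C * measure P (D h)"
    and pos: "AE h in M. 0 < measure P (D h)"
  defines "a \<equiv> \<lambda>h. (\<integral>z. y z * indicator (D h) z \<partial>P) / measure P (D h) - m"
  assumes bnd: "AE h in M. \<bar>a h\<bar> \<le> K"
  shows "(\<integral>\<^sup>+z. ennreal (((\<Sum>b\<in>J. local_average I (D (snd z b)) y (fst z)) / real (card J) - m)\<^sup>2)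
      \<partial>(PiM I (\<lambda>_. P) \<Otimes>\<^sub>M PiM J (\<lambda>_. M))) \<le>
    ennreal (6 * C / real (card I)) * (\<integral>\<^sup>+h. ennreal (1 / measure P (D h)) \<partial>M) +
    ennreal (2 * ((\<integral>h. (a h)\<^sup>2 \<partial>M) / real (card J) + (\<integral>h. a h \<partial>M)\<^sup>2))"
proof -
  interpret P: prob_space P by fact
  interpret M: prob_space M by fact
  let ?PI = "PiM I (\<lambda>_. P)" and ?MJ = "PiM J (\<lambda>_. M)" and ?B = "real (card J)" and ?n = "real (card I)"
  interpret PI: prob_space ?PI by (rule prob_space_PiM) (rule P)
  interpret MJ: prob_space ?MJ by (rule prob_space_PiM) (rule M)
  interpret Q: pair_sigma_finite ?PI ?MJ by standard
  have B: "?B > 0" using J by (simp add: card_gt_0_iff)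
  have n: "?n > 0" using I by (simp add: card_gt_0_iff)
  note [measurable] = borel_measurable_sections[OF P D DP y]
  have am [measurable]: "a \<in> borel_measurable M" unfolding a_def by measurable
  have a2: "integrable M (\<lambda>h. (a h)\<^sup>2)"
  proof (rule M.integrable_const_bound[where B = "K\<^sup>2"])
    show "AE h in M. norm ((a h)\<^sup>2) \<le> K\<^sup>2"
      using bnd by eventually_elim (simp add: abs_le_square_iff[symmetric])
  qed measurable
  define T where "T = (\<lambda>w h. local_average I (D h) y w - a h - m)"
  have Tm: "(\<lambda>z. T (fst z) (snd z b)) \<in> borel_measurable (?PI \<Otimes>\<^sub>M ?MJ)" if b: "b \<in> J" for b
  proof -
    note [measurable] = measurable_local_average[OF I(1) D y b]
    have [measurable]: "(\<lambda>z. a (snd z b)) \<in> borel_measurable (?PI \<Otimes>\<^sub>M ?MJ)"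
      using b by measurable
    show ?thesis unfolding T_def by measurable
  qed
  have tree: "(\<integral>\<^sup>+z. ennreal ((T (fst z) (snd z b))\<^sup>2) \<partial>(?PI \<Otimes>\<^sub>M ?MJ)) \<le>
      ennreal (3 * C / ?n) * (\<integral>\<^sup>+h. ennreal (1 / measure P (D h)) \<partial>M)" if b: "b \<in> J" for b
  proof -
    note [measurable] = Tm[OF b]
    have "(\<integral>\<^sup>+z. ennreal ((T (fst z) (snd z b))\<^sup>2) \<partial>(?PI \<Otimes>\<^sub>M ?MJ)) =
        (\<integral>\<^sup>+h. (\<integral>\<^sup>+w. ennreal ((T (fst (w, h)) (snd (w, h) b))\<^sup>2) \<partial>?PI) \<partial>?MJ)"
      by (rule Q.nn_integral_snd[symmetric]) measurable
    also have "\<dots> = (\<integral>\<^sup>+h. (\<integral>\<^sup>+w. ennreal ((T w (h b))\<^sup>2) \<partial>?PI) \<partial>?MJ)" by simp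
    also have "\<dots> \<le> (\<integral>\<^sup>+h. ennreal (3 * C / ?n) * ennreal (1 / measure P (D (h b))) \<partial>?MJ)"
    proof (rule nn_integral_mono_AE)
      have "AE h in ?MJ. 0 < measure P (D (h b))"
      proof -
        have "AE h in distr ?MJ M (\<lambda>h. h b). 0 < measure P (D h)"
          using pos M b by (subst distr_PiM_component) auto
        then show ?thesis using b by (subst (asm) AE_distr_iff) auto
      qed
      then show "AE h in ?MJ. (\<integral>\<^sup>+w. ennreal ((T w (h b))\<^sup>2) \<partial>?PI) \<le> ennreal (3 * C / ?n) * ennreal (1 / measure P (D (h b)))"
      proof (rule AE_mp[OF _ AE_I2], intro impI)
        fix h assume h: "h \<in> space ?MJ" and q: "0 < measure P (D (h b))"
        have hb: "h b \<in> space M" using h b by (auto simp: space_PiM)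
        note Dh = DP[OF hb]
        have "(\<integral>\<^sup>+w. ennreal ((T w (h b))\<^sup>2) \<partial>?PI) = (\<integral>\<^sup>+w. ennreal ((local_average I (D (h b)) y w -
            (\<integral>z. y z * indicator (D (h b)) z \<partial>P) / measure P (D (h b)))\<^sup>2) \<partial>?PI)"
          by (simp add: T_def a_def)
        also have "\<dots> \<le> ennreal (3 * C / (?n * measure P (D (h b))))"
          using integrable_real_mult_indicator[OF Dh int]
          by (intro local_average_risk[OF P I Dh q y _ C[OF hb] refl])
        also have "3 * C / (?n * measure P (D (h b))) = 3 * C / ?n * (1 / measure P (D (h b)))"
          by simp
        also have "ennreal \<dots> = ennreal (3 * C / ?n) * ennreal (1 / measure P (D (h b)))"
          using C0 n q by (intro ennreal_mult) auto
        finally show "(\<integral>\<^sup>+w. ennreal ((T w (h b))\<^sup>2) \<partial>?PI) \<le> ennreal (3 * C / ?n) * ennreal (1 / measure P (D (h b)))" .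
      qed
    qed
    also have "\<dots> = (\<integral>\<^sup>+h. ennreal (3 * C / ?n) * ennreal (1 / measure P (D h)) \<partial>M)"
      by (rule nn_integral_PiM_component[OF M b]) measurable
    also have "\<dots> = ennreal (3 * C / ?n) * (\<integral>\<^sup>+h. ennreal (1 / measure P (D h)) \<partial>M)"
      by (rule nn_integral_cmult) measurable
    finally show ?thesis .
  qed
  let ?S = "\<lambda>z. (\<Sum>b\<in>J. a (snd z b)) / ?B"
  have Sm [measurable]: "(\<lambda>h. (\<Sum>b\<in>J. a (h b)) / ?B) \<in> borel_measurable ?MJ"
    by measurable
  have pw: "((\<Sum>b\<in>J. local_average I (D (snd z b)) y (fst z)) / ?B - m)\<^sup>2 \<le>
      (2 / ?B) * (\<Sum>b\<in>J. (T (fst z) (snd z b))\<^sup>2) + 2 * (?S z)\<^sup>2" for z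
  proof -
    have "(\<Sum>b\<in>J. local_average I (D (snd z b)) y (fst z)) / ?B - m =
        (\<Sum>b\<in>J. T (fst z) (snd z b)) / ?B + ?S z"
      using B by (simp add: T_def sum_subtractf sum.distrib field_simps)
    then have "((\<Sum>b\<in>J. local_average I (D (snd z b)) y (fst z)) / ?B - m)\<^sup>2 \<le>
        2 * ((\<Sum>b\<in>J. T (fst z) (snd z b)) / ?B)\<^sup>2 + 2 * (?S z)\<^sup>2"
      using sum_squares_bound[of "(\<Sum>b\<in>J. T (fst z) (snd z b)) / ?B" "?S z"] by (simp add: power2_sum)
    also have "((\<Sum>b\<in>J. T (fst z) (snd z b)) / ?B)\<^sup>2 \<le> (\<Sum>b\<in>J. (T (fst z) (snd z b))\<^sup>2) / ?B"
    proof -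
      have "(\<Sum>b\<in>J. T (fst z) (snd z b))\<^sup>2 \<le> ?B * (\<Sum>b\<in>J. (T (fst z) (snd z b))\<^sup>2)"
        using sum_squared_le_sum_of_squares[of "\<lambda>b. T (fst z) (snd z b)" J] J by (simp add: mult.commute)
      then show ?thesis using B by (simp add: power_divide power2_eq_square field_simps)
    qed
    finally show ?thesis by simp
  qed
  have "(\<integral>\<^sup>+z. ennreal (((\<Sum>b\<in>J. local_average I (D (snd z b)) y (fst z)) / ?B - m)\<^sup>2) \<partial>(?PI \<Otimes>\<^sub>M ?MJ)) \<le>
      (\<integral>\<^sup>+z. ennreal (2 / ?B) * (\<Sum>b\<in>J. ennreal ((T (fst z) (snd z b))\<^sup>2)) + ennreal (2 * (?S z)\<^sup>2) \<partial>(?PI \<Otimes>\<^sub>M ?MJ))"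
  proof (rule nn_integral_mono)
    fix z
    show "ennreal (((\<Sum>b\<in>J. local_average I (D (snd z b)) y (fst z)) / ?B - m)\<^sup>2) \<le>
        ennreal (2 / ?B) * (\<Sum>b\<in>J. ennreal ((T (fst z) (snd z b))\<^sup>2)) + ennreal (2 * (?S z)\<^sup>2)"
    proof -
      have "ennreal (2 / ?B) * (\<Sum>b\<in>J. ennreal ((T (fst z) (snd z b))\<^sup>2)) + ennreal (2 * (?S z)\<^sup>2) =
          ennreal (2 / ?B * (\<Sum>b\<in>J. (T (fst z) (snd z b))\<^sup>2)) + ennreal (2 * (?S z)\<^sup>2)"
        using B by (subst ennreal_mult) (auto intro!: sum_nonneg)
      also have "\<dots> = ennreal (2 / ?B * (\<Sum>b\<in>J. (T (fst z) (snd z b))\<^sup>2) + 2 * (?S z)\<^sup>2)"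
        using B by (intro ennreal_plus[symmetric]) (auto intro!: sum_nonneg divide_nonneg_pos)
      finally show ?thesis using ennreal_leI[OF pw[of z]] by simp
    qed
  qed
  also have "\<dots> = ennreal (2 / ?B) * (\<Sum>b\<in>J. \<integral>\<^sup>+z. ennreal ((T (fst z) (snd z b))\<^sup>2) \<partial>(?PI \<Otimes>\<^sub>M ?MJ)) +
      (\<integral>\<^sup>+z. ennreal (2 * (?S z)\<^sup>2) \<partial>(?PI \<Otimes>\<^sub>M ?MJ))"
  proof -
    have "(\<lambda>z. ennreal (2 * (?S z)\<^sup>2)) \<in> borel_measurable (?PI \<Otimes>\<^sub>M ?MJ)" by measurable
    moreover have "(\<lambda>z. ennreal ((T (fst z) (snd z b))\<^sup>2)) \<in> borel_measurable (?PI \<Otimes>\<^sub>M ?MJ)" if "b \<in> J" for b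
      using Tm[OF that] by measurable
    ultimately show ?thesis
      by (subst nn_integral_add, simp, simp, subst nn_integral_cmult, simp, subst nn_integral_sum, simp_all)
  qed
  also have "\<dots> \<le> ennreal (2 / ?B) * (\<Sum>b\<in>J. ennreal (3 * C / ?n) * (\<integral>\<^sup>+h. ennreal (1 / measure P (D h)) \<partial>M)) +
      ennreal (2 * ((\<integral>h. (a h)\<^sup>2 \<partial>M) / ?B + (\<integral>h. a h \<partial>M)\<^sup>2))"
  proof (intro add_mono mult_left_mono sum_mono tree)
    have "(\<integral>\<^sup>+z. ennreal (2 * (?S z)\<^sup>2) \<partial>(?PI \<Otimes>\<^sub>M ?MJ)) =
        (\<integral>\<^sup>+h. (\<integral>\<^sup>+w. ennreal (2 * (?S (w, h))\<^sup>2) \<partial>?PI) \<partial>?MJ)"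
      by (rule Q.nn_integral_snd[symmetric]) measurable
    also have "\<dots> = (\<integral>\<^sup>+h. ennreal (2 * ((\<Sum>b\<in>J. a (h b)) / ?B)\<^sup>2) \<partial>?MJ)"
      by (simp add: PI.emeasure_space_1)
    also have "\<dots> = ennreal (\<integral>h. 2 * ((\<Sum>b\<in>J. a (h b)) / ?B)\<^sup>2 \<partial>?MJ)"
      using mean_square_average(1)[OF M J am a2] by (intro nn_integral_eq_integral) auto
    also have "\<dots> \<le> ennreal (2 * ((\<integral>h. (a h)\<^sup>2 \<partial>M) / ?B + (\<integral>h. a h \<partial>M)\<^sup>2))"
      using mean_square_average(2)[OF M J am a2] by (intro ennreal_leI) simp
    finally show "(\<integral>\<^sup>+z. ennreal (2 * (?S z)\<^sup>2) \<partial>(?PI \<Otimes>\<^sub>M ?MJ)) \<le> ennreal (2 * ((\<integral>h. (a h)\<^sup>2 \<partial>M) / ?B + (\<integral>h. a h \<partial>M)\<^sup>2))" .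
  qed auto
  also have "ennreal (2 / ?B) * (\<Sum>b\<in>J. ennreal (3 * C / ?n) * (\<integral>\<^sup>+h. ennreal (1 / measure P (D h)) \<partial>M)) =
      ennreal (6 * C / ?n) * (\<integral>\<^sup>+h. ennreal (1 / measure P (D h)) \<partial>M)"
  proof -
    have "ennreal (2 / ?B) * (of_nat (card J) * ennreal (3 * C / ?n)) = ennreal (6 * C / ?n)"
      using B C0 n by (simp add: ennreal_of_nat_eq_real_of_nat ennreal_mult[symmetric])
    then show ?thesis by (simp add: mult.assoc[symmetric])
  qed
  finally show ?thesis .
qed

section \<open>Hoelder classes\<close>

lemma cube_convex: "convex (cube :: (real ^ 'd::finite) set)"
  by (rule convex_box)

text \<open>For \<open>\<beta> > 1\<close> the order of differentiation drops by exactly one with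
  \<beta>, so the exponent of the Hoelder condition stays the same; a list of coordinates for
  \<open>partial i g\<close> becomes one for \<open>g\<close> by putting \<open>i\<close> in
  front.\<close>

lemma holder_class_diff:
  assumes "\<beta> > 1" "g \<in> holder_class \<beta>"
  shows "g differentiable_on cube" "partial i g \<in> holder_class (\<beta> - 1)"
proof -
  define k where "k = nat \<lceil>\<beta> - 1 - 1\<rceil>"
  have k: "nat \<lceil>\<beta> - 1\<rceil> = Suc k"
    unfolding k_def using assms(1) by (simp add: nat_eq_iff)
  have t: "times_differentiable (Suc k) g"
    using assms(2) unfolding holder_class_def k by (simp add: Let_def)
  obtain C where C: "C > 0" "\<And>\<nu> x y. length \<nu> = Suc k \<Longrightarrow> x \<in> cube \<Longrightarrow> y \<in> cube \<Longrightarrow>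
      \<bar>partials \<nu> g x - partials \<nu> g y\<bar> \<le> C * norm (x - y) powr (\<beta> - real (Suc k))"
    using assms(2) unfolding holder_class_def k by (auto simp: Let_def)
  show "g differentiable_on cube" using t by simp
  have "\<bar>partials \<nu> (partial i g) x - partials \<nu> (partial i g) y\<bar> \<le> C * norm (x - y) powr (\<beta> - 1 - real k)"
    if "length \<nu> = k" "x \<in> cube" "y \<in> cube" for \<nu> x y
    using C(2)[of "i # \<nu>" x y] that by (simp add: algebra_simps)
  then show "partial i g \<in> holder_class (\<beta> - 1)"
    using t C(1) unfolding holder_class_def k_def[symmetric] by (auto simp: Let_def)
qed

lemma holder_class_le_1:
  assumes "0 < \<beta>" "\<beta> \<le> 1" "g \<in> holder_class \<beta>"
  obtains C where "C \<ge> 0" "\<And>x y. x \<in> cube \<Longrightarrow> y \<in> cube \<Longrightarrow> \<bar>g x - g y\<bar> \<le> C * norm (x - y) powr \<beta>"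
proof -
  have k: "nat \<lceil>\<beta> - 1\<rceil> = 0" using assms by (simp add: ceiling_le_zero)
  obtain C where "C > 0" "\<And>x y. x \<in> cube \<Longrightarrow> y \<in> cube \<Longrightarrow> \<bar>g x - g y\<bar> \<le> C * norm (x - y) powr \<beta>"
    using assms(3) unfolding holder_class_def k by (auto simp: Let_def)
  then show ?thesis using that by (meson less_imp_le)
qed

lemma partial_has_derivative:
  assumes "g differentiable_on cube" "z \<in> cube"
  shows "(g has_derivative (\<lambda>v. \<Sum>i\<in>UNIV. v $ i * partial i g z)) (at z within cube)"
proof -
  let ?D = "frechet_derivative g (at z within cube)"
  have d: "(g has_derivative ?D) (at z within cube)"
    using assms by (simp add: differentiable_on_def frechet_derivative_works)
  then interpret bounded_linear ?D by (rule has_derivative_bounded_linear)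
  have "?D v = (\<Sum>i\<in>UNIV. v $ i * partial i g z)" for v
  proof -
    have "?D v = ?D (\<Sum>i\<in>UNIV. v $ i *s axis i 1)" by (simp add: basis_expansion)
    also have "\<dots> = (\<Sum>i\<in>UNIV. v $ i * partial i g z)"
      by (simp add: sum scaleR scalar_mult_eq_scaleR partial_def)
    finally show ?thesis .
  qed
  then have "?D = (\<lambda>v. \<Sum>i\<in>UNIV. v $ i * partial i g z)" by auto
  then show ?thesis using d by simp
qed

lemma holder_class_continuous:
  assumes "0 < \<beta>" "g \<in> holder_class \<beta>"
  shows "continuous_on cube g"
proof (cases "\<beta> \<le> 1")
  case True
  obtain C where C: "C \<ge> 0" "\<And>x y. x \<in> cube \<Longrightarrow> y \<in> cube \<Longrightarrow> \<bar>g x - g y\<bar> \<le> C * norm (x - y) powr \<beta>"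
    using holder_class_le_1[OF assms(1) True assms(2)] by blast
  show ?thesis
    unfolding continuous_on_def
  proof
    fix x :: "real ^ 'a" assume x: "x \<in> cube"
    have "((\<lambda>y. C * norm (y - x) powr \<beta>) \<longlongrightarrow> C * norm (x - x) powr \<beta>) (at x within cube)"
      using assms(1) by (intro tendsto_intros) auto
    then have "((\<lambda>y. C * norm (y - x) powr \<beta>) \<longlongrightarrow> 0) (at x within cube)" by simp
    moreover have "\<forall>\<^sub>F y in at x within cube. norm (g y - g x) \<le> C * norm (y - x) powr \<beta>"
      using C(2) x by (auto simp: eventually_at_filter)
    ultimately have "((\<lambda>y. g y - g x) \<longlongrightarrow> 0) (at x within cube)"
      by (rule Lim_null_comparison[rotated])
    then show "(g \<longlongrightarrow> g x) (at x within cube)" by (simp add: LIM_zero_iff)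
  qed
next
  case False
  then show ?thesis
    using holder_class_diff(1)[of \<beta> g] assms by (intro differentiable_imp_continuous_on) auto
qed

lemma continuous_on_cube_bounded:
  assumes "continuous_on cube (g :: real ^ 'd::finite \<Rightarrow> real)"
  obtains K where "K \<ge> 0" "\<And>z. z \<in> cube \<Longrightarrow> \<bar>g z\<bar> \<le> K"
proof -
  have "bounded (g ` cube)"
    by (intro compact_imp_bounded compact_continuous_image assms compact_cbox)
  then obtain K where "\<And>z. z \<in> cube \<Longrightarrow> \<bar>g z\<bar> \<le> K" by (auto simp: bounded_real)
  then show ?thesis using that[of "max 0 K"] by (meson max.cobounded1 max.coboundedI2)
qed

lemma linear_bound:
  fixes v :: "real ^ 'd::finite"
  assumes "\<And>i. \<bar>c i\<bar> \<le> K"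
  shows "\<bar>\<Sum>i\<in>UNIV. v $ i * c i\<bar> \<le> real CARD('d) * K * norm v"
proof -
  have "\<bar>\<Sum>i\<in>UNIV. v $ i * c i\<bar> \<le> (\<Sum>i\<in>(UNIV :: 'd set). \<bar>v $ i * c i\<bar>)" by (rule sum_abs)
  also have "\<dots> \<le> (\<Sum>i\<in>(UNIV :: 'd set). norm v * K)"
    unfolding abs_mult by (intro sum_mono mult_mono assms component_le_norm_cart) auto
  finally show ?thesis by (simp add: mult_ac)
qed

text \<open>Lets error terms of different orders in a bounded diameter be compared with the lowest
  order.\<close>

lemma powr_le_powr_bounded:
  fixes r :: real
  assumes "0 \<le> r" "r \<le> R" "1 \<le> R" "0 < a" "a \<le> b"
  shows "r powr b \<le> R powr b * r powr a"
proof (cases "r = 0")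
  case False
  have "r powr b = r powr (b - a) * r powr a"
    by (simp add: powr_add[symmetric])
  also have "r powr (b - a) \<le> R powr (b - a)"
    using assms by (intro powr_mono2) auto
  also have "R powr (b - a) \<le> R powr b"
    using assms by (intro powr_mono) auto
  finally show ?thesis by (simp add: mult_right_mono)
qed simp

lemma norm_diff_cube_le:
  fixes x y :: "real ^ 'd::finite"
  assumes "x \<in> cube" "y \<in> cube"
  shows "norm (x - y) \<le> real CARD('d)"
proof -
  have "norm (x - y) \<le> (\<Sum>i\<in>UNIV. \<bar>(x - y) $ i\<bar>)" by (rule norm_le_l1_cart)
  also have "\<dots> \<le> (\<Sum>i\<in>(UNIV :: 'd set). 1)"
  proof (rule sum_mono)
    fix i
    have "0 \<le> x $ i" "x $ i \<le> 1" "0 \<le> y $ i" "y $ i \<le> 1" using assms by (auto simp: mem_box_cart)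
    then show "\<bar>(x - y) $ i\<bar> \<le> 1" by simp
  qed
  finally show ?thesis by simp
qed

text \<open>For \<open>\<beta> > 1\<close> the first partial derivatives are continuous on the
  compact cube, hence bounded, and the mean value inequality on the convex cube gives a Lipschitz
  bound.\<close>

lemma holder_class_bound:
  fixes g :: "real ^ 'd::finite \<Rightarrow> real"
  assumes "0 < \<beta>" "g \<in> holder_class \<beta>"
  obtains C where "C \<ge> 0" "\<And>x y. x \<in> cube \<Longrightarrow> y \<in> cube \<Longrightarrow> \<bar>g x - g y\<bar> \<le> C * norm (x - y) powr min 1 \<beta>"
proof (cases "\<beta> \<le> 1")
  case True
  then show ?thesis using holder_class_le_1[OF assms(1) True assms(2)] that by (simp add: min_absorb2) blast
next
  case False
  then have b: "1 < \<beta>" by simp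
  have "\<exists>K\<ge>0. \<forall>z\<in>cube. \<bar>partial i g z\<bar> \<le> K" for i
  proof -
    have "continuous_on cube (partial i g)"
      using b by (intro holder_class_continuous[OF _ holder_class_diff(2)[OF b assms(2)]]) simp
    then show ?thesis by (meson continuous_on_cube_bounded)
  qed
  then obtain K where K: "\<And>i. K i \<ge> 0" "\<And>i z. z \<in> cube \<Longrightarrow> \<bar>partial i g z\<bar> \<le> K i" by metis
  define L where "L = (\<Sum>i\<in>UNIV. K i)"
  have KL: "K i \<le> L" for i unfolding L_def using K(1) by (intro member_le_sum) auto
  have L: "L \<ge> 0" unfolding L_def using K(1) by (intro sum_nonneg) auto
  have "\<bar>g x - g y\<bar> \<le> (real CARD('d) * L) * norm (x - y)" if "x \<in> cube" "y \<in> cube" for x y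
  proof -
    have "norm (g x - g y) \<le> (real CARD('d) * L) * norm (x - y)"
    proof (rule differentiable_bound[OF cube_convex])
      fix z :: "real ^ 'd" assume z: "z \<in> cube"
      show "(g has_derivative (\<lambda>v. \<Sum>i\<in>UNIV. v $ i * partial i g z)) (at z within cube)"
        by (rule partial_has_derivative[OF holder_class_diff(1)[OF b assms(2)] z])
      show "onorm (\<lambda>v. \<Sum>i\<in>UNIV. v $ i * partial i g z) \<le> real CARD('d) * L"
        using linear_bound[of "\<lambda>i. partial i g z" L, OF order_trans[OF K(2)[OF z] KL]] L
        by (intro onorm_bound) auto
    qed (use that in auto)
    then show ?thesis by simp
  qed
  then show ?thesis using that[of "real CARD('d) * L"] L b by (simp add: min_absorb1)
qed

text \<open>Mean value inequality for \<open>G\<close>, which up to a constant is \<open>g\<close>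
  minus its linearisation at \<open>x\<close>. Along the segment its derivative is an increment of
  the gradient, of order \<open>norm (z - x) powr ?\<gamma>\<close>, and the length of the segment
  adds 1 to the exponent, giving \<open>min 2 \<beta>\<close>.\<close>

lemma holder_class_taylor:
  fixes g :: "real ^ 'd::finite \<Rightarrow> real"
  assumes "1 < \<beta>" "g \<in> holder_class \<beta>" and x: "x \<in> cube"
  obtains C where "C \<ge> 0"
    "\<And>z. z \<in> cube \<Longrightarrow> \<bar>g z - g x - (\<Sum>i\<in>UNIV. (z $ i - x $ i) * partial i g x)\<bar> \<le> C * norm (z - x) powr min 2 \<beta>"
proof -
  let ?\<gamma> = "min 1 (\<beta> - 1)"
  have "\<exists>C\<ge>0. \<forall>z\<in>cube. \<forall>y\<in>cube. \<bar>partial i g z - partial i g y\<bar> \<le> C * norm (z - y) powr ?\<gamma>" for i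
  proof -
    have "0 < \<beta> - 1" using assms by simp
    from holder_class_bound[OF this holder_class_diff(2)[OF assms(1,2), of i]]
    show ?thesis by (metis (no_types))
  qed
  then obtain K where K: "\<And>i. K i \<ge> 0"
    "\<And>i z y. z \<in> cube \<Longrightarrow> y \<in> cube \<Longrightarrow> \<bar>partial i g z - partial i g y\<bar> \<le> K i * norm (z - y) powr ?\<gamma>" by metis
  define L where "L = (\<Sum>i\<in>UNIV. K i)"
  have KL: "K i \<le> L" for i unfolding L_def using K(1) by (intro member_le_sum) auto
  have L: "L \<ge> 0" unfolding L_def using K(1) by (intro sum_nonneg) auto
  have "\<bar>g z - g x - (\<Sum>i\<in>UNIV. (z $ i - x $ i) * partial i g x)\<bar> \<le> (real CARD('d) * L) * norm (z - x) powr min 2 \<beta>"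
    if z: "z \<in> cube" for z
  proof -
    let ?S = "closed_segment x z"
    let ?B = "real CARD('d) * (L * norm (z - x) powr ?\<gamma>)"
    have S: "?S \<subseteq> cube" using x z by (simp add: closed_segment_subset cube_convex)
    define G where "G w = g w - (\<Sum>i\<in>UNIV. w $ i * partial i g x)" for w
    have "norm (G z - G x) \<le> ?B * norm (z - x)"
    proof (rule differentiable_bound[OF convex_closed_segment])
      fix w assume w: "w \<in> ?S"
      then have wc: "w \<in> cube" using S by blast
      have "(g has_derivative (\<lambda>v. \<Sum>i\<in>UNIV. v $ i * partial i g w)) (at w within ?S)"
        by (rule has_derivative_subset[OF partial_has_derivative[OF holder_class_diff(1)[OF assms(1,2)] wc] S])
      moreover have "((\<lambda>w. \<Sum>i\<in>UNIV. w $ i * partial i g x) has_derivative (\<lambda>v. \<Sum>i\<in>UNIV. v $ i * partial i g x)) (at w within ?S)"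
        by (auto intro!: derivative_eq_intros bounded_linear.has_derivative[OF bounded_linear_vec_nth])
      ultimately have "(G has_derivative (\<lambda>v. (\<Sum>i\<in>UNIV. v $ i * partial i g w) - (\<Sum>i\<in>UNIV. v $ i * partial i g x))) (at w within ?S)"
        unfolding G_def by (rule has_derivative_diff)
      moreover have "(\<Sum>i\<in>UNIV. v $ i * partial i g w) - (\<Sum>i\<in>UNIV. v $ i * partial i g x) =
          (\<Sum>i\<in>UNIV. v $ i * (partial i g w - partial i g x))" for v :: "real ^ 'd"
        by (simp add: sum_subtractf right_diff_distrib)
      ultimately show "(G has_derivative (\<lambda>v. \<Sum>i\<in>UNIV. v $ i * (partial i g w - partial i g x))) (at w within ?S)"
        by simp
      have "\<bar>partial i g w - partial i g x\<bar> \<le> L * norm (z - x) powr ?\<gamma>" for i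
      proof -
        have "\<bar>partial i g w - partial i g x\<bar> \<le> K i * norm (w - x) powr ?\<gamma>" by (rule K(2)[OF wc x])
        also have "\<dots> \<le> L * norm (z - x) powr ?\<gamma>"
          using assms(1) KL L segment_bound(1)[OF w] by (intro mult_mono powr_mono2) auto
        finally show ?thesis .
      qed
      then show "onorm (\<lambda>v. \<Sum>i\<in>UNIV. v $ i * (partial i g w - partial i g x)) \<le> ?B"
        using linear_bound[of "\<lambda>i. partial i g w - partial i g x" "L * norm (z - x) powr ?\<gamma>"] L
        by (intro onorm_bound) auto
    qed auto
    also have "?B * norm (z - x) = (real CARD('d) * L) * norm (z - x) powr min 2 \<beta>"
    proof -
      have "norm (z - x) powr ?\<gamma> * norm (z - x) = norm (z - x) powr (?\<gamma> + 1)"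
        by (cases "z = x") (simp_all add: powr_add)
      moreover have "?\<gamma> + 1 = min 2 \<beta>" by (auto simp: min_def)
      ultimately show ?thesis by (simp add: mult.assoc)
    qed
    also have "G z - G x = g z - g x - (\<Sum>i\<in>UNIV. (z $ i - x $ i) * partial i g x)"
      by (simp add: G_def sum_subtractf left_diff_distrib)
    finally show ?thesis by simp
  qed
  then show ?thesis using that[of "real CARD('d) * L"] L by simp
qed

section \<open>Bias of a cell\<close>

text \<open>The reflection of z to a + b - z preserves Lebesgue measure and the box, and replaces
  the coordinate by \<open>a $ i + b $ i\<close> minus itself. So the integral of the coordinate is
  half of \<open>a $ i + b $ i\<close> times the volume.\<close>

lemma integral_cbox_coordinate:
  fixes a b :: "real ^ 'd::finite"
  assumes ab: "\<And>i. a $ i \<le> b $ i"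
  shows "integrable lborel (\<lambda>z. indicator (cbox a b) z * (z $ i - x $ i))"
    and "(\<integral>z. indicator (cbox a b) z * (z $ i - x $ i) \<partial>lborel) =
      measure lborel (cbox a b) * ((a $ i + b $ i) / 2 - x $ i)"
proof -
  have int: "integrable lborel (\<lambda>z. indicator (cbox a b) z * (z $ i - c))" for c :: real
  proof -
    have "set_integrable lborel (cbox a b) (\<lambda>z. z $ i - c)"
      unfolding set_integrable_def by (intro borel_integrable_compact compact_cbox continuous_intros)
    then show ?thesis by (simp add: set_integrable_def)
  qed
  then show "integrable lborel (\<lambda>z. indicator (cbox a b) z * (z $ i - x $ i))" .
  have ind: "integrable lborel (indicator (cbox a b) :: _ \<Rightarrow> real)"
    by (intro integrable_real_indicator emeasure_lborel_cbox_finite) simp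
  let ?J = "\<lambda>c. \<integral>z. indicator (cbox a b) z * (z $ i - c) \<partial>lborel"
  have refl: "(lborel :: (real ^ 'd) measure) = distr lborel borel (\<lambda>z. (a + b) + (- 1) *\<^sub>R z)"
    using lborel_affine[of "- 1" "a + b"] by (simp add: density_1)
  have "?J 0 = (\<integral>z. indicator (cbox a b) z * (z $ i) \<partial>distr lborel borel (\<lambda>z. (a + b) + (- 1) *\<^sub>R z))"
    using refl by simp
  also have "\<dots> = (\<integral>z. indicator (cbox a b) (a + b - z) * ((a + b - z) $ i) \<partial>lborel)"
    by (subst integral_distr) auto
  also have "\<dots> = (\<integral>z. (a $ i + b $ i) * indicator (cbox a b) z - indicator (cbox a b) z * (z $ i - 0) \<partial>lborel)"
  proof (intro Bochner_Integration.integral_cong refl)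
    fix z
    have "a + b - z \<in> cbox a b \<longleftrightarrow> z \<in> cbox a b"
      by (auto simp: mem_box_cart algebra_simps)
    then show "indicator (cbox a b) (a + b - z) * ((a + b - z) $ i) =
        (a $ i + b $ i) * indicator (cbox a b) z - indicator (cbox a b) z * (z $ i - 0)"
      by (auto simp: indicator_def)
  qed simp
  also have "\<dots> = (a $ i + b $ i) * measure lborel (cbox a b) - ?J 0"
    using int[of 0] ind by simp
  finally have J0: "?J 0 = measure lborel (cbox a b) * ((a $ i + b $ i) / 2)"
    by (simp add: mult.commute)
  have "(\<integral>z. indicator (cbox a b) z * (z $ i - x $ i) \<partial>lborel) =
      (\<integral>z. indicator (cbox a b) z * (z $ i - 0) - x $ i * indicator (cbox a b) z \<partial>lborel)"
    by (intro Bochner_Integration.integral_cong refl) (auto simp: indicator_def)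
  also have "\<dots> = ?J 0 - x $ i * measure lborel (cbox a b)"
    using int[of 0] ind by simp
  finally show "(\<integral>z. indicator (cbox a b) z * (z $ i - x $ i) \<partial>lborel) =
      measure lborel (cbox a b) * ((a $ i + b $ i) / 2 - x $ i)"
    unfolding J0 by (simp add: algebra_simps)
qed

lemma integrable_on_cbox:
  fixes g :: "real ^ 'd::finite \<Rightarrow> real"
  assumes "continuous_on cube g" "cbox a b \<subseteq> cube"
  shows "integrable lborel (\<lambda>z. indicator (cbox a b) z * g z)"
proof -
  have "set_integrable lborel (cbox a b) g"
    unfolding set_integrable_def
    using assms by (intro borel_integrable_compact compact_cbox continuous_on_subset[OF assms(1)])
  then show ?thesis by (simp add: set_integrable_def)
qed

text \<open>The second case rests on the value 0 of the Bochner integral of a function that is not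
  integrable.\<close>

lemma integral_cbox_abs_le:
  fixes g k :: "real ^ 'd::finite \<Rightarrow> real"
  assumes "integrable lborel (\<lambda>z. indicator (cbox a b) z * k z)"
    and "\<And>z. z \<in> cbox a b \<Longrightarrow> \<bar>g z\<bar> \<le> k z"
  shows "\<bar>\<integral>z. indicator (cbox a b) z * g z \<partial>lborel\<bar> \<le> (\<integral>z. indicator (cbox a b) z * k z \<partial>lborel)"
proof (cases "integrable lborel (\<lambda>z. indicator (cbox a b) z * g z)")
  case True
  then show ?thesis
    using assms by (intro integral_abs_bound_integral) (auto simp: indicator_def)
next
  case False
  have "0 \<le> indicator (cbox a b) z * k z" for z
    using assms(2)[of z] by (auto simp: indicator_def)
  then have "0 \<le> (\<integral>z. indicator (cbox a b) z * k z \<partial>lborel)" by (rule Bochner_Integration.integral_nonneg)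
  then show ?thesis using False by (simp add: not_integrable_integral_eq)
qed

lemma norm_diff_le_diameter:
  fixes x z :: "real ^ 'd::finite"
  assumes "z \<in> cbox a b" "x \<in> cbox a b"
  shows "norm (z - x) \<le> norm (b - a)"
proof (rule norm_le_componentwise_cart)
  fix i
  have "a $ i \<le> z $ i" "z $ i \<le> b $ i" "a $ i \<le> x $ i" "x $ i \<le> b $ i"
    using assms by (auto simp: mem_box_cart)
  then show "norm ((z - x) $ i) \<le> norm ((b - a) $ i)" by simp
qed

text \<open>Split \<mu> - \<mu>(x) into its linear part, with \<open>G\<close> the gradient at
  \<open>x\<close>, and a remainder, and split f into f(x) and f - f(x). Against the constant f(x)
  the linear part averages to its value at the centre of the box. Against f - f(x) it is of order
  one plus \<open>min 1 \<beta>f\<close> in the diameter, and the remainder of order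
  \<open>min 2 \<beta>\<mu>\<close>; by the choice of \<beta> neither exponent is below
  \<open>min 2 \<beta>\<close>.\<close>

lemma cell_bias:
  fixes \<mu> f :: "real ^ 'd::finite \<Rightarrow> real"
  assumes \<beta>\<mu>: "0 < \<beta>\<mu>" "\<mu> \<in> holder_class \<beta>\<mu>" and \<beta>f: "0 < \<beta>f" "f \<in> holder_class \<beta>f"
    and c: "0 < c" "\<And>z. z \<in> cube \<Longrightarrow> c \<le> f z" and x: "x \<in> cube"
    and \<beta>: "\<beta> = min \<beta>\<mu> (\<beta>f + 1)"
  obtains C G where "C \<ge> 0"
    "\<And>a b. cbox a b \<subseteq> cube \<Longrightarrow> x \<in> box a b \<Longrightarrow>
       c * measure lborel (cbox a b) \<le> (\<integral>z. indicator (cbox a b) z * f z \<partial>lborel)"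
    "\<And>a b. cbox a b \<subseteq> cube \<Longrightarrow> x \<in> box a b \<Longrightarrow>
       \<bar>(\<integral>z. indicator (cbox a b) z * ((\<mu> z - \<mu> x) * f z) \<partial>lborel) / (\<integral>z. indicator (cbox a b) z * f z \<partial>lborel)\<bar>
         \<le> C * norm (b - a) powr min 1 \<beta>"
    "\<And>a b. 1 < \<beta> \<Longrightarrow> cbox a b \<subseteq> cube \<Longrightarrow> x \<in> box a b \<Longrightarrow>
       \<bar>(\<integral>z. indicator (cbox a b) z * ((\<mu> z - \<mu> x) * f z) \<partial>lborel) / (\<integral>z. indicator (cbox a b) z * f z \<partial>lborel)
          - (\<Sum>i\<in>UNIV. ((a $ i + b $ i) / 2 - x $ i) * G i)\<bar>
         \<le> C * norm (b - a) powr min 2 \<beta>"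
proof -
  have fc: "continuous_on cube f" by (rule holder_class_continuous[OF \<beta>f])
  have \<mu>c: "continuous_on cube \<mu>" by (rule holder_class_continuous[OF \<beta>\<mu>])
  obtain C1 where C1: "C1 \<ge> 0" "\<And>x y. x \<in> cube \<Longrightarrow> y \<in> cube \<Longrightarrow> \<bar>\<mu> x - \<mu> y\<bar> \<le> C1 * norm (x - y) powr min 1 \<beta>\<mu>"
    using holder_class_bound[OF \<beta>\<mu>] by blast
  obtain C2 where C2: "C2 \<ge> 0" "\<And>x y. x \<in> cube \<Longrightarrow> y \<in> cube \<Longrightarrow> \<bar>f x - f y\<bar> \<le> C2 * norm (x - y) powr min 1 \<beta>f"
    using holder_class_bound[OF \<beta>f] by blast
  \<comment> \<open>\<open>\<beta>f + 1\<close> exceeds 1, so after capping at 1 only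
    \<open>\<beta>\<mu>\<close> counts.\<close>
  have m1: "min 1 \<beta>\<mu> = min 1 \<beta>" using \<beta>f(1) by (auto simp: \<beta> min_def)
  let ?w = "\<lambda>a b g. \<integral>z. indicator (cbox a b) z * g z \<partial>(lborel :: (real ^ 'd) measure)"
  have fpos: "0 < f z" if "z \<in> cube" for z using c(1) c(2)[OF that] by linarith
  have vol: "0 < measure lborel (cbox a b)" if "x \<in> box a b" for a b :: "real ^ 'd"
  proof -
    have "a $ i < b $ i" for i
      using that by (meson less_trans mem_box_cart(1))
    then show ?thesis
      by (auto simp: content_pos_lt_eq Basis_vec_def inner_axis)
  qed
  have ind: "integrable lborel (indicator (cbox a b) :: real ^ 'd \<Rightarrow> real)" for a b
    by (intro integrable_real_indicator emeasure_lborel_cbox_finite) simp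
  have q: "c * measure lborel (cbox a b) \<le> ?w a b f" if "cbox a b \<subseteq> cube" for a b
  proof -
    have "c * measure lborel (cbox a b) = (\<integral>z. c * indicator (cbox a b) z \<partial>lborel)" by simp
    also have "\<dots> \<le> ?w a b f"
    proof (rule integral_mono)
      show "integrable lborel (\<lambda>z. c * indicator (cbox a b) z)"
        by (intro integrable_mult_right ind)
    qed (use integrable_on_cbox[OF fc that] c that in \<open>auto simp: indicator_def\<close>)
    finally show ?thesis .
  qed
  have qpos: "0 < ?w a b f" if "cbox a b \<subseteq> cube" "x \<in> box a b" for a b
    using q[OF that(1)] vol[OF that(2)] c(1) by (meson less_le_trans mult_pos_pos)
  have avg: "\<bar>?w a b (\<lambda>z. g z * f z) / ?w a b f\<bar> \<le> K"
    if ab: "cbox a b \<subseteq> cube" "x \<in> box a b" and g: "\<And>z. z \<in> cbox a b \<Longrightarrow> \<bar>g z\<bar> \<le> K" for a b g K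
  proof -
    have "\<bar>?w a b (\<lambda>z. g z * f z)\<bar> \<le> ?w a b (\<lambda>z. K * f z)"
    proof (rule integral_cbox_abs_le)
      show "integrable lborel (\<lambda>z. indicator (cbox a b) z * (K * f z))"
        using integrable_on_cbox[OF fc ab(1)] by (simp add: mult.left_commute)
      show "\<bar>g z * f z\<bar> \<le> K * f z" if "z \<in> cbox a b" for z
        using g[OF that] fpos[of z] that ab by (auto simp: abs_mult intro!: mult_right_mono)
    qed
    also have "\<dots> = K * ?w a b f" by (simp add: mult.left_commute)
    finally show ?thesis using qpos[OF ab] by (simp add: abs_divide pos_divide_le_eq)
  qed
  \<comment> \<open>For an integrand without the weight \<open>f\<close>, comparison with the mass
    of the box costs the factor \<open>1 / c\<close>.\<close>
  have avg_vol: "\<bar>?w a b g / ?w a b f\<bar> \<le> K / c"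
    if ab: "cbox a b \<subseteq> cube" "x \<in> box a b" and K: "0 \<le> K" and g: "\<And>z. z \<in> cbox a b \<Longrightarrow> \<bar>g z\<bar> \<le> K" for a b g K
  proof -
    have "\<bar>?w a b g\<bar> \<le> ?w a b (\<lambda>z. K)"
      using ind by (intro integral_cbox_abs_le g) auto
    also have "\<dots> = K / c * (c * measure lborel (cbox a b))" using c(1) by simp
    also have "\<dots> \<le> K / c * ?w a b f"
      using q[OF ab(1)] K c(1) by (intro mult_left_mono) auto
    finally show ?thesis using qpos[OF ab] by (simp add: abs_divide pos_divide_le_eq)
  qed
  have near: "norm (z - x) \<le> norm (b - a)" if "z \<in> cbox a b" "x \<in> box a b" for a b z :: "real ^ 'd"
    using that box_subset_cbox[of a b] by (intro norm_diff_le_diameter) auto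
  have first: "\<bar>?w a b (\<lambda>z. (\<mu> z - \<mu> x) * f z) / ?w a b f\<bar> \<le> C1 * norm (b - a) powr min 1 \<beta>"
    if ab: "cbox a b \<subseteq> cube" "x \<in> box a b" for a b
  proof (rule avg[OF ab])
    fix z assume z: "z \<in> cbox a b"
    have "\<bar>\<mu> z - \<mu> x\<bar> \<le> C1 * norm (z - x) powr min 1 \<beta>"
      using C1(2)[of z x] z ab x by (auto simp: m1)
    also have "\<dots> \<le> C1 * norm (b - a) powr min 1 \<beta>"
      using C1(1) near[OF z ab(2)] \<beta>\<mu>(1) \<beta>f(1) by (intro mult_left_mono powr_mono2) (auto simp: \<beta>)
    finally show "\<bar>\<mu> z - \<mu> x\<bar> \<le> C1 * norm (b - a) powr min 1 \<beta>" .
  qed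
  show thesis
  proof (cases "1 < \<beta>")
    case False
    \<comment> \<open>The claim about the centre is void here, so any \<open>G\<close> will
      do.\<close>
    show ?thesis
      by (rule that[of C1 "\<lambda>_. 0"]) (use C1(1) q first False in auto)
  next
    case True
    then have b1: "1 < \<beta>\<mu>" by (simp add: \<beta>)
    define G where "G i = partial i \<mu> x" for i
    obtain C3 where C3: "C3 \<ge> 0" "\<And>z. z \<in> cube \<Longrightarrow>
        \<bar>\<mu> z - \<mu> x - (\<Sum>i\<in>UNIV. (z $ i - x $ i) * G i)\<bar> \<le> C3 * norm (z - x) powr min 2 \<beta>\<mu>"
      using holder_class_taylor[OF b1 \<beta>\<mu>(2) x] unfolding G_def by blast
    define K where "K = real CARD('d) * (\<Sum>i\<in>UNIV. \<bar>G i\<bar>)"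
    have K0: "K \<ge> 0" unfolding K_def by (simp add: sum_nonneg)
    have lin: "\<bar>\<Sum>i\<in>UNIV. v $ i * G i\<bar> \<le> K * norm v" for v
      unfolding K_def by (rule linear_bound) (auto intro!: member_le_sum)
    define R where "R = real CARD('d)"
    have R: "1 \<le> R" unfolding R_def by (simp add: Suc_le_eq)
    \<comment> \<open>\<open>R\<close> bounds the diameter of the cube, and \<open>R powr 2\<close>
      pays for lowering all exponents to \<open>min 2 \<beta>\<close>. The factor 2 counts the
      variation of \<open>f\<close> once in the numerator and once in the denominator.\<close>
    define C where "C = C1 + (C3 + 2 * (K * C2 / c)) * (R powr 2)"
    have C: "C \<ge> 0" "C1 \<le> C" unfolding C_def using C1 C2 C3 K0 c by auto
    have second: "\<bar>?w a b (\<lambda>z. (\<mu> z - \<mu> x) * f z) / ?w a b f - (\<Sum>i\<in>UNIV. ((a $ i + b $ i) / 2 - x $ i) * G i)\<bar>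
         \<le> C * norm (b - a) powr min 2 \<beta>"
      if ab: "cbox a b \<subseteq> cube" "x \<in> box a b" for a b
    proof -
      let ?r = "norm (b - a)" and ?q = "?w a b f" and ?m = "measure lborel (cbox a b)"
      let ?lin = "\<lambda>z :: real ^ 'd. \<Sum>i\<in>UNIV. (z $ i - x $ i) * G i"
      let ?cen = "\<Sum>i\<in>UNIV. ((a $ i + b $ i) / 2 - x $ i) * G i"
      have le: "a $ i \<le> b $ i" for i
        using ab(2) by (meson less_imp_le less_trans mem_box_cart(1))
      have xab: "x \<in> cbox a b" using ab(2) box_subset_cbox by blast
      have abc: "a \<in> cube" "b \<in> cube" using ab(1) le by (auto simp: mem_box_cart subset_iff)
      have rR: "?r \<le> R" unfolding R_def by (rule norm_diff_cube_le[OF abc(2,1)])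
      have lin_int: "?w a b ?lin = ?m * ?cen"
      proof -
        have "?w a b ?lin = (\<integral>z. (\<Sum>i\<in>UNIV. (indicator (cbox a b) z * (z $ i - x $ i)) * G i) \<partial>lborel)"
          by (intro Bochner_Integration.integral_cong refl) (simp add: sum_distrib_left mult.assoc)
        also have "\<dots> = (\<Sum>i\<in>UNIV. ?m * ((a $ i + b $ i) / 2 - x $ i) * G i)"
          using integral_cbox_coordinate[OF le] by (subst Bochner_Integration.integral_sum) auto
        finally show ?thesis by (simp add: sum_distrib_left mult.assoc)
      qed
      have linc: "continuous_on cube ?lin"
        by (intro continuous_intros)
      have lin_le: "\<bar>?lin z\<bar> \<le> K * ?r" if "z \<in> cbox a b" for z
      proof -
        have "\<bar>?lin z\<bar> \<le> K * norm (z - x)" using lin[of "z - x"] by simp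
        also have "\<dots> \<le> K * ?r" using near[OF that ab(2)] K0 by (intro mult_left_mono)
        finally show ?thesis .
      qed
      have cen_le: "\<bar>?cen\<bar> \<le> K * ?r"
      proof -
        have "(\<chi> i. (a $ i + b $ i) / 2) \<in> cbox a b"
          using le by (simp add: mem_box_cart)
        from lin_le[OF this] show ?thesis by simp
      qed
      have df: "\<bar>f z - f x\<bar> \<le> C2 * ?r powr min 1 \<beta>f" if "z \<in> cbox a b" for z
      proof -
        have "\<bar>f z - f x\<bar> \<le> C2 * norm (z - x) powr min 1 \<beta>f"
          using C2(2) that ab x by blast
        also have "\<dots> \<le> C2 * ?r powr min 1 \<beta>f"
          using C2(1) near[OF that ab(2)] \<beta>f(1) by (intro mult_left_mono powr_mono2) auto
        finally show ?thesis .
      qed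
      let ?e = "\<lambda>z. \<mu> z - \<mu> x - ?lin z"
      have ec: "continuous_on cube ?e" by (intro continuous_intros \<mu>c linc)
      have i1: "integrable lborel (\<lambda>z. indicator (cbox a b) z * (?e z * f z))"
        by (intro integrable_on_cbox ab continuous_intros ec fc)
      have i2: "integrable lborel (\<lambda>z. indicator (cbox a b) z * (?lin z * (f z - f x)))"
        by (intro integrable_on_cbox ab continuous_intros linc fc)
      have i3: "integrable lborel (\<lambda>z. indicator (cbox a b) z * ?lin z)"
        by (intro integrable_on_cbox ab linc)
      have i4: "integrable lborel (\<lambda>z. indicator (cbox a b) z * (f z - f x))"
        by (intro integrable_on_cbox ab continuous_intros fc)
      have "?w a b (\<lambda>z. (\<mu> z - \<mu> x) * f z) = (\<integral>z. indicator (cbox a b) z * (?e z * f z) +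
          indicator (cbox a b) z * (?lin z * (f z - f x)) + f x * (indicator (cbox a b) z * ?lin z) \<partial>lborel)"
        by (intro Bochner_Integration.integral_cong refl) (simp add: algebra_simps)
      also have "\<dots> = ?w a b (\<lambda>z. ?e z * f z) + ?w a b (\<lambda>z. ?lin z * (f z - f x)) + f x * (?m * ?cen)"
        unfolding lin_int[symmetric] using i1 i2 i3 by simp
      finally have num: "?w a b (\<lambda>z. (\<mu> z - \<mu> x) * f z) =
          ?w a b (\<lambda>z. ?e z * f z) + ?w a b (\<lambda>z. ?lin z * (f z - f x)) + f x * (?m * ?cen)" .
      have "?q = (\<integral>z. indicator (cbox a b) z * (f z - f x) + f x * indicator (cbox a b) z \<partial>lborel)"
        by (intro Bochner_Integration.integral_cong refl) (simp add: algebra_simps)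
      also have "\<dots> = ?w a b (\<lambda>z. f z - f x) + f x * ?m"
        using i4 ind by simp
      \<comment> \<open>So \<open>f x * ?m / ?q\<close>, the factor in front of \<open>?cen\<close>,
        is 1 up to a relative error controlled by the variation of \<open>f\<close>.\<close>
      finally have den: "f x * ?m = ?q - ?w a b (\<lambda>z. f z - f x)" by simp
      have q0: "?q \<noteq> 0" using qpos[OF ab] by simp
      have dec: "?w a b (\<lambda>z. (\<mu> z - \<mu> x) * f z) / ?q - ?cen =
          ?w a b (\<lambda>z. ?e z * f z) / ?q + ?w a b (\<lambda>z. ?lin z * (f z - f x)) / ?q - (?w a b (\<lambda>z. f z - f x) / ?q) * ?cen"
      proof -
        have "f x * (?m * ?cen) = (?q - ?w a b (\<lambda>z. f z - f x)) * ?cen"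
          unfolding den[symmetric] by simp
        then have "?w a b (\<lambda>z. (\<mu> z - \<mu> x) * f z) / ?q =
            (?w a b (\<lambda>z. ?e z * f z) + ?w a b (\<lambda>z. ?lin z * (f z - f x)) + (?q - ?w a b (\<lambda>z. f z - f x)) * ?cen) / ?q"
          using num by simp
        moreover have "(e + s + (q - t) * v) / q - v = e / q + s / q - t / q * v" if "q \<noteq> 0" for e s q t v :: real
          using that by (simp add: field_simps)
        ultimately show ?thesis using q0 by simp
      qed
      have "\<bar>?w a b (\<lambda>z. (\<mu> z - \<mu> x) * f z) / ?q - ?cen\<bar> \<le> \<bar>?w a b (\<lambda>z. ?e z * f z) / ?q\<bar> + \<bar>?w a b (\<lambda>z. ?lin z * (f z - f x)) / ?q\<bar> +
          \<bar>?w a b (\<lambda>z. f z - f x) / ?q\<bar> * \<bar>?cen\<bar>"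
      proof -
        have tri: "\<bar>e + s - t * v\<bar> \<le> \<bar>e\<bar> + \<bar>s\<bar> + \<bar>t\<bar> * \<bar>v\<bar>" for e s t v :: real
          using abs_mult[of t v] by linarith
        show ?thesis unfolding dec by (rule tri)
      qed
      also have "\<dots> \<le> C3 * ?r powr min 2 \<beta>\<mu> + (K * ?r * (C2 * ?r powr min 1 \<beta>f)) / c + (C2 * ?r powr min 1 \<beta>f) / c * (K * ?r)"
      proof -
        have "\<bar>?w a b (\<lambda>z. ?e z * f z) / ?q\<bar> \<le> C3 * ?r powr min 2 \<beta>\<mu>"
        proof (rule avg[OF ab])
          fix z assume z: "z \<in> cbox a b"
          have "\<bar>?e z\<bar> \<le> C3 * norm (z - x) powr min 2 \<beta>\<mu>" using C3(2) z ab by blast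
          also have "\<dots> \<le> C3 * ?r powr min 2 \<beta>\<mu>"
            using C3(1) near[OF z ab(2)] \<beta>\<mu>(1) by (intro mult_left_mono powr_mono2) auto
          finally show "\<bar>?e z\<bar> \<le> C3 * ?r powr min 2 \<beta>\<mu>" .
        qed
        moreover have "\<bar>?w a b (\<lambda>z. ?lin z * (f z - f x)) / ?q\<bar> \<le> (K * ?r * (C2 * ?r powr min 1 \<beta>f)) / c"
        proof (rule avg_vol[OF ab])
          fix z assume z: "z \<in> cbox a b"
          show "\<bar>?lin z * (f z - f x)\<bar> \<le> K * ?r * (C2 * ?r powr min 1 \<beta>f)"
            unfolding abs_mult using lin_le[OF z] df[OF z] K0 by (intro mult_mono) auto
        qed (use C2(1) K0 in auto)
        moreover have "\<bar>?w a b (\<lambda>z. f z - f x) / ?q\<bar> \<le> (C2 * ?r powr min 1 \<beta>f) / c"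
          by (rule avg_vol[OF ab]) (use df C2(1) in auto)
        then have "\<bar>?w a b (\<lambda>z. f z - f x) / ?q\<bar> * \<bar>?cen\<bar> \<le> (C2 * ?r powr min 1 \<beta>f) / c * (K * ?r)"
          using cen_le C2(1) c(1) by (intro mult_mono) auto
        ultimately show ?thesis by linarith
      qed
      also have "\<dots> = C3 * ?r powr min 2 \<beta>\<mu> + 2 * (K * C2 / c) * (?r powr min 1 \<beta>f * ?r)"
        by (simp add: field_simps)
      also have "?r powr min 1 \<beta>f * ?r = ?r powr (min 1 \<beta>f + 1)"
        by (cases "?r = 0") (simp_all add: powr_add)
      also have "C3 * ?r powr min 2 \<beta>\<mu> + 2 * (K * C2 / c) * ?r powr (min 1 \<beta>f + 1) \<le>
          C3 * (R powr 2 * ?r powr min 2 \<beta>) + 2 * (K * C2 / c) * (R powr 2 * ?r powr min 2 \<beta>)"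
      proof -
        have "?r powr s \<le> R powr 2 * ?r powr min 2 \<beta>" if "min 2 \<beta> \<le> s" "s \<le> 2" for s
        proof -
          have "?r powr s \<le> R powr s * ?r powr min 2 \<beta>"
            using rR R True that by (intro powr_le_powr_bounded) auto
          also have "\<dots> \<le> R powr 2 * ?r powr min 2 \<beta>"
            using R that by (intro mult_right_mono powr_mono) auto
          finally show ?thesis .
        qed
        then show ?thesis
          using C2(1) C3(1) K0 c(1) by (intro add_mono mult_left_mono) (auto simp: \<beta>)
      qed
      also have "\<dots> = ((C3 + 2 * (K * C2 / c)) * R powr 2) * ?r powr min 2 \<beta>"
        by (simp add: algebra_simps)
      also have "\<dots> \<le> C * ?r powr min 2 \<beta>"
        using C1(1) by (intro mult_right_mono) (auto simp: C_def)
      finally show ?thesis .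
    qed
    show ?thesis
    proof (rule that[of C G])
      fix a b assume ab: "cbox a b \<subseteq> cube" "x \<in> box a b"
      show "\<bar>?w a b (\<lambda>z. (\<mu> z - \<mu> x) * f z) / ?w a b f\<bar> \<le> C * norm (b - a) powr min 1 \<beta>"
        using first[OF ab] C(2) by (meson mult_right_mono order_trans powr_ge_zero)
    qed (use C(1) q second in auto)
  qed
qed

section \<open>The forest\<close>

lemma borel_measurable_cube_indicator:
  fixes g :: "real ^ 'd::finite \<Rightarrow> real"
  shows "continuous_on cube g \<Longrightarrow> (\<lambda>z. indicator cube z * g z) \<in> borel_measurable borel"
  using borel_measurable_continuous_on_indicator[of cube g] by simp

text \<open>The risk bound uses the law only through its mass and the first two moments of the
  response on cylinders over Borel sets of positions. Indicators of such cylinders are measurable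
  with respect to \<open>given_X P\<close>, so the conditional expectations can be integrated
  against them; the density \<open>f\<close> then turns mass and first moment into Lebesgue
  integrals.\<close>

lemma data_law_facts:
  fixes f \<mu> \<sigma>2 :: "real ^ 'd::finite \<Rightarrow> real"
  assumes law: "data_law f \<mu> \<sigma>2 \<beta>f \<beta>\<mu> \<beta>\<sigma> P"
  obtains C where "C \<ge> 0" "prob_space P" "fst \<in> borel_measurable P" "snd \<in> borel_measurable P"
    "integrable P (\<lambda>z. (snd z)\<^sup>2)"
    "\<And>A. A \<in> sets borel \<Longrightarrow> (\<integral>z. (snd z)\<^sup>2 * indicator {z. fst z \<in> A} z \<partial>P) \<le> C * measure P {z. fst z \<in> A}"
    "\<And>A. A \<in> sets borel \<Longrightarrow> measure P {z. fst z \<in> A} = (\<integral>z. indicator A z * (indicator cube z * f z) \<partial>lborel)"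
    "\<And>A. A \<in> sets borel \<Longrightarrow> (\<integral>z. snd z * indicator {z. fst z \<in> A} z \<partial>P) =
       (\<integral>z. indicator A z * (indicator cube z * (\<mu> z * f z)) \<partial>lborel)"
proof -
  note law = law[unfolded data_law_def]
  have P: "prob_space P" and sP: "sets P = sets borel"
    and dist: "distributed P lborel fst (\<lambda>x. ennreal (indicator cube x * f x))"
    and Y2: "\<exists>C. AE z in P. nn_cond_exp P (given_X P) (\<lambda>z. ennreal ((snd z)\<^sup>2)) z \<le> ennreal C"
    and Y1: "AE z in P. real_cond_exp P (given_X P) snd z = \<mu> (fst z)"
    and \<mu>: "\<beta>\<mu> > 0" "\<mu> \<in> holder_class \<beta>\<mu>" and f: "\<beta>f > 0" "f \<in> holder_class \<beta>f"
    using law by blast+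
  obtain c where c: "c > 0" "\<And>z. z \<in> cube \<Longrightarrow> c \<le> f z" using law by blast
  have f0: "0 \<le> indicator cube z * f z" for z
    using c(1) c(2)[of z] by (cases "z \<in> cube") auto
  interpret P: prob_space P by (rule P)
  have spP: "space P = UNIV" using sets_eq_imp_space_eq[OF sP] by simp
  have fst [measurable]: "fst \<in> borel_measurable P" and snd [measurable]: "snd \<in> borel_measurable P"
    using sP by (simp_all add: borel_prod[symmetric] cong: measurable_cong_sets)
  let ?F = "given_X P"
  have spF: "space ?F = UNIV" by (simp add: given_X_def spP)
  have sub: "subalgebra P ?F"
    unfolding subalgebra_def
  proof
    show "space ?F = space P" by (simp add: spF spP)
    have "{fst -` A \<inter> space P |A. A \<in> sets borel} \<subseteq> sets P" using measurable_sets[OF fst] by blast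
    then show "sets ?F \<subseteq> sets P"
      unfolding given_X_def sets_vimage_algebra by (rule sets.sigma_sets_subset)
  qed
  interpret F: sigma_finite_subalgebra P ?F
    by (intro finite_measure_subalgebra_is_sigma_finite finite_measure_subalgebra.intro
        finite_measure_subalgebra_axioms.intro sub P.finite_measure_axioms)
  have fstF: "fst \<in> measurable ?F borel"
    unfolding given_X_def by (rule measurable_vimage_algebra1) simp
  have indF: "(\<lambda>z. indicator A (fst z)) \<in> borel_measurable ?F" if "A \<in> sets borel" for A :: "(real ^ 'd) set"
    using that by (intro measurable_compose[OF fstF]) auto
  have cyl: "{z. fst z \<in> A} \<in> sets P" if "A \<in> sets borel" for A
    using measurable_sets[OF fst that] by (simp add: spP vimage_def)
  have ind: "indicator {z. fst z \<in> A} z = indicator A (fst z)" for A and z :: "(real ^ 'd) \<times> real"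
    by (simp add: indicator_def)
  obtain C0 where C0: "AE z in P. nn_cond_exp P ?F (\<lambda>z. ennreal ((snd z)\<^sup>2)) z \<le> ennreal C0" using Y2 by blast
  define C where "C = max 0 C0"
  have C: "C \<ge> 0" "AE z in P. nn_cond_exp P ?F (\<lambda>z. ennreal ((snd z)\<^sup>2)) z \<le> ennreal C"
    using C0 by (auto simp: C_def elim!: eventually_mono intro: order_trans ennreal_leI)
  have nn: "(\<integral>\<^sup>+z. indicator A (fst z) * ennreal ((snd z)\<^sup>2) \<partial>P) \<le> ennreal (C * measure P {z. fst z \<in> A})"
    if A: "A \<in> sets borel" for A
  proof -
    have "(\<integral>\<^sup>+z. indicator A (fst z) * ennreal ((snd z)\<^sup>2) \<partial>P) =
        (\<integral>\<^sup>+z. indicator A (fst z) * nn_cond_exp P ?F (\<lambda>z. ennreal ((snd z)\<^sup>2)) z \<partial>P)"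
      using indF[OF A] A by (intro F.nn_cond_exp_intg[symmetric]) (auto intro: measurable_compose[OF fstF])
    also have "\<dots> \<le> (\<integral>\<^sup>+z. ennreal C * indicator {z. fst z \<in> A} z \<partial>P)"
      using C(2) by (intro nn_integral_mono_AE, eventually_elim) (auto simp: indicator_def)
    also have "\<dots> = ennreal (C * measure P {z. fst z \<in> A})"
      using C(1) cyl[OF A] by (simp add: nn_integral_cmult P.emeasure_eq_measure ennreal_mult)
    finally show ?thesis .
  qed
  have int2: "integrable P (\<lambda>z. (snd z)\<^sup>2)"
  proof (rule integrableI_bounded)
    have "(\<integral>\<^sup>+z. ennreal (norm ((snd z)\<^sup>2)) \<partial>P) = (\<integral>\<^sup>+z. indicator UNIV (fst z) * ennreal ((snd z)\<^sup>2) \<partial>P)"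
      by simp
    also have "\<dots> \<le> ennreal (C * measure P {z. fst z \<in> UNIV})" by (rule nn) simp
    also have "\<dots> < \<infinity>" by simp
    finally show "(\<integral>\<^sup>+z. ennreal (norm ((snd z)\<^sup>2)) \<partial>P) < \<infinity>" .
  qed measurable
  have int1: "integrable P snd" by (rule P.square_integrable_imp_integrable[OF snd int2])
  have density: "(\<integral>z. (indicator cube z * f z) * g z \<partial>lborel) = (\<integral>z. g (fst z) \<partial>P)"
    if "g \<in> borel_measurable borel" for g
    using that by (intro distributed_integral[OF dist]) (auto simp: f0)
  have "AE z in P. fst z \<in> cube"
  proof -
    have "emeasure P (fst -` (- cube) \<inter> space P) = (\<integral>\<^sup>+z. ennreal (indicator cube z * f z) * indicator (- cube) z \<partial>lborel)"
      by (rule distributed_emeasure[OF dist]) simp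
    also have "\<dots> = (\<integral>\<^sup>+z. 0 \<partial>(lborel :: (real ^ 'd) measure))"
      by (intro nn_integral_cong) (auto simp: indicator_def)
    also have "\<dots> = 0" by simp
    finally have "fst -` (- cube) \<inter> space P \<in> null_sets P"
      using measurable_sets[OF fst, of "- cube"] by auto
    then show ?thesis by (rule AE_I') auto
  qed
  \<comment> \<open>\<open>\<mu>\<close> may fail to be measurable outside the cube, whereas its
    product with the indicator is Borel because \<open>\<mu>\<close> is continuous on the
    cube.\<close>
  then have Y1': "AE z in P. real_cond_exp P ?F snd z = indicator cube (fst z) * \<mu> (fst z)"
    using Y1 by eventually_elim simp
  have \<mu>m: "(\<lambda>z. indicator cube z * \<mu> z) \<in> borel_measurable borel"
    by (rule borel_measurable_cube_indicator[OF holder_class_continuous[OF \<mu>]])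
  show thesis
  proof (rule that[OF C(1) P fst snd int2])
    fix A :: "(real ^ 'd) set" assume A [measurable]: "A \<in> sets borel"
    have i: "integrable P (\<lambda>z. indicator A (fst z) * (snd z)\<^sup>2)"
    proof -
      have "integrable P (\<lambda>z. (snd z)\<^sup>2 * indicator {z. fst z \<in> A} z)"
        by (rule integrable_real_mult_indicator[OF cyl[OF A] int2])
      then show ?thesis by (simp add: ind mult.commute)
    qed
    have "ennreal (\<integral>z. indicator A (fst z) * (snd z)\<^sup>2 \<partial>P) = (\<integral>\<^sup>+z. ennreal (indicator A (fst z) * (snd z)\<^sup>2) \<partial>P)"
      by (rule nn_integral_eq_integral[OF i, symmetric]) simp
    also have "\<dots> = (\<integral>\<^sup>+z. indicator A (fst z) * ennreal ((snd z)\<^sup>2) \<partial>P)"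
      by (intro nn_integral_cong) (simp add: indicator_def)
    finally have "ennreal (\<integral>z. indicator A (fst z) * (snd z)\<^sup>2 \<partial>P) \<le> ennreal (C * measure P {z. fst z \<in> A})"
      using nn[OF A] by simp
    then show "(\<integral>z. (snd z)\<^sup>2 * indicator {z. fst z \<in> A} z \<partial>P) \<le> C * measure P {z. fst z \<in> A}"
      using C(1) by (simp add: ind mult.commute)
    have "measure P {z. fst z \<in> A} = (\<integral>z. indicator {z. fst z \<in> A} z \<partial>P)"
      using cyl[OF A] by simp
    also have "\<dots> = (\<integral>z. indicator A (fst z) \<partial>P)" by (simp add: ind)
    also have "\<dots> = (\<integral>z. (indicator cube z * f z) * indicator A z \<partial>lborel)"
      by (rule density[symmetric]) measurable
    finally show "measure P {z. fst z \<in> A} = (\<integral>z. indicator A z * (indicator cube z * f z) \<partial>lborel)"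
      by (simp add: mult.commute)
    have "integrable P (\<lambda>z. snd z * indicator {z. fst z \<in> A} z)"
      by (rule integrable_real_mult_indicator[OF cyl[OF A] int1])
    then have i1: "integrable P (\<lambda>z. indicator A (fst z) * snd z)" by (simp add: ind mult.commute)
    have "(\<integral>z. snd z * indicator {z. fst z \<in> A} z \<partial>P) = (\<integral>z. indicator A (fst z) * snd z \<partial>P)"
      by (simp add: ind mult.commute)
    also have "\<dots> = (\<integral>z. indicator A (fst z) * real_cond_exp P ?F snd z \<partial>P)"
      by (rule F.real_cond_exp_intg(2)[OF i1 indF[OF A] snd, symmetric])
    also have "\<dots> = (\<integral>z. indicator A (fst z) * (indicator cube (fst z) * \<mu> (fst z)) \<partial>P)"
    proof (rule integral_cong_AE)
      show "AE z in P. indicator A (fst z) * real_cond_exp P ?F snd z = indicator A (fst z) * (indicator cube (fst z) * \<mu> (fst z))"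
        using Y1' by eventually_elim simp
      show "(\<lambda>z. indicator A (fst z) * (indicator cube (fst z) * \<mu> (fst z))) \<in> borel_measurable P"
        using measurable_compose[OF fst \<mu>m] by measurable
    qed measurable
    also have "\<dots> = (\<integral>z. (indicator cube z * f z) * (indicator A z * (indicator cube z * \<mu> z)) \<partial>lborel)"
      by (rule density[symmetric]) (use \<mu>m in measurable)
    also have "\<dots> = (\<integral>z. indicator A z * (indicator cube z * (\<mu> z * f z)) \<partial>lborel)"
      by (intro Bochner_Integration.integral_cong refl) (simp add: indicator_def)
    finally show "(\<integral>z. snd z * indicator {z. fst z \<in> A} z \<partial>P) =
       (\<integral>z. indicator A z * (indicator cube z * (\<mu> z * f z)) \<partial>lborel)" .
  qed
qed

text \<open>Carries expectations over the abstract probability space to a product space, where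
  Fubini separates data from trees. Independence within the data and within the trees gives the two
  inner product laws, independence between them the outer product.\<close>

lemma forest_sample_distr:
  fixes H :: "nat \<Rightarrow> 'w \<Rightarrow> 'd::finite history"
  assumes "forest_sample M P n B X Y H" "n \<ge> 1" "B \<ge> 1"
  defines "D \<equiv> \<lambda>\<omega>. \<lambda>i\<in>{1..n}. (X i \<omega>, Y i \<omega>)" and "T \<equiv> \<lambda>\<omega>. \<lambda>b\<in>{1..B}. H b \<omega>"
  shows "D \<in> measurable M (PiM {1..n} (\<lambda>_. P))" "T \<in> measurable M (PiM {1..B} (\<lambda>_. mondrian_law))"
    and "distr M (PiM {1..n} (\<lambda>_. P) \<Otimes>\<^sub>M PiM {1..B} (\<lambda>_. mondrian_law)) (\<lambda>\<omega>. (D \<omega>, T \<omega>)) =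
      PiM {1..n} (\<lambda>_. P) \<Otimes>\<^sub>M PiM {1..B} (\<lambda>_. mondrian_law)"
proof -
  let ?P = "PiM {1..n} (\<lambda>_. P)" and ?T = "PiM {1..B} (\<lambda>_. mondrian_law :: 'd history measure)"
  note fs = assms(1)[unfolded forest_sample_def iid_def]
  interpret M: prob_space M using fs by blast
  have iD: "M.indep_vars (\<lambda>_. P) (\<lambda>i \<omega>. (X i \<omega>, Y i \<omega>)) {1..n}"
    and dD: "\<And>i. i \<in> {1..n} \<Longrightarrow> distr M P (\<lambda>\<omega>. (X i \<omega>, Y i \<omega>)) = P"
    and iT: "M.indep_vars (\<lambda>_. mondrian_law) H {1..B}"
    and dT: "\<And>b. b \<in> {1..B} \<Longrightarrow> distr M mondrian_law (H b) = mondrian_law"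
    and ind: "M.indep_set (sets (vimage_algebra (space M) D ?P)) (sets (vimage_algebra (space M) T ?T))"
    using fs unfolding D_def T_def by blast+
  have rD: "(\<lambda>\<omega>. (X i \<omega>, Y i \<omega>)) \<in> measurable M P" if "i \<in> {1..n}" for i
    using iD that unfolding M.indep_vars_def by blast
  have rT: "H b \<in> measurable M mondrian_law" if "b \<in> {1..B}" for b
    using iT that unfolding M.indep_vars_def by blast
  show mD: "D \<in> measurable M ?P"
    unfolding D_def by (rule measurable_restrict[OF rD])
  show mT: "T \<in> measurable M ?T"
    unfolding T_def by (rule measurable_restrict[OF rT])
  have "distr M ?P D = (\<Pi>\<^sub>M i\<in>{1..n}. distr M P (\<lambda>\<omega>. (X i \<omega>, Y i \<omega>)))"
    unfolding D_def using iD rD assms(2) by (subst M.indep_vars_iff_distr_eq_PiM'[symmetric]) auto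
  also have "\<dots> = ?P" by (intro PiM_cong refl dD)
  finally have distD: "distr M ?P D = ?P" .
  have "distr M ?T T = (\<Pi>\<^sub>M b\<in>{1..B}. distr M mondrian_law (H b))"
    unfolding T_def using iT rT assms(3) by (subst M.indep_vars_iff_distr_eq_PiM'[symmetric]) auto
  also have "\<dots> = ?T" by (intro PiM_cong refl dT)
  finally have distT: "distr M ?T T = ?T" .
  interpret P: prob_space ?P using M.prob_space_distr[OF mD] by (simp only: distD)
  interpret T: prob_space ?T using M.prob_space_distr[OF mT] by (simp only: distT)
  show "distr M (?P \<Otimes>\<^sub>M ?T) (\<lambda>\<omega>. (D \<omega>, T \<omega>)) = ?P \<Otimes>\<^sub>M ?T"
  proof (rule pair_measure_eqI[symmetric])
    show "sigma_finite_measure ?P" "sigma_finite_measure ?T" by unfold_locales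
    fix U V assume U: "U \<in> sets ?P" and V: "V \<in> sets ?T"
    have mem: "D -` U \<inter> space M \<in> sets (vimage_algebra (space M) D ?P)"
      "T -` V \<inter> space M \<in> sets (vimage_algebra (space M) T ?T)"
      using U V by (auto intro: in_vimage_algebra)
    have ev: "D -` U \<inter> space M \<in> sets M" "T -` V \<inter> space M \<in> sets M"
      using measurable_sets[OF mD U] measurable_sets[OF mT V] by auto
    have "emeasure ?P U * emeasure ?T V = emeasure (distr M ?P D) U * emeasure (distr M ?T T) V"
      by (simp only: distD distT)
    also have "\<dots> = emeasure M (D -` U \<inter> space M) * emeasure M (T -` V \<inter> space M)"
      using emeasure_distr[OF mD U] emeasure_distr[OF mT V] by simp
    also have "\<dots> = emeasure M ((D -` U \<inter> space M) \<inter> (T -` V \<inter> space M))"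
      using M.indep_setD[OF ind mem] by (simp add: M.emeasure_eq_measure ennreal_mult)
    also have "(D -` U \<inter> space M) \<inter> (T -` V \<inter> space M) = (\<lambda>\<omega>. (D \<omega>, T \<omega>)) -` (U \<times> V) \<inter> space M"
      by auto
    also have "emeasure M \<dots> = emeasure (distr M (?P \<Otimes>\<^sub>M ?T) (\<lambda>\<omega>. (D \<omega>, T \<omega>))) (U \<times> V)"
      using U V mD mT by (intro emeasure_distr[symmetric]) auto
    finally show "emeasure ?P U * emeasure ?T V = emeasure (distr M (?P \<Otimes>\<^sub>M ?T) (\<lambda>\<omega>. (D \<omega>, T \<omega>))) (U \<times> V)" .
  qed simp
qed

section \<open>Joint measurability of cells and points\<close>

lemma measurable_formed [measurable]:
  "Measurable.pred (mondrian_law :: 'd::finite history measure) (\<lambda>h. formed l h n)"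
proof (induction n rule: less_induct)
  case (less n)
  show ?case
  proof (cases n)
    case (Suc m)
    have [measurable]: "Measurable.pred (mondrian_law :: 'd history measure) (\<lambda>h. formed l h (m div 2))"
      using less.IH[of "m div 2"] Suc by simp
    show ?thesis unfolding Suc formed.simps by measurable
  qed simp
qed

lemma measurable_mem_cell:
  fixes f :: "'a \<Rightarrow> real ^ 'd::finite"
  assumes [measurable]: "g \<in> measurable N mondrian_law" "f \<in> borel_measurable N"
  shows "Measurable.pred N (\<lambda>w. f w \<in> cell (g w) n)"
proof (induction n rule: less_induct)
  case (less n)
  show ?case
  proof (cases n)
    case (Suc m)
    let ?p = "m div 2"
    have [measurable]: "Measurable.pred N (\<lambda>w. f w \<in> cell (g w) ?p)"
      using less.IH[of ?p] Suc by simp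
    have [measurable]: "(\<lambda>w. f w $ j) \<in> borel_measurable N" for j
      by (rule measurable_compose[OF assms(2)])
         (intro borel_measurable_continuous_onI continuous_intros)
    have [measurable]: "(\<lambda>w. coord (g w) ?p) \<in> measurable N (count_space UNIV)"
      "(\<lambda>w. loc (g w) ?p) \<in> borel_measurable N"
      by (rule measurable_compose[OF assms(1)], measurable)+
    show ?thesis
    proof (cases "even m")
      case True
      then have eq: "f w \<in> cell (g w) n \<longleftrightarrow> f w \<in> cell (g w) ?p \<and>
          (\<forall>j. coord (g w) ?p = j \<longrightarrow> f w $ j \<le> loc (g w) ?p)" for w
        by (auto simp: Suc Let_def)
      show ?thesis unfolding eq by measurable
    next
      case False
      then have eq: "f w \<in> cell (g w) n \<longleftrightarrow> f w \<in> cell (g w) ?p \<and>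
          (\<forall>j. coord (g w) ?p = j \<longrightarrow> loc (g w) ?p < f w $ j)" for w
        by (auto simp: Suc Let_def)
      show ?thesis unfolding eq by measurable
    qed
  qed simp
qed

definition cell_data :: "real \<Rightarrow> real ^ 'd::finite \<Rightarrow> 'd history \<Rightarrow> ((real ^ 'd) \<times> real) set" where
  "cell_data l x h = {z. fst z \<in> cell_of (mondrian_partition l h) x}"

text \<open>Membership is a countable disjunction over nodes. History and point are arbitrary
  measurable functions, so that pairs of a tree and an observation as well as points with a fixed
  tree are covered.\<close>

lemma measurable_cell_of:
  fixes f :: "'a \<Rightarrow> real ^ 'd::finite"
  assumes [measurable]: "g \<in> measurable N mondrian_law" "f \<in> borel_measurable N"
  shows "Measurable.pred N (\<lambda>w. f w \<in> cell_of (mondrian_partition l (g w)) x)"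
proof -
  note [measurable] = measurable_mem_cell
  have [measurable]: "Measurable.pred N (\<lambda>w. formed l (g w) n)" "(\<lambda>w. split_due (g w) n) \<in> borel_measurable N" for n
    by (rule measurable_compose[OF assms(1)], measurable)+
  have eq: "f w \<in> cell_of (mondrian_partition l (g w)) x \<longleftrightarrow>
      (\<exists>n. formed l (g w) n \<and> l < split_due (g w) n \<and> x \<in> cell (g w) n \<and> f w \<in> cell (g w) n)" for w
    unfolding cell_of_def mondrian_partition_def by blast
  show ?thesis unfolding eq by measurable
qed

lemma forest_estimator_eq:
  fixes X :: "nat \<Rightarrow> real ^ 'd::finite"
  assumes "B \<ge> 1"
  shows "forest_estimator n B (\<lambda>b. mondrian_partition l (H b)) X Y x =
    (\<Sum>b\<in>{1..B}. local_average {1..n} (cell_data l x ((\<lambda>b\<in>{1..B}. H b) b)) snd (\<lambda>i\<in>{1..n}. (X i, Y i))) / real (card {1..B})"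
proof -
  have "local_average {1..n} (cell_data l x (H b)) snd (\<lambda>i\<in>{1..n}. (X i, Y i)) =
      (\<Sum>i=1..n. Y i * indicator (cell_of (mondrian_partition l (H b)) x) (X i)) /
       (\<Sum>i=1..n. indicator (cell_of (mondrian_partition l (H b)) x) (X i))" for b
  proof -
    have "{i \<in> {1..n}. (\<lambda>i\<in>{1..n}. (X i, Y i)) i \<in> cell_data l x (H b)} =
        {i \<in> {1..n}. X i \<in> cell_of (mondrian_partition l (H b)) x}"
      by (auto simp: cell_data_def)
    then show ?thesis
      by (simp add: local_average_def hits_def cell_data_def indicator_def sum.If_cases Int_def)
  qed
  then show ?thesis by (simp add: forest_estimator_def)
qed

text \<open>For y the diameter times \<open>l\<close>, the power y to the \<open>p\<close> is at
  most 1 plus the square of y, so the second moment controls all smaller powers at the right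
  scale.\<close>

lemma expected_diameter_powr:
  fixes x :: "real ^ 'd::finite"
  assumes l: "l > 0" and x: "x \<in> box 0 1" and p: "0 \<le> p" "p \<le> 2"
  shows "(\<integral>\<^sup>+h. ennreal (norm (final_upper l x h - final_lower l x h) powr p) \<partial>mondrian_law) \<le>
    ennreal ((1 + 8 * real CARD('d)) / l powr p)"
proof -
  interpret P: prob_space "mondrian_law :: 'd history measure" by (rule prob_space_mondrian_law)
  let ?r = "\<lambda>h. norm (final_upper l x h - final_lower l x h)"
  have r2: "(\<lambda>h. (?r h)\<^sup>2) \<in> borel_measurable mondrian_law"
    unfolding norm_vec_def L2_set_def by simp
  have "?r h powr p \<le> (1 + l\<^sup>2 * (?r h)\<^sup>2) / l powr p" for h
  proof -
    have "(l * ?r h) powr p \<le> 1 + (l * ?r h)\<^sup>2"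
    proof (cases "l * ?r h \<le> 1")
      case True
      have "(l * ?r h) powr p \<le> 1" using True l p by (intro powr_le1) auto
      then show ?thesis using zero_le_power2[of "l * ?r h"] by linarith
    next
      case False
      then have "(l * ?r h) powr p \<le> (l * ?r h) powr 2" using p by (intro powr_mono) auto
      also have "\<dots> = (l * ?r h)\<^sup>2" using False by (simp add: powr_numeral)
      finally show ?thesis by simp
    qed
    then show ?thesis using l by (simp add: powr_mult power_mult_distrib pos_le_divide_eq mult.commute)
  qed
  then have "(\<integral>\<^sup>+h. ennreal (?r h powr p) \<partial>mondrian_law) \<le> (\<integral>\<^sup>+h. ennreal ((1 + l\<^sup>2 * (?r h)\<^sup>2) / l powr p) \<partial>mondrian_law)"
    by (intro nn_integral_mono ennreal_leI)
  also have "\<dots> = (\<integral>\<^sup>+h. ennreal (1 / l powr p) * (1 + ennreal (l\<^sup>2) * ennreal ((?r h)\<^sup>2)) \<partial>mondrian_law)"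
  proof (rule nn_integral_cong)
    fix h
    have "ennreal ((1 + l\<^sup>2 * (?r h)\<^sup>2) / l powr p) = ennreal (1 / l powr p * (1 + l\<^sup>2 * (?r h)\<^sup>2))" by simp
    also have "\<dots> = ennreal (1 / l powr p) * ennreal (1 + l\<^sup>2 * (?r h)\<^sup>2)"
      by (intro ennreal_mult) auto
    also have "ennreal (1 + l\<^sup>2 * (?r h)\<^sup>2) = 1 + ennreal (l\<^sup>2) * ennreal ((?r h)\<^sup>2)"
      by (simp add: ennreal_plus ennreal_mult)
    finally show "ennreal ((1 + l\<^sup>2 * (?r h)\<^sup>2) / l powr p) = ennreal (1 / l powr p) * (1 + ennreal (l\<^sup>2) * ennreal ((?r h)\<^sup>2))" .
  qed
  also have "\<dots> = ennreal (1 / l powr p) * (1 + ennreal (l\<^sup>2) * (\<integral>\<^sup>+h. ennreal ((?r h)\<^sup>2) \<partial>mondrian_law))"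
    using r2 P.emeasure_space_1 by (simp add: nn_integral_cmult nn_integral_add)
  also have "\<dots> \<le> ennreal (1 / l powr p) * (1 + ennreal (l\<^sup>2) * ennreal (8 * real CARD('d) / l\<^sup>2))"
    by (intro mult_left_mono add_left_mono nn_integral_square_diameter[OF l x]) auto
  also have "ennreal (l\<^sup>2) * ennreal (8 * real CARD('d) / l\<^sup>2) = ennreal (8 * real CARD('d))"
    using l by (subst ennreal_mult[symmetric]) auto
  also have "ennreal (1 / l powr p) * (1 + ennreal (8 * real CARD('d))) = ennreal (1 / l powr p) * ennreal (1 + 8 * real CARD('d))"
    by (simp add: ennreal_plus)
  also have "\<dots> = ennreal (1 / l powr p * (1 + 8 * real CARD('d)))"
    by (intro ennreal_mult[symmetric]) auto
  finally show ?thesis by simp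
qed

lemma AE_mem_box_iff_mem_cbox:
  fixes a b :: "real ^ 'd::finite"
  shows "AE z in lborel. z \<in> cbox a b \<longrightarrow> z \<in> box a b"
proof -
  have "cbox a b - box a b \<in> null_sets lborel"
  proof -
    have "negligible (cbox a b - box a b)" by (rule negligible_frontier_interval)
    then have "cbox a b - box a b \<in> null_sets (completion lborel)"
      by (simp add: negligible_iff_null_sets)
    then show ?thesis by (subst (asm) null_sets_completion_iff) auto
  qed
  then show ?thesis by (rule AE_I') auto
qed

text \<open>The constant depends on the lifetime only through its lower bound \<open>l0\<close>. In
  it, \<open>6 * CY * KV / c\<close> belongs to the variance, as the mass of a cell is at least
  \<open>c\<close> times its volume; \<open>CB\<^sup>2 * D8\<close> belongs to the mean squared
  bias; and, if \<open>\<beta> > 1\<close>, \<open>CM / l powr min 2 \<beta>\<close> bounds the mean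
  bias.\<close>

lemma mondrian_forest_risk:
  fixes f \<mu> \<sigma>2 :: "real ^ 'd::finite \<Rightarrow> real" and x :: "real ^ 'd"
  assumes law: "data_law f \<mu> \<sigma>2 \<beta>f \<beta>\<mu> \<beta>\<sigma> P" and \<beta>: "\<beta> = min \<beta>\<mu> (\<beta>f + 1)"
    and x: "x \<in> box 0 1" and l0: "0 < l0"
  obtains C where "C \<ge> 0" "\<And>l n B. l \<ge> l0 \<Longrightarrow> n \<ge> 1 \<Longrightarrow> B \<ge> 1 \<Longrightarrow>
    (\<integral>\<^sup>+z. ennreal (((\<Sum>b\<in>{1..B}. local_average {1..n} (cell_data l x (snd z b)) snd (fst z)) / real (card {1..B}) - \<mu> x)\<^sup>2)
      \<partial>(PiM {1..n} (\<lambda>_. P) \<Otimes>\<^sub>M PiM {1..B} (\<lambda>_. mondrian_law))) \<le>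
    ennreal (C * (l ^ CARD('d) / real n + 1 / l powr (2 * min 2 \<beta>) + 1 / (l powr (2 * min 1 \<beta>) * real B)))"
proof -
  have \<beta>\<mu>: "0 < \<beta>\<mu>" "\<mu> \<in> holder_class \<beta>\<mu>" and \<beta>f: "0 < \<beta>f" "f \<in> holder_class \<beta>f"
    using law unfolding data_law_def by blast+
  obtain c where c: "c > 0" "\<And>z. z \<in> cube \<Longrightarrow> c \<le> f z"
    using law unfolding data_law_def by blast
  have fc: "continuous_on cube f" by (rule holder_class_continuous[OF \<beta>f])
  have \<mu>c: "continuous_on cube \<mu>" by (rule holder_class_continuous[OF \<beta>\<mu>])
  have xc: "x \<in> cube" using x box_subset_cbox by blast
  obtain CY where CY: "CY \<ge> 0" and P: "prob_space P"
    and mfst [measurable]: "fst \<in> borel_measurable P" and msnd [measurable]: "snd \<in> borel_measurable P"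
    and int2: "integrable P (\<lambda>z. (snd z)\<^sup>2)"
    and d2: "\<And>A. A \<in> sets borel \<Longrightarrow> (\<integral>z. (snd z)\<^sup>2 * indicator {z. fst z \<in> A} z \<partial>P) \<le> CY * measure P {z. fst z \<in> A}"
    and d0: "\<And>A. A \<in> sets borel \<Longrightarrow> measure P {z. fst z \<in> A} = (\<integral>z. indicator A z * (indicator cube z * f z) \<partial>lborel)"
    and d1: "\<And>A. A \<in> sets borel \<Longrightarrow> (\<integral>z. snd z * indicator {z. fst z \<in> A} z \<partial>P) =
       (\<integral>z. indicator A z * (indicator cube z * (\<mu> z * f z)) \<partial>lborel)"
    using data_law_facts[OF law] by blast
  obtain CB G where CB: "CB \<ge> 0"
    and qb: "\<And>a b. cbox a b \<subseteq> cube \<Longrightarrow> x \<in> box a b \<Longrightarrow>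
       c * measure lborel (cbox a b) \<le> (\<integral>z. indicator (cbox a b) z * f z \<partial>lborel)"
    and bias1: "\<And>a b. cbox a b \<subseteq> cube \<Longrightarrow> x \<in> box a b \<Longrightarrow>
       \<bar>(\<integral>z. indicator (cbox a b) z * ((\<mu> z - \<mu> x) * f z) \<partial>lborel) / (\<integral>z. indicator (cbox a b) z * f z \<partial>lborel)\<bar>
         \<le> CB * norm (b - a) powr min 1 \<beta>"
    and bias2: "\<And>a b. 1 < \<beta> \<Longrightarrow> cbox a b \<subseteq> cube \<Longrightarrow> x \<in> box a b \<Longrightarrow>
       \<bar>(\<integral>z. indicator (cbox a b) z * ((\<mu> z - \<mu> x) * f z) \<partial>lborel) / (\<integral>z. indicator (cbox a b) z * f z \<partial>lborel)
          - (\<Sum>i\<in>UNIV. ((a $ i + b $ i) / 2 - x $ i) * G i)\<bar>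
         \<le> CB * norm (b - a) powr min 2 \<beta>"
    using cell_bias[OF \<beta>\<mu> \<beta>f c xc \<beta>] by blast
  obtain KV where KV: "KV \<ge> 0"
    "\<And>l. l \<ge> l0 \<Longrightarrow> (\<integral>\<^sup>+h. ennreal (1 / (\<Prod>i\<in>UNIV. final_upper l x h $ i - final_lower l x h $ i)) \<partial>mondrian_law)
     \<le> ennreal (KV * l ^ CARD('d))"
    using nn_integral_inverse_volume[OF x l0] by blast
  have powr_sq: "(y powr e)\<^sup>2 = y powr (2 * e)" for y e :: real
    by (simp only: power2_eq_square powr_add[symmetric] mult_2)
  have b0: "0 < \<beta>" using \<beta>\<mu>(1) \<beta>f(1) by (simp add: \<beta>)
  define D8 where "D8 = 1 + 8 * real CARD('d)"
  have D8: "D8 \<ge> 1" by (simp add: D8_def)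
  define CG where "CG = (\<Sum>i\<in>UNIV. \<bar>G i\<bar> * (1 / x $ i + 1 / (1 - x $ i)))"
  have xi: "0 < x $ i" "x $ i < 1" for i using x by (auto simp: mem_box_cart)
  have CG: "CG \<ge> 0" unfolding CG_def using xi by (intro sum_nonneg mult_nonneg_nonneg add_nonneg_nonneg) (auto simp: less_imp_le)
  \<comment> \<open>\<open>CG / l\<^sup>2\<close> bounds the linear bias from the mean offset of the
    centre. For \<open>l \<ge> l0\<close> the factor \<open>l0 powr (min 2 \<beta> - 2)\<close>,
    with nonpositive exponent, brings this to the order of the second summand, which bounds the
    nonlinear part.\<close>
  define CM where "CM = CG * l0 powr (min 2 \<beta> - 2) + CB * D8"
  have CM: "CM \<ge> 0" unfolding CM_def using CG CB D8 by simp
  define C where "C = 6 * CY * KV / c + 2 * (CB\<^sup>2 * D8) + 2 * (CM\<^sup>2)"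
  interpret P: prob_space P by (rule P)
  let ?\<Lambda> = "mondrian_law :: 'd history measure"
  interpret \<Lambda>: prob_space ?\<Lambda> by (rule prob_space_mondrian_law)
  have main: "(\<integral>\<^sup>+z. ennreal (((\<Sum>b\<in>{1..B}. local_average {1..n} (cell_data l x (snd z b)) snd (fst z)) / real (card {1..B}) - \<mu> x)\<^sup>2)
      \<partial>(PiM {1..n} (\<lambda>_. P) \<Otimes>\<^sub>M PiM {1..B} (\<lambda>_. mondrian_law))) \<le>
    ennreal (C * (l ^ CARD('d) / real n + 1 / l powr (2 * min 2 \<beta>) + 1 / (l powr (2 * min 1 \<beta>) * real B)))"
    if ll: "l \<ge> l0" and n: "n \<ge> 1" and B: "B \<ge> 1" for l n B
  proof -
    have l: "l > 0" using ll l0 by simp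
    define lo where "lo = final_lower l x"
    define up where "up = final_upper l x"
    let ?D = "cell_data l x"
    define a where "a = (\<lambda>h. (\<integral>z. snd z * indicator (?D h) z \<partial>P) / measure P (?D h) - \<mu> x)"
    have Dm: "Measurable.pred (?\<Lambda> \<Otimes>\<^sub>M P) (\<lambda>z. snd z \<in> ?D (fst z))"
      unfolding cell_data_def mem_Collect_eq by (rule measurable_cell_of) measurable
    have cellb: "cell_of (mondrian_partition l h) x \<in> sets borel" for h :: "'d history"
    proof -
      have "Measurable.pred borel (\<lambda>y. y \<in> cell_of (mondrian_partition l h) x)"
        using measurable_cell_of[of "\<lambda>_. h" borel "\<lambda>y. y"] by simp
      then show ?thesis by (simp add: pred_def)
    qed
    have spP: "space P = UNIV"
      using law unfolding data_law_def by (metis sets_eq_imp_space_eq space_borel)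
    have DP: "?D h \<in> sets P" for h
      using measurable_sets[OF mfst cellb[of h]] by (simp add: cell_data_def vimage_def spP)
    note good = AE_final_cell[OF l x]
    let ?vol = "\<lambda>h. \<Prod>i\<in>UNIV. up h $ i - lo h $ i"
    let ?q = "\<lambda>h. \<integral>z. indicator (cbox (lo h) (up h)) z * f z \<partial>lborel"
    \<comment> \<open>The cell lies between the open and the closed box with its corners, which
      differ by a null set, so all integrals over it are integrals over a box and
      \<open>cell_bias\<close> applies.\<close>
    have facts: "AE h in ?\<Lambda>. cbox (lo h) (up h) \<subseteq> cube \<and> x \<in> box (lo h) (up h) \<and>
        0 < ?vol h \<and> measure lborel (cbox (lo h) (up h)) = ?vol h \<and>
        measure P (?D h) = ?q h \<and>
        a h = (\<integral>z. indicator (cbox (lo h) (up h)) z * ((\<mu> z - \<mu> x) * f z) \<partial>lborel) / ?q h"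
      using good
    proof eventually_elim
      case (elim h)
      let ?b = "cbox (lo h) (up h)" and ?cell = "cell_of (mondrian_partition l h) x"
      have o: "0 \<le> lo h $ i" "lo h $ i < x $ i" "x $ i < up h $ i" "up h $ i \<le> 1" for i
        using elim by (auto simp: lo_def up_def)
      have sub: "?b \<subseteq> cube"
      proof
        fix z assume z: "z \<in> ?b"
        have "0 \<le> z $ i \<and> z $ i \<le> 1" for i
          using z o(1)[of i] o(4)[of i] unfolding mem_box_cart by (meson order_trans)
        then show "z \<in> cube" by (simp add: mem_box_cart)
      qed
      note cell = elim
      have xb: "x \<in> box (lo h) (up h)" using o by (auto simp: mem_box_cart)
      have volpos: "0 < ?vol h" using o by (intro prod_pos) (auto intro: less_trans)
      have vol: "measure lborel ?b = ?vol h"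
        using xb box_subset_cbox by (subst content_cbox_cart) blast+
      have cellAE: "AE z in lborel. (indicator ?cell z :: real) = indicator ?b z"
        using AE_mem_box_iff_mem_cbox[of "lo h" "up h"]
      proof eventually_elim
        case (elim z)
        then show ?case using cell by (auto simp: indicator_def lo_def up_def)
      qed
      have conv: "(\<integral>z. indicator ?cell z * (indicator cube z * g z) \<partial>lborel) = (\<integral>z. indicator ?b z * g z \<partial>lborel)"
        if "continuous_on cube g" for g :: "real ^ 'd \<Rightarrow> real"
      proof (rule integral_cong_AE)
        show "(\<lambda>z. indicator ?cell z * (indicator cube z * g z)) \<in> borel_measurable lborel"
          using borel_measurable_cube_indicator[OF that] cellb by simp
        show "(\<lambda>z. indicator ?b z * g z) \<in> borel_measurable lborel"
          using integrable_on_cbox[OF that sub] by simp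
        show "AE z in lborel. indicator ?cell z * (indicator cube z * g z) = indicator ?b z * g z"
          using cellAE by eventually_elim (use sub in \<open>auto simp: indicator_def\<close>)
      qed
      have q: "measure P (?D h) = ?q h"
        unfolding cell_data_def d0[OF cellb] by (rule conv[OF fc])
      have qpos: "0 < ?q h"
        using qb[OF sub xb] volpos c(1) unfolding vol by (meson less_le_trans mult_pos_pos)
      have "(\<integral>z. snd z * indicator (?D h) z \<partial>P) = (\<integral>z. indicator ?b z * (\<mu> z * f z) \<partial>lborel)"
        unfolding cell_data_def d1[OF cellb] by (intro conv continuous_intros fc \<mu>c)
      moreover have "(\<integral>z. indicator ?b z * ((\<mu> z - \<mu> x) * f z) \<partial>lborel) =
          (\<integral>z. indicator ?b z * (\<mu> z * f z) - \<mu> x * (indicator ?b z * f z) \<partial>lborel)"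
        by (intro Bochner_Integration.integral_cong refl) (simp add: algebra_simps)
      moreover have "\<dots> = (\<integral>z. indicator ?b z * (\<mu> z * f z) \<partial>lborel) - \<mu> x * ?q h"
        using integrable_on_cbox[OF fc sub] integrable_on_cbox[OF continuous_on_mult[OF \<mu>c fc] sub] by simp
      ultimately have "a h = (\<integral>z. indicator ?b z * ((\<mu> z - \<mu> x) * f z) \<partial>lborel) / ?q h"
        using qpos by (simp add: a_def q diff_divide_distrib)
      then show ?case using sub xb volpos vol q by blast
    qed
    let ?r = "\<lambda>h. norm (up h - lo h)"
    have rm [measurable]: "?r \<in> borel_measurable ?\<Lambda>"
      unfolding norm_vec_def L2_set_def lo_def up_def by simp
    have rp: "(\<integral>\<^sup>+h. ennreal (?r h powr p) \<partial>?\<Lambda>) \<le> ennreal (D8 / l powr p)" if "0 \<le> p" "p \<le> 2" for p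
      unfolding D8_def lo_def up_def by (rule expected_diameter_powr[OF l x that])
    have rint: "integrable ?\<Lambda> (\<lambda>h. ?r h powr p)" "(\<integral>h. ?r h powr p \<partial>?\<Lambda>) \<le> D8 / l powr p" if "0 \<le> p" "p \<le> 2" for p
    proof -
      show i: "integrable ?\<Lambda> (\<lambda>h. ?r h powr p)"
      proof (rule integrableI_bounded)
        have "(\<integral>\<^sup>+h. ennreal (norm (?r h powr p)) \<partial>?\<Lambda>) \<le> ennreal (D8 / l powr p)" using rp[OF that] by simp
        also have "\<dots> < \<infinity>" by simp
        finally show "(\<integral>\<^sup>+h. ennreal (norm (?r h powr p)) \<partial>?\<Lambda>) < \<infinity>" .
      qed measurable
      have "ennreal (\<integral>h. ?r h powr p \<partial>?\<Lambda>) = (\<integral>\<^sup>+h. ennreal (?r h powr p) \<partial>?\<Lambda>)"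
        by (rule nn_integral_eq_integral[OF i, symmetric]) simp
      then have "ennreal (\<integral>h. ?r h powr p \<partial>?\<Lambda>) \<le> ennreal (D8 / l powr p)" using rp[OF that] by simp
      then show "(\<integral>h. ?r h powr p \<partial>?\<Lambda>) \<le> D8 / l powr p" using D8 by (subst (asm) ennreal_le_iff) auto
    qed
    have am [measurable]: "a \<in> borel_measurable ?\<Lambda>"
    proof -
      note [measurable] = borel_measurable_sections[OF P Dm DP msnd]
      show ?thesis unfolding a_def by measurable
    qed
    have a1: "AE h in ?\<Lambda>. \<bar>a h\<bar> \<le> CB * ?r h powr min 1 \<beta>"
      using facts by eventually_elim (use bias1 in simp)
    \<comment> \<open>A deterministic bound from the diameter of the cube; it makes \<open>a\<close>
      and its square integrable and is required by \<open>forest_risk\<close>.\<close>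
    have abnd: "AE h in ?\<Lambda>. \<bar>a h\<bar> \<le> CB * real CARD('d) powr min 1 \<beta>"
      using facts a1
    proof eventually_elim
      case (elim h)
      have "lo h \<in> cbox (lo h) (up h)" "up h \<in> cbox (lo h) (up h)"
        using elim(1) by (auto simp: mem_box_cart intro: less_imp_le less_trans)
      then have "?r h \<le> real CARD('d)" using elim(1) by (intro norm_diff_cube_le) auto
      then have "CB * ?r h powr min 1 \<beta> \<le> CB * real CARD('d) powr min 1 \<beta>"
        using CB b0 by (intro mult_left_mono powr_mono2) auto
      then show ?case using elim(2) by linarith
    qed
    have aint: "integrable ?\<Lambda> a"
      by (rule \<Lambda>.integrable_const_bound[OF _ am]) (use abnd in simp)
    have a2int: "integrable ?\<Lambda> (\<lambda>h. (a h)\<^sup>2)"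
      by (rule \<Lambda>.integrable_const_bound[where B = "(CB * real CARD('d) powr min 1 \<beta>)\<^sup>2"])
         (use abnd in \<open>eventually_elim, simp add: abs_le_square_iff[symmetric]\<close>, measurable)
    have Ea2: "(\<integral>h. (a h)\<^sup>2 \<partial>?\<Lambda>) \<le> CB\<^sup>2 * D8 / l powr (2 * min 1 \<beta>)"
    proof -
      have p: "0 \<le> 2 * min 1 \<beta>" "2 * min 1 \<beta> \<le> 2" using b0 by auto
      have "(\<integral>h. (a h)\<^sup>2 \<partial>?\<Lambda>) \<le> (\<integral>h. CB\<^sup>2 * ?r h powr (2 * min 1 \<beta>) \<partial>?\<Lambda>)"
      proof (rule integral_mono_AE[OF a2int])
        show "integrable ?\<Lambda> (\<lambda>h. CB\<^sup>2 * ?r h powr (2 * min 1 \<beta>))" using rint(1)[OF p] by simp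
        show "AE h in ?\<Lambda>. (a h)\<^sup>2 \<le> CB\<^sup>2 * ?r h powr (2 * min 1 \<beta>)"
          using a1
        proof eventually_elim
          case (elim h)
          have "(a h)\<^sup>2 = \<bar>a h\<bar>\<^sup>2" by simp
          also have "\<dots> \<le> (CB * ?r h powr min 1 \<beta>)\<^sup>2" using elim by (intro power_mono) auto
          also have "\<dots> = CB\<^sup>2 * ?r h powr (2 * min 1 \<beta>)"
            by (simp only: power_mult_distrib powr_sq)
          finally show ?case .
        qed
      qed
      also have "\<dots> = CB\<^sup>2 * (\<integral>h. ?r h powr (2 * min 1 \<beta>) \<partial>?\<Lambda>)" by simp
      also have "\<dots> \<le> CB\<^sup>2 * (D8 / l powr (2 * min 1 \<beta>))"
        using rint(2)[OF p] by (intro mult_left_mono) auto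
      finally show ?thesis by simp
    qed
    \<comment> \<open>For \<open>\<beta> \<le> 1\<close> the exponents \<open>min 1 \<beta>\<close>
      and \<open>min 2 \<beta>\<close> agree, and nonnegativity of the variance suffices. For
      \<open>\<beta> > 1\<close> the bias is compared with its linear part, whose mean is of order
      \<open>1 / l\<^sup>2\<close>; this is where independent trees with cells off centre compensate
      each other.\<close>
    have Ea: "(\<integral>h. a h \<partial>?\<Lambda>)\<^sup>2 \<le> (CB\<^sup>2 * D8 + CM\<^sup>2) / l powr (2 * min 2 \<beta>)"
    proof (cases "1 < \<beta>")
      case False
      have "(\<integral>h. a h \<partial>?\<Lambda>)\<^sup>2 \<le> (\<integral>h. (a h)\<^sup>2 \<partial>?\<Lambda>)"
        using \<Lambda>.variance_eq[OF aint a2int] \<Lambda>.variance_positive[of a] by linarith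
      also have "\<dots> \<le> CB\<^sup>2 * D8 / l powr (2 * min 2 \<beta>)"
        using Ea2 False by (simp add: min_def)
      also have "\<dots> \<le> (CB\<^sup>2 * D8 + CM\<^sup>2) / l powr (2 * min 2 \<beta>)"
        by (intro divide_right_mono) auto
      finally show ?thesis .
    next
      case True
      have p: "0 \<le> min 2 \<beta>" "min 2 \<beta> \<le> 2" using b0 by auto
      let ?cen = "\<lambda>h. \<Sum>i\<in>UNIV. ((lo h $ i + up h $ i) / 2 - x $ i) * G i"
      note cb = center_bias[OF l x]
      have ceni: "integrable ?\<Lambda> (\<lambda>h. (lo h $ i + up h $ i) / 2 - x $ i)" for i
        using cb(1,2) by (simp add: lo_def up_def)
      have cenint: "integrable ?\<Lambda> ?cen"
        using ceni by (intro Bochner_Integration.integrable_sum integrable_mult_left)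
      have "\<bar>\<integral>h. ?cen h \<partial>?\<Lambda>\<bar> = \<bar>\<Sum>i\<in>UNIV. (\<integral>h. (lo h $ i + up h $ i) / 2 - x $ i \<partial>?\<Lambda>) * G i\<bar>"
        using ceni by (subst Bochner_Integration.integral_sum) auto
      also have "\<dots> \<le> (\<Sum>i\<in>UNIV. \<bar>(\<integral>h. (lo h $ i + up h $ i) / 2 - x $ i \<partial>?\<Lambda>) * G i\<bar>)" by (rule sum_abs)
      also have "\<dots> \<le> (\<Sum>i\<in>UNIV. ((1 / x $ i + 1 / (1 - x $ i)) / l\<^sup>2) * \<bar>G i\<bar>)"
        unfolding abs_mult lo_def up_def by (intro sum_mono mult_right_mono cb(3)) auto
      also have "\<dots> = CG / l\<^sup>2"
        by (simp add: CG_def sum_divide_distrib mult.commute)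
      finally have cen: "\<bar>\<integral>h. ?cen h \<partial>?\<Lambda>\<bar> \<le> CG / l\<^sup>2" .
      have "\<bar>\<integral>h. a h - ?cen h \<partial>?\<Lambda>\<bar> \<le> (\<integral>h. \<bar>a h - ?cen h\<bar> \<partial>?\<Lambda>)" by (rule integral_abs_bound)
      also have "\<dots> \<le> (\<integral>h. CB * ?r h powr min 2 \<beta> \<partial>?\<Lambda>)"
      proof (rule integral_mono_AE)
        show "integrable ?\<Lambda> (\<lambda>h. \<bar>a h - ?cen h\<bar>)" using aint cenint by simp
        show "integrable ?\<Lambda> (\<lambda>h. CB * ?r h powr min 2 \<beta>)" using rint(1)[OF p] by simp
        show "AE h in ?\<Lambda>. \<bar>a h - ?cen h\<bar> \<le> CB * ?r h powr min 2 \<beta>"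
          using facts by eventually_elim (use bias2[OF True] in simp)
      qed
      also have "\<dots> \<le> CB * (D8 / l powr min 2 \<beta>)"
        using mult_left_mono[OF rint(2)[OF p] CB] by simp
      finally have dev: "\<bar>\<integral>h. a h - ?cen h \<partial>?\<Lambda>\<bar> \<le> CB * D8 / l powr min 2 \<beta>" by simp
      have l2: "1 / l\<^sup>2 \<le> l0 powr (min 2 \<beta> - 2) / l powr min 2 \<beta>"
      proof -
        have "1 / l\<^sup>2 = l powr (min 2 \<beta> - 2) / l powr min 2 \<beta>"
          using l by (simp add: powr_diff powr_numeral)
        also have "\<dots> \<le> l0 powr (min 2 \<beta> - 2) / l powr min 2 \<beta>"
          using ll l0 p by (intro divide_right_mono powr_mono2') auto
        finally show ?thesis .
      qed
      have "\<bar>\<integral>h. a h \<partial>?\<Lambda>\<bar> \<le> CG * (1 / l\<^sup>2) + CB * D8 / l powr min 2 \<beta>"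
        using cen dev aint cenint by simp
      also have "\<dots> \<le> CG * (l0 powr (min 2 \<beta> - 2) / l powr min 2 \<beta>) + CB * D8 / l powr min 2 \<beta>"
        using l2 CG by (intro add_right_mono mult_left_mono)
      also have "\<dots> = CM / l powr min 2 \<beta>"
        by (simp add: CM_def add_divide_distrib)
      finally have "(\<integral>h. a h \<partial>?\<Lambda>)\<^sup>2 \<le> (CM / l powr min 2 \<beta>)\<^sup>2"
        using CM by (simp add: abs_le_square_iff[symmetric])
      also have "\<dots> = CM\<^sup>2 / l powr (2 * min 2 \<beta>)"
        by (simp only: power_divide powr_sq)
      also have "\<dots> \<le> (CB\<^sup>2 * D8 + CM\<^sup>2) / l powr (2 * min 2 \<beta>)"
        using D8 by (intro divide_right_mono) auto
      finally show ?thesis .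
    qed
    have inv: "(\<integral>\<^sup>+h. ennreal (1 / measure P (?D h)) \<partial>?\<Lambda>) \<le> ennreal (KV * l ^ CARD('d) / c)"
    proof -
      have "(\<integral>\<^sup>+h. ennreal (1 / measure P (?D h)) \<partial>?\<Lambda>) \<le> (\<integral>\<^sup>+h. ennreal (1 / c) * ennreal (1 / ?vol h) \<partial>?\<Lambda>)"
      proof (rule nn_integral_mono_AE)
        show "AE h in ?\<Lambda>. ennreal (1 / measure P (?D h)) \<le> ennreal (1 / c) * ennreal (1 / ?vol h)"
          using facts
        proof eventually_elim
          case (elim h)
          have "c * ?vol h \<le> measure P (?D h)" using qb[of "lo h" "up h"] elim by simp
          then have "1 / measure P (?D h) \<le> 1 / (c * ?vol h)"
            using c(1) elim by (intro divide_left_mono) (auto intro: less_le_trans[OF mult_pos_pos])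
          also have "\<dots> = 1 / c * (1 / ?vol h)" by simp
          finally have "ennreal (1 / measure P (?D h)) \<le> ennreal (1 / c * (1 / ?vol h))" by (rule ennreal_leI)
          also have "\<dots> = ennreal (1 / c) * ennreal (1 / ?vol h)"
            using c(1) elim by (intro ennreal_mult) auto
          finally show ?case .
        qed
      qed
      also have "\<dots> = ennreal (1 / c) * (\<integral>\<^sup>+h. ennreal (1 / ?vol h) \<partial>?\<Lambda>)"
        unfolding lo_def up_def by (rule nn_integral_cmult) measurable
      also have "\<dots> \<le> ennreal (1 / c) * ennreal (KV * l ^ CARD('d))"
        unfolding lo_def up_def by (intro mult_left_mono KV(2)[OF ll]) auto
      also have "\<dots> = ennreal (1 / c * (KV * l ^ CARD('d)))"
        using c(1) KV(1) l by (intro ennreal_mult[symmetric]) auto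
      finally show ?thesis by simp
    qed
    have "(\<integral>\<^sup>+z. ennreal (((\<Sum>b\<in>{1..B}. local_average {1..n} (?D (snd z b)) snd (fst z)) / real (card {1..B}) - \<mu> x)\<^sup>2)
        \<partial>(PiM {1..n} (\<lambda>_. P) \<Otimes>\<^sub>M PiM {1..B} (\<lambda>_. ?\<Lambda>))) \<le>
      ennreal (6 * CY / real (card {1..n})) * (\<integral>\<^sup>+h. ennreal (1 / measure P (?D h)) \<partial>?\<Lambda>) +
      ennreal (2 * ((\<integral>h. (a h)\<^sup>2 \<partial>?\<Lambda>) / real (card {1..B}) + (\<integral>h. a h \<partial>?\<Lambda>)\<^sup>2))"
      unfolding a_def
    proof (rule forest_risk[OF P prob_space_mondrian_law _ _ _ _ Dm DP msnd int2 CY])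
      show "(\<integral>z. (snd z)\<^sup>2 * indicator (?D h) z \<partial>P) \<le> CY * measure P (?D h)" for h
        unfolding cell_data_def by (rule d2[OF cellb])
      show "AE h in ?\<Lambda>. 0 < measure P (?D h)"
        using facts
      proof eventually_elim
        case (elim h)
        then have "c * ?vol h \<le> measure P (?D h)" using qb[of "lo h" "up h"] by simp
        then show ?case using c(1) elim by (auto intro: less_le_trans[OF mult_pos_pos])
      qed
      show "AE h in ?\<Lambda>. \<bar>(\<integral>z. snd z * indicator (?D h) z \<partial>P) / measure P (?D h) - \<mu> x\<bar> \<le> CB * real CARD('d) powr min 1 \<beta>"
        using abnd by (simp add: a_def)
    qed (use n B in auto)
    also have "\<dots> \<le> ennreal (6 * CY / real n) * ennreal (KV * l ^ CARD('d) / c) +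
        ennreal (2 * ((CB\<^sup>2 * D8 / l powr (2 * min 1 \<beta>)) / real B + (CB\<^sup>2 * D8 + CM\<^sup>2) / l powr (2 * min 2 \<beta>)))"
      using inv Ea divide_right_mono[OF Ea2, of "real B"] by (intro add_mono mult_mono ennreal_leI) auto
    also have "\<dots> = ennreal (6 * CY / real n * (KV * l ^ CARD('d) / c) +
        2 * ((CB\<^sup>2 * D8 / l powr (2 * min 1 \<beta>)) / real B + (CB\<^sup>2 * D8 + CM\<^sup>2) / l powr (2 * min 2 \<beta>)))"
      using CY KV(1) l c(1) D8
      by (subst ennreal_mult[symmetric]; (subst ennreal_plus[symmetric])?; (intro add_nonneg_nonneg mult_nonneg_nonneg divide_nonneg_nonneg)?; auto)
    also have "\<dots> \<le> ennreal (C * (l ^ CARD('d) / real n + 1 / l powr (2 * min 2 \<beta>) + 1 / (l powr (2 * min 1 \<beta>) * real B)))"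
    proof (rule ennreal_leI)
      define u where "u = l ^ CARD('d) / real n"
      define v where "v = 1 / l powr (2 * min 2 \<beta>)"
      define w where "w = 1 / (l powr (2 * min 1 \<beta>) * real B)"
      have nn: "0 \<le> u" "0 \<le> v" "0 \<le> w" using l by (auto simp: u_def v_def w_def)
      have k: "0 \<le> 6 * CY * KV / c" "0 \<le> CB\<^sup>2 * D8" using CY KV(1) c(1) D8 by auto
      have "6 * CY / real n * (KV * l ^ CARD('d) / c) +
        2 * ((CB\<^sup>2 * D8 / l powr (2 * min 1 \<beta>)) / real B + (CB\<^sup>2 * D8 + CM\<^sup>2) / l powr (2 * min 2 \<beta>)) =
        (6 * CY * KV / c) * u + 2 * (CB\<^sup>2 * D8) * w + 2 * (CB\<^sup>2 * D8 + CM\<^sup>2) * v"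
        by (simp add: u_def v_def w_def mult_ac)
      also have "\<dots> \<le> C * u + C * w + C * v"
        using nn k by (intro add_mono mult_right_mono) (auto simp: C_def)
      finally show "6 * CY / real n * (KV * l ^ CARD('d) / c) +
        2 * ((CB\<^sup>2 * D8 / l powr (2 * min 1 \<beta>)) / real B + (CB\<^sup>2 * D8 + CM\<^sup>2) / l powr (2 * min 2 \<beta>)) \<le>
        C * (l ^ CARD('d) / real n + 1 / l powr (2 * min 2 \<beta>) + 1 / (l powr (2 * min 1 \<beta>) * real B))"
        unfolding u_def[symmetric] v_def[symmetric] w_def[symmetric] by (simp add: algebra_simps)
    qed
    finally show ?thesis .
  qed
  have "C \<ge> 0" using CY KV(1) c(1) D8 by (simp add: C_def)
  then show thesis using that main by blast
qed

text \<open>Used with \<open>s = min 2 \<beta>\<close> and \<open>t = min 1 \<beta>\<close>. All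
  three terms get the same exponent: \<open>real d * e - 1 = - (2 * s * e)\<close> balances variance
  against squared bias, and the lower bound on \<open>B\<close> supplies exactly the missing
  \<open>(2 * s - 2 * t) * e\<close> in the third term.\<close>

lemma risk_rate:
  fixes l :: "nat \<Rightarrow> real" and B :: "nat \<Rightarrow> nat" and d :: nat and s t :: real
  defines "e \<equiv> 1 / (real d + 2 * s)"
  assumes d: "d \<ge> 1" and s: "0 < t" "t \<le> s"
    and l: "\<And>n. n \<ge> 1 \<Longrightarrow> l n > 0" and B: "\<And>n. n \<ge> 1 \<Longrightarrow> B n \<ge> 1"
    and so: "same_order l (\<lambda>n. real n powr e)"
    and lB: "(\<lambda>n. real n powr ((2 * s - 2 * t) / (real d + 2 * s))) \<lessapprox> (\<lambda>n. real (B n))"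
  shows "(\<lambda>n. l n ^ d / real n + 1 / l n powr (2 * s) + 1 / (l n powr (2 * t) * real (B n)))
     \<lessapprox> (\<lambda>n. real n powr (- (2 * s) / (real d + 2 * s)))"
proof -
  have ds: "0 < real d + 2 * s" using d s by simp
  obtain K1 where K1: "\<And>n. n \<ge> 1 \<Longrightarrow> l n \<le> K1 * real n powr e"
    using so unfolding same_order_def lesssim_def by blast
  obtain K2 where K2: "\<And>n. n \<ge> 1 \<Longrightarrow> real n powr e \<le> K2 * l n"
    using so unfolding same_order_def lesssim_def by blast
  obtain K3 where K3: "\<And>n. n \<ge> 1 \<Longrightarrow> real n powr ((2 * s - 2 * t) / (real d + 2 * s)) \<le> K3 * real (B n)"
    using lB unfolding lesssim_def by blast
  \<comment> \<open>The definition of \<open>\<lessapprox>\<close> does not fix the sign of the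
    constant; the instance \<open>n = 1\<close>, where the power equals 1, does.\<close>
  have K2p: "0 < K2"
  proof -
    have "0 < K2 * l 1" using K2[of 1] by simp
    then show ?thesis using l[of 1] by (simp add: zero_less_mult_iff)
  qed
  have K3p: "0 < K3"
  proof -
    have "0 < K3 * real (B 1)" using K3[of 1] by simp
    then show ?thesis using B[of 1] by (simp add: zero_less_mult_iff)
  qed
  have bound: "l n ^ d / real n + 1 / l n powr (2 * s) + 1 / (l n powr (2 * t) * real (B n)) \<le>
      (K1 ^ d + K2 powr (2 * s) + K2 powr (2 * t) * K3) * real n powr (- (2 * s) / (real d + 2 * s))" if n: "n \<ge> 1" for n
  proof -
    let ?N = "real n" and ?R = "real n powr (- (2 * s) / (real d + 2 * s))"
    have N: "?N > 0" using n by simp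
    have "l n ^ d \<le> (K1 * ?N powr e) ^ d" using K1[OF n] l[OF n] by (intro power_mono) auto
    also have "\<dots> = K1 ^ d * ?N powr (real d * e)"
      using N by (simp add: power_mult_distrib powr_realpow[symmetric] powr_powr mult.commute)
    finally have "l n ^ d / ?N \<le> K1 ^ d * ?N powr (real d * e) / ?N"
      using N by (intro divide_right_mono) auto
    also have "\<dots> = K1 ^ d * ?N powr (real d * e - 1)"
      using N by (simp add: powr_diff)
    also have "real d * e - 1 = - (2 * s) / (real d + 2 * s)"
      using ds by (simp add: e_def field_simps)
    finally have t1: "l n ^ d / ?N \<le> K1 ^ d * ?R" .
    have inv: "1 / l n powr (2 * r) \<le> K2 powr (2 * r) * ?N powr (- (2 * r * e))" if r: "r > 0" for r
    proof -
      have "(?N powr e) powr (2 * r) \<le> (K2 * l n) powr (2 * r)"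
        using K2[OF n] r by (intro powr_mono2) auto
      then have le: "?N powr (2 * r * e) \<le> K2 powr (2 * r) * l n powr (2 * r)"
        using K2p l[OF n] by (simp add: powr_powr powr_mult mult.commute)
      have "1 / l n powr (2 * r) = ?N powr (2 * r * e) / (?N powr (2 * r * e) * l n powr (2 * r))"
        using N by simp
      also have "\<dots> \<le> (K2 powr (2 * r) * l n powr (2 * r)) / (?N powr (2 * r * e) * l n powr (2 * r))"
        using le N l[OF n] by (intro divide_right_mono) auto
      also have "\<dots> = K2 powr (2 * r) / ?N powr (2 * r * e)"
        using l[OF n] by simp
      finally show ?thesis by (simp add: powr_minus divide_inverse)
    qed
    have t2: "1 / l n powr (2 * s) \<le> K2 powr (2 * s) * ?R"
      using inv[of s] s by (simp add: e_def)
    have t3: "1 / (l n powr (2 * t) * real (B n)) \<le> K2 powr (2 * t) * K3 * ?R"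
    proof -
      let ?g = "(2 * s - 2 * t) / (real d + 2 * s)"
      have Bn: "real (B n) > 0" using B[OF n] by simp
      have "1 / real (B n) \<le> K3 / ?N powr ?g"
        using K3[OF n] Bn N by (simp add: field_simps)
      then have "(1 / l n powr (2 * t)) * (1 / real (B n)) \<le> (K2 powr (2 * t) * ?N powr (- (2 * t * e))) * (K3 / ?N powr ?g)"
        using inv[of t] s Bn K3p by (intro mult_mono) auto
      also have "\<dots> = K2 powr (2 * t) * K3 * (?N powr (- (2 * t * e)) * ?N powr (- ?g))"
        by (simp add: powr_minus divide_inverse)
      also have "?N powr (- (2 * t * e)) * ?N powr (- ?g) = ?N powr (- (2 * t * e) + - ?g)"
        by (rule powr_add[symmetric])
      also have "- (2 * t * e) + - ?g = - (2 * s) / (real d + 2 * s)"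
        using ds by (simp add: e_def add_divide_distrib[symmetric] diff_divide_distrib)
      finally show ?thesis by simp
    qed
    show ?thesis using t1 t2 t3 by (simp add: distrib_right)
  qed
  then show ?thesis unfolding lesssim_def by blast
qed

text \<open>The constants may be negative. The first one is replaced by \<open>max 0 C1\<close>,
  which is legitimate because \<open>b\<close> is nonnegative.\<close>

lemma lesssim_trans_nonneg:
  assumes "a \<lessapprox> b" "b \<lessapprox> c" "\<And>n. n \<ge> 1 \<Longrightarrow> 0 \<le> b n"
  shows "a \<lessapprox> c"
proof -
  obtain C1 where C1: "\<And>n. n \<ge> 1 \<Longrightarrow> a n \<le> C1 * b n" using assms(1) unfolding lesssim_def by blast
  obtain C2 where C2: "\<And>n. n \<ge> 1 \<Longrightarrow> b n \<le> C2 * c n" using assms(2) unfolding lesssim_def by blast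
  have "a n \<le> max 0 C1 * C2 * c n" if n: "n \<ge> 1" for n
  proof -
    have "a n \<le> max 0 C1 * b n"
      using C1[OF n] assms(3)[OF n] by (meson max.cobounded2 mult_right_mono order_trans)
    also have "\<dots> \<le> max 0 C1 * (C2 * c n)" using C2[OF n] by (intro mult_left_mono) auto
    finally show ?thesis by (simp add: mult.assoc)
  qed
  then show ?thesis unfolding lesssim_def by blast
qed

text \<open>The logarithm vanishes at \<open>n = 1\<close>, so the growth condition bounds
  \<open>l n\<close> away from 0 only from 2 on, and \<open>l 1\<close> itself settles the first
  value. The uniform lower bound is what the constant of \<open>mondrian_forest_risk\<close> depends
  on.\<close>

lemma lesssim_ln_lower_bound:
  fixes l :: "nat \<Rightarrow> real"
  assumes "(\<lambda>n. ln (real n) ^ 3) \<lessapprox> l" and pos: "\<And>n. n \<ge> 1 \<Longrightarrow> l n > 0"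
  obtains l0 where "l0 > 0" "\<And>n. n \<ge> 1 \<Longrightarrow> l0 \<le> l n"
proof -
  obtain C where C: "\<And>n. n \<ge> 1 \<Longrightarrow> ln (real n) ^ 3 \<le> C * l n"
    using assms(1) unfolding lesssim_def by blast
  define C' where "C' = max 1 C"
  define m where "m = ln 2 ^ 3 / C'"
  have m: "0 < m" unfolding m_def C'_def by simp
  have "l n \<ge> min (l 1) m" if n: "n \<ge> 1" for n
  proof (cases "n = 1")
    case False
    then have n2: "real n \<ge> 2" using n by simp
    have "ln 2 ^ 3 \<le> ln (real n) ^ 3"
      using n2 by (intro power_mono) auto
    also have "\<dots> \<le> C * l n" by (rule C[OF n])
    finally have le: "ln 2 ^ 3 \<le> C * l n" .
    have "l n > 0" by (rule pos[OF n])
    then have "ln 2 ^ 3 \<le> C' * l n" using le unfolding C'_def by (meson max.cobounded2 mult_right_mono less_imp_le order_trans)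
    then have "m \<le> l n" unfolding m_def C'_def by (simp add: pos_divide_le_eq mult.commute)
    then show ?thesis by simp
  qed simp
  then show ?thesis using that[of "min (l 1) m"] pos[of 1] m by simp
qed

text \<open>Integrability of the loss is part of the claim because \<open>mse\<close> is a Bochner
  integral, which would be 0 for a loss that is not integrable.\<close>

theorem theorem1:
  fixes P :: "((real ^ 'd::finite) \<times> real) measure"
    and f \<mu> \<sigma>2 :: "real ^ 'd \<Rightarrow> real"
    and \<beta>f \<beta>\<mu> \<beta>\<sigma> \<beta> :: real
    and x :: "real ^ 'd"
    and l :: "nat \<Rightarrow> real"
    and B :: "nat \<Rightarrow> nat"
    and M :: "nat \<Rightarrow> 'w measure"
    and X :: "nat \<Rightarrow> nat \<Rightarrow> 'w \<Rightarrow> real ^ 'd"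
    and Y :: "nat \<Rightarrow> nat \<Rightarrow> 'w \<Rightarrow> real"
    and H :: "nat \<Rightarrow> nat \<Rightarrow> 'w \<Rightarrow> 'd history"
    and mse :: "nat \<Rightarrow> real"
  assumes "data_law f \<mu> \<sigma>2 \<beta>f \<beta>\<mu> \<beta>\<sigma> P"
    and "\<beta> = min \<beta>\<mu> (\<beta>f + 1)"
    and "\<And>n. n \<ge> 1 \<Longrightarrow> forest_sample (M n) P n (B n) (X n) (Y n) (H n)"
    and "x \<in> box 0 1"
    and "\<And>n. n \<ge> 1 \<Longrightarrow> l n > 0"
    and "\<And>n. n \<ge> 1 \<Longrightarrow> B n \<ge> 1"
    and "(\<lambda>n. ln (real n) ^ 3) \<lessapprox> l"
    and "filterlim (\<lambda>n. real n / l n ^ CARD('d)) at_top sequentially"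
    and "(\<lambda>n. ln (real n) ^ CARD('d)) \<lessapprox> (\<lambda>n. real (B n))"
    and "\<And>n. mse n = (\<integral>\<omega>. (mondrian_forest n (l n) (B n) (X n) (Y n) (H n) x \<omega> - \<mu> x)\<^sup>2 \<partial>M n)"
  shows "(\<forall>n\<ge>1. integrable (M n)
           (\<lambda>\<omega>. (mondrian_forest n (l n) (B n) (X n) (Y n) (H n) x \<omega> - \<mu> x)\<^sup>2)) \<and>
         mse \<lessapprox> (\<lambda>n. l n ^ CARD('d) / real n
                       + 1 / l n powr (2 * min 2 \<beta>)
                       + 1 / (l n powr (2 * min 1 \<beta>) * real (B n))) \<and>
         (same_order l (\<lambda>n. real n powr (1 / (CARD('d) + 2 * min 2 \<beta>))) \<longrightarrow>
          (\<lambda>n. real n powr ((2 * min 2 \<beta> - 2 * min 1 \<beta>) / (CARD('d) + 2 * min 2 \<beta>)))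
            \<lessapprox> (\<lambda>n. real (B n)) \<longrightarrow>
          mse \<lessapprox> (\<lambda>n. real n powr (- (2 * min 2 \<beta>) / (CARD('d) + 2 * min 2 \<beta>))))"
proof -
  let ?bound = "\<lambda>n. l n ^ CARD('d) / real n + 1 / l n powr (2 * min 2 \<beta>) + 1 / (l n powr (2 * min 1 \<beta>) * real (B n))"
  let ?loss = "\<lambda>n \<omega>. (mondrian_forest n (l n) (B n) (X n) (Y n) (H n) x \<omega> - \<mu> x)\<^sup>2"
  obtain l0 where l0: "l0 > 0" "\<And>n. n \<ge> 1 \<Longrightarrow> l0 \<le> l n"
    using lesssim_ln_lower_bound[OF assms(7,5)] by blast
  obtain C where C: "C \<ge> 0" "\<And>l n B. l \<ge> l0 \<Longrightarrow> n \<ge> 1 \<Longrightarrow> B \<ge> 1 \<Longrightarrow>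
    (\<integral>\<^sup>+z. ennreal (((\<Sum>b\<in>{1..B}. local_average {1..n} (cell_data l x (snd z b)) snd (fst z)) / real (card {1..B}) - \<mu> x)\<^sup>2)
      \<partial>(PiM {1..n} (\<lambda>_. P) \<Otimes>\<^sub>M PiM {1..B} (\<lambda>_. mondrian_law))) \<le>
    ennreal (C * (l ^ CARD('d) / real n + 1 / l powr (2 * min 2 \<beta>) + 1 / (l powr (2 * min 1 \<beta>) * real B)))"
    using mondrian_forest_risk[OF assms(1,2,4) l0(1)] by blast
  have \<beta>0: "0 < \<beta>"
    using assms(1) unfolding data_law_def assms(2) by simp
  have bound0: "0 \<le> ?bound n" if "n \<ge> 1" for n
    using assms(5)[OF that] by (intro add_nonneg_nonneg) auto
  \<comment> \<open>The loss is a measurable function \<open>F\<close> of the sample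
    \<open>V\<close>, whose law is the product measure, so the bound on the product space transfers
    to \<open>M n\<close>.\<close>
  have risk: "?loss n \<in> borel_measurable (M n)" "(\<integral>\<^sup>+\<omega>. ennreal (?loss n \<omega>) \<partial>M n) \<le> ennreal (C * ?bound n)"
    if n: "n \<ge> 1" for n
  proof -
    let ?P = "PiM {1..n} (\<lambda>_. P)" and ?T = "PiM {1..B n} (\<lambda>_. mondrian_law :: 'd history measure)"
    define F where "F z = (((\<Sum>b\<in>{1..B n}. local_average {1..n} (cell_data (l n) x (snd z b)) snd (fst z)) /
      real (card {1..B n}) - \<mu> x)\<^sup>2)" for z :: "(nat \<Rightarrow> (real ^ 'd) \<times> real) \<times> (nat \<Rightarrow> 'd history)"
    define V where "V \<omega> = ((\<lambda>i\<in>{1..n}. (X n i \<omega>, Y n i \<omega>)), (\<lambda>b\<in>{1..B n}. H n b \<omega>))" for \<omega>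
    note fs = forest_sample_distr[OF assms(3)[OF n] n assms(6)[OF n]]
    have V: "V \<in> measurable (M n) (?P \<Otimes>\<^sub>M ?T)"
      unfolding V_def by (rule measurable_Pair[OF fs(1,2)])
    have D: "distr (M n) (?P \<Otimes>\<^sub>M ?T) V = ?P \<Otimes>\<^sub>M ?T"
      unfolding V_def by (rule fs(3))
    have loss: "?loss n \<omega> = F (V \<omega>)" for \<omega>
      unfolding mondrian_forest_def F_def V_def fst_conv snd_conv
      by (subst forest_estimator_eq[OF assms(6)[OF n]]) simp
    have [measurable]: "fst \<in> borel_measurable P" and msnd: "snd \<in> borel_measurable P"
      using data_law_facts[OF assms(1)] by metis+
    have "Measurable.pred ((mondrian_law :: 'd history measure) \<Otimes>\<^sub>M P) (\<lambda>z. snd z \<in> cell_data (l n) x (fst z))"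
      unfolding cell_data_def mem_Collect_eq by (rule measurable_cell_of) measurable
    then have [measurable]: "(\<lambda>z. local_average {1..n} (cell_data (l n) x (snd z b)) snd (fst z)) \<in> borel_measurable (?P \<Otimes>\<^sub>M ?T)"
      if "b \<in> {1..B n}" for b
      using that by (intro measurable_local_average msnd) auto
    have F: "F \<in> borel_measurable (?P \<Otimes>\<^sub>M ?T)"
      unfolding F_def by measurable
    show "?loss n \<in> borel_measurable (M n)"
      unfolding loss by (rule measurable_compose[OF V F])
    have "(\<integral>\<^sup>+\<omega>. ennreal (?loss n \<omega>) \<partial>M n) = (\<integral>\<^sup>+z. ennreal (F z) \<partial>distr (M n) (?P \<Otimes>\<^sub>M ?T) V)"
      unfolding loss using F by (intro nn_integral_distr[OF V, symmetric]) simp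
    also have "\<dots> \<le> ennreal (C * ?bound n)"
      unfolding D F_def by (rule C(2)[OF l0(2)[OF n] n assms(6)[OF n]])
    finally show "(\<integral>\<^sup>+\<omega>. ennreal (?loss n \<omega>) \<partial>M n) \<le> ennreal (C * ?bound n)" .
  qed
  have int: "integrable (M n) (?loss n)" if n: "n \<ge> 1" for n
  proof (rule integrableI_bounded[OF risk(1)[OF n]])
    have "(\<integral>\<^sup>+\<omega>. ennreal (norm (?loss n \<omega>)) \<partial>M n) \<le> ennreal (C * ?bound n)"
      using risk(2)[OF n] by simp
    also have "\<dots> < \<infinity>" by simp
    finally show "(\<integral>\<^sup>+\<omega>. ennreal (norm (?loss n \<omega>)) \<partial>M n) < \<infinity>" .
  qed
  have "mse n \<le> C * ?bound n" if n: "n \<ge> 1" for n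
  proof -
    have "ennreal (mse n) = (\<integral>\<^sup>+\<omega>. ennreal (?loss n \<omega>) \<partial>M n)"
      unfolding assms(10) by (rule nn_integral_eq_integral[OF int[OF n], symmetric]) simp
    then have "ennreal (mse n) \<le> ennreal (C * ?bound n)"
      using risk(2)[OF n] by (simp only:)
    then show ?thesis
      by (rule ennreal_le_iff[THEN iffD1, rotated]) (rule mult_nonneg_nonneg[OF C(1) bound0[OF n]])
  qed
  then have mse: "mse \<lessapprox> ?bound" unfolding lesssim_def by blast
  have "mse \<lessapprox> (\<lambda>n. real n powr (- (2 * min 2 \<beta>) / (real CARD('d) + 2 * min 2 \<beta>)))"
    if "same_order l (\<lambda>n. real n powr (1 / (real CARD('d) + 2 * min 2 \<beta>)))"
      and "(\<lambda>n. real n powr ((2 * min 2 \<beta> - 2 * min 1 \<beta>) / (real CARD('d) + 2 * min 2 \<beta>))) \<lessapprox> (\<lambda>n. real (B n))"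
  proof (rule lesssim_trans_nonneg[OF mse _ bound0])
    show "?bound \<lessapprox> (\<lambda>n. real n powr (- (2 * min 2 \<beta>) / (real CARD('d) + 2 * min 2 \<beta>)))"
      using \<beta>0 that assms(5,6) by (intro risk_rate) (auto simp: Suc_le_eq)
  qed
  then show ?thesis using int mse by blast
qed

end
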